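(* For every integer $\ell$, the permutation class $\operatorname{Av}(24153, 31524, \ell(\ell-1)\cdots 21)$ is strongly rational.
   Context: $\operatorname{Av}(B)$ is the set of permutations containing no element of $B$ as a pattern (a subsequence order isomorphic to it); $\ell(\ell-1)\cdots 21$ is the decreasing permutation of length $\ell$. A permutation class is a set of permutations closed downward under pattern containment. The generating function of a class $\mathcal{C}$ is $\sum_{\pi\in\mathcal{C}}x^{|\pi|}$, where $|\pi|$ is the length of $\pi$. A class is strongly rational if it and every one of its subclasses have rational generating functions. *)

theory Defs
  imports
    "HOL-Library.Sublist"
    "HOL-Combinatorics.Multiset_Permutations"
    "HOL-Computational_Algebra.Polynomial_FPS"
begin

text \<open>
  A permutation of length \<open>n\<close> is written in one-line notation, as a list that contains each of
  \<open>1, \<dots>, n\<close> exactly once. The empty permutation is allowed.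
\<close>
definition is_perm :: "nat list \<Rightarrow> bool" where
  "is_perm \<pi> \<longleftrightarrow> \<pi> \<in> permutations_of_set {1..length \<pi>}"

definition order_isomorphic :: "nat list \<Rightarrow> nat list \<Rightarrow> bool" where
  "order_isomorphic xs ys \<longleftrightarrow> length xs = length ys \<and>
     (\<forall>i < length xs. \<forall>j < length xs. xs ! i < xs ! j \<longleftrightarrow> ys ! i < ys ! j)"

definition contains_pattern :: "nat list \<Rightarrow> nat list \<Rightarrow> bool" where
  "contains_pattern \<pi> \<sigma> \<longleftrightarrow> (\<exists>xs. subseq xs \<pi> \<and> order_isomorphic xs \<sigma>)"

definition Av :: "nat list set \<Rightarrow> nat list set" where
  "Av B = {\<pi>. is_perm \<pi> \<and> (\<forall>\<beta> \<in> B. \<not> contains_pattern \<pi> \<beta>)}"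

definition decreasing_perm :: "nat \<Rightarrow> nat list" where
  "decreasing_perm l = rev [1..<Suc l]"

definition perm_class :: "nat list set \<Rightarrow> bool" where
  "perm_class C \<longleftrightarrow> (\<forall>\<pi> \<in> C. is_perm \<pi>) \<and>
     (\<forall>\<pi> \<in> C. \<forall>\<sigma>. is_perm \<sigma> \<and> contains_pattern \<pi> \<sigma> \<longrightarrow> \<sigma> \<in> C)"

text \<open>
  The sum over all \<open>\<pi> \<in> C\<close> of \<open>x\<close> to the power \<open>length \<pi>\<close>, with like powers collected. For sets of
  permutations the cardinalities are those of finite sets.
\<close>
definition class_gf :: "nat list set \<Rightarrow> rat fps" where
  "class_gf C = Abs_fps (\<lambda>n. of_nat (card {\<pi> \<in> C. length \<pi> = n}))"

text \<open>
  The equation \<open>f = p / q\<close> is cleared of denominators, as division of formal power series is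
  not exact when \<open>q\<close> has zero constant term and does not divide \<open>p\<close>.
\<close>
definition rational_fps :: "'a :: field fps \<Rightarrow> bool" where
  "rational_fps f \<longleftrightarrow> (\<exists>p q. q \<noteq> 0 \<and> fps_of_poly q * f = fps_of_poly p)"

text \<open>The choice \<open>D = C\<close> covers the class itself.\<close>
definition strongly_rational :: "nat list set \<Rightarrow> bool" where
  "strongly_rational C \<longleftrightarrow> perm_class C \<and>
     (\<forall>D. perm_class D \<and> D \<subseteq> C \<longrightarrow> rational_fps (class_gf D))"

end

theory Submission
  imports Defs "HOL-Library.Infinite_Set"
begin

text \<open>
  The permutations 24153 and 31524 are the ones whose inversion graph is a path on five vertices,
  and a decreasing subsequence is a clique of that graph. The proof is by induction on the clique
  number \<open>l\<close>. A permutation of the class is a skew sum of skew indecomposable permutations with smaller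
  clique number, or a sum of sum indecomposable ones, or an inflation of a simple permutation, in
  which every inflating permutation has smaller clique number because its points are all inverted
  with a common further point.

  In a simple permutation of the class, every box contains only boundedly many sum components with
  inversions, and each component is dominated by a path joining its extreme points. Hence
  boundedly many lines meet all inversions, so that the cells are increasing, and boundedly many
  further lines make the gridding acyclic. The permutation is then encoded by a word over a finite
  alphabet of cells. The words that encode the lexicographically least gridding and are in normal
  form with respect to the exchange of independent letters form a regular language and encode each
  simple permutation once.

  An inflation is thus a word over pairs of a cell and an inflating permutation. The subword order on
  such words implies containment and is a well-quasi-order by Higman's lemma. Upsets of words have
  finitely many residuals, even over the infinite alphabet, and the residual by a letter is monotone
  in the inflating permutation. The generating functions of the residuals therefore solve a linear
  system whose coefficients are rational because the class of inflating permutations is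
  strongly rational.
\<close>

section \<open>Rational generating functions\<close>

text \<open>Two demands on the encoding pull against each other. Counting needs one word per
  permutation, so skeletons must be canonical; but membership in a subclass is visible only through
  the subword order, and canonical words need be closed neither upwards nor downwards. Canonicity is
  therefore imposed by a regular language that reads only the cells and ignores the inflating
  permutations, and the subclass condition by upsets of all words. The number of lines and cells has
  to be bounded in terms of \<open>l\<close> alone, since otherwise the alphabet would not be
  finite. Acyclicity means that the points can be listed so that each column is read from left to
  right and, at the same time, each row from bottom to top; one direction serves all cells because
  all are increasing. Skew sums and inflations take their blocks from the previous class, but a
  direct sum does not lower the clique number: its blocks are the sum indecomposable members of the
  class under construction, so direct sums come last.\<close>

lemma rational_fps_of_poly [simp]: "rational_fps (fps_of_poly p)"
  unfolding rational_fps_def by (intro exI[of _ p] exI[of _ 1]) simp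

lemma rational_fps_0 [simp]: "rational_fps 0"
  using rational_fps_of_poly[of 0] by simp

lemma rational_fps_1 [simp]: "rational_fps 1"
  using rational_fps_of_poly[of 1] by simp

lemma rational_fps_add:
  assumes "rational_fps f" "rational_fps g"
  shows "rational_fps (f + g)"
proof -
  obtain p q p' q' where pq: "q \<noteq> 0" "fps_of_poly q * f = fps_of_poly p"
      "q' \<noteq> 0" "fps_of_poly q' * g = fps_of_poly p'"
    using assms unfolding rational_fps_def by blast
  have "fps_of_poly (q * q') * (f + g) =
      fps_of_poly q' * (fps_of_poly q * f) + fps_of_poly q * (fps_of_poly q' * g)"
    by (simp add: fps_of_poly_mult algebra_simps)
  also have "\<dots> = fps_of_poly (q' * p + q * p')"
    by (simp add: pq fps_of_poly_mult fps_of_poly_add)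
  finally show ?thesis
    unfolding rational_fps_def using pq(1,3) by (intro exI[of _ "q' * p + q * p'"] exI[of _ "q * q'"]) simp
qed

lemma rational_fps_mult:
  assumes "rational_fps f" "rational_fps g"
  shows "rational_fps (f * g)"
proof -
  obtain p q p' q' where pq: "q \<noteq> 0" "fps_of_poly q * f = fps_of_poly p"
      "q' \<noteq> 0" "fps_of_poly q' * g = fps_of_poly p'"
    using assms unfolding rational_fps_def by blast
  have "fps_of_poly (q * q') * (f * g) = (fps_of_poly q * f) * (fps_of_poly q' * g)"
    by (simp add: fps_of_poly_mult algebra_simps)
  also have "\<dots> = fps_of_poly (p * p')"
    by (simp add: pq fps_of_poly_mult)
  finally show ?thesis
    unfolding rational_fps_def using pq(1,3) by (intro exI[of _ "p * p'"] exI[of _ "q * q'"]) simp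
qed

lemma rational_fps_uminus: "rational_fps f \<Longrightarrow> rational_fps (- f)"
  using rational_fps_mult[OF rational_fps_of_poly[of "-1"], of f] by (simp add: fps_of_poly_uminus)

lemma rational_fps_diff: "rational_fps f \<Longrightarrow> rational_fps g \<Longrightarrow> rational_fps (f - g)"
  using rational_fps_add[of f "- g"] by (simp add: rational_fps_uminus)

lemma rational_fps_sum: "(\<And>i. i \<in> I \<Longrightarrow> rational_fps (f i)) \<Longrightarrow> rational_fps (sum f I)"
  by (induction I rule: infinite_finite_induct) (auto intro: rational_fps_add)

lemma rational_fps_inverse:
  assumes "rational_fps f" "fps_nth f 0 \<noteq> 0"
  shows "rational_fps (inverse f)"
proof -
  obtain p q where pq: "q \<noteq> 0" "fps_of_poly q * f = fps_of_poly p"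
    using assms unfolding rational_fps_def by blast
  have f0: "f \<noteq> 0" using assms(2) by auto
  have "p \<noteq> 0"
  proof
    assume "p = 0"
    then have "fps_of_poly q * f = 0" using pq by simp
    then show False using f0 pq(1) by simp
  qed
  moreover have "fps_of_poly p * inverse f = fps_of_poly q"
    using pq(2)[symmetric] inverse_mult_eq_1'[OF assms(2)] by (simp add: mult.assoc)
  ultimately show ?thesis unfolding rational_fps_def by blast
qed

text \<open>Gaussian elimination. The pivot \<open>1 - g z z\<close> has constant term 1, so it has
  a rational inverse, and substituting the solved equation into the others keeps all coefficients
  rational with zero constant term.\<close>

lemma rational_linear_system:
  fixes f :: "'k \<Rightarrow> 'a::field fps"
  assumes "finite Q"
    and "\<And>k. k \<in> Q \<Longrightarrow> f k = c k + (\<Sum>k'\<in>Q. g k k' * f k')"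
    and "\<And>k. k \<in> Q \<Longrightarrow> rational_fps (c k)"
    and "\<And>k k'. k \<in> Q \<Longrightarrow> k' \<in> Q \<Longrightarrow> rational_fps (g k k') \<and> fps_nth (g k k') 0 = 0"
    and "k \<in> Q"
  shows "rational_fps (f k)"
  using assms
proof (induction Q arbitrary: c g k rule: finite_induct)
  case empty
  then show ?case by simp
next
  case (insert z Q)
  define h where "h = inverse (1 - g z z)"
  have g0: "fps_nth (1 - g z z) 0 \<noteq> 0" using insert.prems(3)[of z z] by simp
  have h_rat: "rational_fps h"
    unfolding h_def using g0 insert.prems(3)[of z z]
    by (intro rational_fps_inverse rational_fps_diff) auto
  have "(1 - g z z) * f z = c z + (\<Sum>k'\<in>Q. g z k' * f k')"
    using insert.prems(1)[of z] insert.hyps by (simp add: algebra_simps)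
  then have "h * ((1 - g z z) * f z) = h * (c z + (\<Sum>k'\<in>Q. g z k' * f k'))" by simp
  moreover have "h * (1 - g z z) = 1" unfolding h_def by (rule inverse_mult_eq_1[OF g0])
  ultimately have fz: "f z = h * (c z + (\<Sum>k'\<in>Q. g z k' * f k'))"
    by (metis mult.assoc mult_1)
  have fk: "f k = (c k + g k z * h * c z) + (\<Sum>k'\<in>Q. (g k k' + g k z * h * g z k') * f k')"
    if "k \<in> Q" for k
  proof -
    have "f k = c k + g k z * f z + (\<Sum>k'\<in>Q. g k k' * f k')"
      using insert.prems(1)[of k] insert.hyps that by (simp add: algebra_simps)
    also have "g k z * f z = g k z * h * c z + (\<Sum>k'\<in>Q. g k z * h * g z k' * f k')"
      by (subst fz) (simp add: algebra_simps sum_distrib_left)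
    finally show ?thesis by (simp add: algebra_simps sum.distrib)
  qed
  have IH: "rational_fps (f k)" if "k \<in> Q" for k
  proof (rule insert.IH[OF fk _ _ that])
    show "rational_fps (c k + g k z * h * c z)" if "k \<in> Q" for k
      using insert.prems(2,3) h_rat that by (intro rational_fps_add rational_fps_mult) auto
    show "rational_fps (g k k' + g k z * h * g z k') \<and> fps_nth (g k k' + g k z * h * g z k') 0 = 0"
      if "k \<in> Q" "k' \<in> Q" for k k'
      using insert.prems(3) h_rat that by (auto intro!: rational_fps_add rational_fps_mult)
  qed
  show ?case
  proof (cases "k = z")
    case True
    have "rational_fps (h * (c z + (\<Sum>k'\<in>Q. g z k' * f k')))"
      using IH h_rat insert.prems(2,3)
      by (intro rational_fps_mult rational_fps_add rational_fps_sum) auto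
    then show ?thesis using True fz by simp
  next
    case False
    then show ?thesis using IH insert.prems(4) by simp
  qed
qed

section \<open>Counting series of graded sets\<close>

definition gf :: "('a \<Rightarrow> nat) \<Rightarrow> 'a set \<Rightarrow> rat fps" where
  "gf sz U = Abs_fps (\<lambda>n. of_nat (card {a \<in> U. sz a = n}))"

text \<open>\<open>card\<close> is 0 on infinite sets, so the sum and product laws for
  \<open>gf\<close> are stated for sets with finitely many elements of each size.\<close>

definition finite_levels :: "('a \<Rightarrow> nat) \<Rightarrow> 'a set \<Rightarrow> bool" where
  "finite_levels sz U \<longleftrightarrow> (\<forall>n. finite {a \<in> U. sz a = n})"

lemma finite_levels_subset: "finite_levels sz U \<Longrightarrow> V \<subseteq> U \<Longrightarrow> finite_levels sz V"
  unfolding finite_levels_def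
proof
  fix n
  assume "\<forall>n. finite {a \<in> U. sz a = n}" "V \<subseteq> U"
  moreover from this have "{a \<in> V. sz a = n} \<subseteq> {a \<in> U. sz a = n}" by blast
  ultimately show "finite {a \<in> V. sz a = n}" using finite_subset by blast
qed

lemma gf_nth: "fps_nth (gf sz U) n = of_nat (card {a \<in> U. sz a = n})"
  by (simp add: gf_def)

lemma gf_empty [simp]: "gf sz {} = 0"
  by (simp add: gf_def fps_eq_iff)

lemma gf_Un:
  assumes "finite_levels sz U" "finite_levels sz V" "U \<inter> V = {}"
  shows "gf sz (U \<union> V) = gf sz U + gf sz V"
proof -
  have "card {a \<in> U \<union> V. sz a = n} = card {a \<in> U. sz a = n} + card {a \<in> V. sz a = n}" for n
    using assms unfolding finite_levels_def
    by (subst card_Un_disjoint[symmetric]) (auto intro!: arg_cong[where f = card])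
  then show ?thesis by (simp add: fps_eq_iff gf_nth)
qed

lemma gf_Diff:
  assumes "finite_levels sz U" "V \<subseteq> U"
  shows "gf sz (U - V) = gf sz U - gf sz V"
proof -
  have "gf sz (V \<union> (U - V)) = gf sz V + gf sz (U - V)"
    using assms by (intro gf_Un) (auto intro: finite_levels_subset)
  moreover have "V \<union> (U - V) = U" using assms by auto
  ultimately show ?thesis by simp
qed

lemma gf_UN:
  assumes "finite I" "\<And>i. i \<in> I \<Longrightarrow> finite_levels sz (U i)"
    and "\<And>i j. i \<in> I \<Longrightarrow> j \<in> I \<Longrightarrow> i \<noteq> j \<Longrightarrow> U i \<inter> U j = {}"
  shows "gf sz (\<Union>i\<in>I. U i) = (\<Sum>i\<in>I. gf sz (U i))"
proof -
  have "card {a \<in> (\<Union>i\<in>I. U i). sz a = n} = (\<Sum>i\<in>I. card {a \<in> U i. sz a = n})" for n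
  proof -
    have "{a \<in> (\<Union>i\<in>I. U i). sz a = n} = (\<Union>i\<in>I. {a \<in> U i. sz a = n})" by auto
    moreover have "card (\<Union>i\<in>I. {a \<in> U i. sz a = n}) = (\<Sum>i\<in>I. card {a \<in> U i. sz a = n})"
      using assms unfolding finite_levels_def by (intro card_UN_disjoint) blast+
    ultimately show ?thesis by simp
  qed
  then show ?thesis by (simp add: fps_eq_iff gf_nth fps_sum_nth)
qed

lemma gf_bij:
  assumes "bij_betw h U V" "\<And>a. a \<in> U \<Longrightarrow> sz' (h a) = sz a"
  shows "gf sz U = gf sz' V"
proof -
  have "card {a \<in> U. sz a = n} = card {b \<in> V. sz' b = n}" for n
  proof (rule bij_betw_same_card[of h])
    show "bij_betw h {a \<in> U. sz a = n} {b \<in> V. sz' b = n}"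
      using assms unfolding bij_betw_def by (auto intro: inj_on_subset)
  qed
  then show ?thesis by (simp add: fps_eq_iff gf_nth)
qed

lemma gf_Times:
  assumes "finite_levels sz U" "finite_levels sz' V"
  shows "gf (\<lambda>(a, b). sz a + sz' b) (U \<times> V) = gf sz U * gf sz' V"
proof -
  have "card {p \<in> U \<times> V. (case p of (a, b) \<Rightarrow> sz a + sz' b) = n} =
      (\<Sum>i\<le>n. card {a \<in> U. sz a = i} * card {b \<in> V. sz' b = n - i})" for n
  proof -
    have "{p \<in> U \<times> V. (case p of (a, b) \<Rightarrow> sz a + sz' b) = n} =
        (\<Union>i\<in>{..n}. {a \<in> U. sz a = i} \<times> {b \<in> V. sz' b = n - i})" by auto
    moreover have "card (\<Union>i\<in>{..n}. {a \<in> U. sz a = i} \<times> {b \<in> V. sz' b = n - i}) =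
        (\<Sum>i\<in>{..n}. card ({a \<in> U. sz a = i} \<times> {b \<in> V. sz' b = n - i}))"
      using assms unfolding finite_levels_def by (intro card_UN_disjoint) auto
    ultimately show ?thesis by (simp add: card_cartesian_product)
  qed
  then show ?thesis by (simp add: fps_eq_iff gf_nth fps_mult_nth atLeast0AtMost)
qed

section \<open>Well-quasi-orders and regular languages\<close>

text \<open>Reflexivity on \<open>A\<close> comes from constant sequences, see
  \<open>wqo_on_refl\<close>.\<close>

definition wqo_on :: "('a \<Rightarrow> 'a \<Rightarrow> bool) \<Rightarrow> 'a set \<Rightarrow> bool" where
  "wqo_on le A \<longleftrightarrow> transp le \<and> (\<forall>f. (\<forall>i::nat. f i \<in> A) \<longrightarrow> (\<exists>i j. i < j \<and> le (f i) (f j)))"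

lemma wqo_onE:
  assumes "wqo_on le A" "\<And>i::nat. f i \<in> A"
  obtains i j where "i < j" "le (f i) (f j)"
  using assms unfolding wqo_on_def by blast

lemma wqo_on_refl: "wqo_on le A \<Longrightarrow> a \<in> A \<Longrightarrow> le a a"
  unfolding wqo_on_def by (elim conjE allE[of _ "\<lambda>_. a"]) auto

text \<open>Terms with no later term above them are finite in number, since infinitely many would
  form a bad sequence. Beyond the last of them each term has a later one above it, and these are
  chained.\<close>

lemma wqo_on_ascending:
  assumes "wqo_on le A" and fA: "\<And>i::nat. f i \<in> A"
  shows "\<exists>\<phi>. strict_mono (\<phi> :: nat \<Rightarrow> nat) \<and> (\<forall>i j. i < j \<longrightarrow> le (f (\<phi> i)) (f (\<phi> j)))"
proof -
  have tr: "transp le" using assms unfolding wqo_on_def by blast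
  define T where "T = {i. \<forall>j>i. \<not> le (f i) (f j)}"
  have "finite T"
  proof (rule ccontr)
    assume inf: "infinite T"
    obtain i j where ij: "i < j" "le (f (enumerate T i)) (f (enumerate T j))"
      using wqo_onE[OF assms(1), of "\<lambda>i. f (enumerate T i)"] fA by blast
    have "enumerate T i < enumerate T j" by (rule enumerate_mono[OF ij(1) inf])
    moreover have "enumerate T i \<in> T" using inf by (rule enumerate_in_set)
    ultimately show False using ij(2) unfolding T_def by blast
  qed
  then obtain N where N: "\<And>i. i \<in> T \<Longrightarrow> i < N" unfolding finite_nat_set_iff_bounded by blast
  have step: "\<exists>j>i. le (f i) (f j)" if "i \<ge> N" for i using N[of i] that unfolding T_def by force
  have "\<exists>\<phi>. \<forall>n. N \<le> \<phi> n \<and> (\<phi> n < \<phi> (Suc n) \<and> le (f (\<phi> n)) (f (\<phi> (Suc n))))"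
  proof (rule dependent_nat_choice)
    show "\<exists>x. N \<le> x" by blast
    show "\<exists>y. N \<le> y \<and> x < y \<and> le (f x) (f y)" if "N \<le> x" for x n :: nat
      using step[OF that] that by (meson less_imp_le order_trans)
  qed
  then obtain \<phi> :: "nat \<Rightarrow> nat" where \<phi>: "\<And>n. \<phi> n < \<phi> (Suc n)" "\<And>n. le (f (\<phi> n)) (f (\<phi> (Suc n)))" by blast
  have "le (f (\<phi> i)) (f (\<phi> j))" if "i < j" for i j
    using that
  proof (induction j)
    case (Suc j)
    then show ?case
      using \<phi>(2)[of j] tr by (cases "i = j") (auto dest: transpD)
  qed simp
  with \<phi>(1) show ?thesis using strict_mono_Suc_iff by blast
qed

lemma transp_list_emb: "transp le \<Longrightarrow> transp (list_emb le)"
proof (rule transpI)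
  fix x y z
  assume tr: "transp le" and "list_emb le x y" "list_emb le y z"
  then show "list_emb le x z" by (intro list_emb_trans[of x y z le]) (meson transpD)+
qed

text \<open>Nash-Williams' argument: in a bad sequence chosen with least lengths term by term, the
  heads contain an ascending subsequence; replacing the words from there on by the tails of that
  subsequence gives a bad sequence with a shorter term.\<close>

theorem higman:
  assumes wqo: "wqo_on le A"
  shows "wqo_on (list_emb le) (lists A)"
proof (rule ccontr)
  define bad where "bad f \<longleftrightarrow> (\<forall>i::nat. f i \<in> lists A) \<and>
    (\<forall>i j. i < j \<longrightarrow> \<not> list_emb le (f i) (f j))" for f
  assume "\<not> wqo_on (list_emb le) (lists A)"
  then obtain f0 where f0: "bad f0"
    using wqo transp_list_emb[of le] unfolding wqo_on_def bad_def by blast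
  \<comment> \<open>The first \<open>n\<close> entries of \<open>H n\<close> are fixed for good;
    stage \<open>n\<close> fixes entry \<open>n\<close> with the least possible length.\<close>
  define minext where "minext n h h' \<longleftrightarrow> bad h' \<and> (\<forall>i<n. h' i = h i) \<and>
    (\<forall>g. bad g \<and> (\<forall>i<n. g i = h i) \<longrightarrow> length (h' n) \<le> length (g n))" for n h h'
  have minext_ex: "\<exists>h'. minext n h h'" if "bad h" for n h
    using ex_has_least_nat[of "\<lambda>g. bad g \<and> (\<forall>i<n. g i = h i)" h "\<lambda>g. length (g n)"] that
    unfolding minext_def by (simp add: conj_assoc)
  have "\<exists>H. \<forall>n. bad (H n) \<and> minext n (H n) (H (Suc n))"
  proof (rule dependent_nat_choice)
    show "\<exists>h. bad h" using f0 by blast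
    show "\<exists>h'. bad h' \<and> minext n h h'" if "bad h" for h n
      using minext_ex[OF that, of n] unfolding minext_def by blast
  qed
  then obtain H where Hbad: "\<And>n. bad (H n)" and Hmin: "\<And>n. minext n (H n) (H (Suc n))" by blast
  define m where "m n = H (Suc n) n" for n
  have m_eq: "H n i = m i" if "i < n" for n i
    using that
  proof (induction n)
    case (Suc n)
    then show ?case using Hmin[of n] unfolding minext_def m_def by (cases "i = n") auto
  qed simp
  have m_min: "length (m n) \<le> length (g n)" if "bad g" "\<And>i. i < n \<Longrightarrow> g i = m i" for g n
    using Hmin[of n] that m_eq unfolding minext_def m_def by metis
  have m_bad: "\<not> list_emb le (m i) (m j)" if "i < j" for i j
    using Hbad[of "Suc j"] m_eq[of i "Suc j"] m_eq[of j "Suc j"] that unfolding bad_def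
    by (metis lessI less_SucI)
  have m_in: "m i \<in> lists A" for i
    using Hbad[of "Suc i"] unfolding bad_def m_def by blast
  have m_ne: "m i \<noteq> []" for i
    using m_bad[of i "Suc i"] by auto
  have "hd (m i) \<in> A" for i
    using m_in[of i] m_ne[of i] by (cases "m i") auto
  then obtain \<phi> :: "nat \<Rightarrow> nat" where \<phi>: "strict_mono \<phi>"
      "\<And>i j. i < j \<Longrightarrow> le (hd (m (\<phi> i))) (hd (m (\<phi> j)))"
    using wqo_on_ascending[OF wqo, of "\<lambda>i. hd (m i)"] by blast
  \<comment> \<open>The entries before \<open>\<phi> 0\<close> are kept, and entry
    \<open>\<phi> 0\<close> becomes the tail of \<open>m (\<phi> 0)\<close>, which is
    shorter.\<close>
  define g where "g n = (if n < \<phi> 0 then m n else tl (m (\<phi> (n - \<phi> 0))))" for n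
  have "length (g (\<phi> 0)) < length (m (\<phi> 0))"
    using m_ne[of "\<phi> 0"] unfolding g_def by simp
  then have "\<not> bad g"
    using m_min[of g "\<phi> 0"] unfolding g_def by fastforce
  moreover have "g i \<in> lists A" for i
  proof (cases "i < \<phi> 0")
    case False
    then show ?thesis using m_in[of "\<phi> (i - \<phi> 0)"] m_ne[of "\<phi> (i - \<phi> 0)"]
      unfolding g_def by (cases "m (\<phi> (i - \<phi> 0))") auto
  qed (simp add: g_def m_in del: in_lists_conv_set)
  ultimately obtain i j where ij: "i < j" "list_emb le (g i) (g j)"
    unfolding bad_def by blast
  consider "j < \<phi> 0" | "i < \<phi> 0" "\<phi> 0 \<le> j" | "\<phi> 0 \<le> i" by linarith
  then show False
  proof cases
    case 1
    then show False using ij m_bad[of i j] unfolding g_def by auto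
  next
    case 2
    define k where "k = j - \<phi> 0"
    have "list_emb le (m i) (tl (m (\<phi> k)))" using 2 ij(2) unfolding g_def k_def by auto
    then have "list_emb le (m i) (hd (m (\<phi> k)) # tl (m (\<phi> k)))" by (rule list_emb_Cons)
    moreover have "i < \<phi> k" using 2(1) strict_mono_leD[OF \<phi>(1), of 0 k] by simp
    ultimately show False using m_bad[of i "\<phi> k"] m_ne by simp
  next
    case 3
    define a b where "a = i - \<phi> 0" and "b = j - \<phi> 0"
    have ab: "a < b" using 3 ij(1) unfolding a_def b_def by simp
    have "list_emb le (tl (m (\<phi> a))) (tl (m (\<phi> b)))"
      using 3 ij unfolding g_def a_def b_def by auto
    then have "list_emb le (hd (m (\<phi> a)) # tl (m (\<phi> a))) (hd (m (\<phi> b)) # tl (m (\<phi> b)))"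
      using \<phi>(2)[OF ab] by (intro list_emb_Cons2)
    then show False
      using m_bad[of "\<phi> a" "\<phi> b"] m_ne strict_monoD[OF \<phi>(1) ab] by simp
  qed
qed

lemma wqo_on_finite_eq: "finite S \<Longrightarrow> wqo_on (=) S"
  unfolding wqo_on_def
proof (intro conjI allI impI)
  fix f :: "nat \<Rightarrow> 'a"
  assume "finite S" "\<forall>i. f i \<in> S"
  then have "range f \<subseteq> S" by blast
  then have "finite (range f)" using \<open>finite S\<close> finite_subset by blast
  then have "\<not> inj f" using finite_imageD infinite_UNIV_nat by blast
  then obtain i j where "i \<noteq> j" "f i = f j" unfolding inj_def by blast
  then show "\<exists>i j. i < j \<and> f i = f j" by (metis linorder_neqE_nat)
qed (auto intro: transpI)

lemma wqo_on_Times_eq: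
  assumes "finite S" "wqo_on le U"
  shows "wqo_on (\<lambda>a b. fst a = fst b \<and> le (snd a) (snd b)) (S \<times> U)"
  unfolding wqo_on_def
proof (intro conjI allI impI)
  show "transp (\<lambda>a b. fst a = fst b \<and> le (snd a) (snd b))"
    using assms(2) unfolding wqo_on_def by (intro transpI) (auto dest: transpD)
next
  fix f :: "nat \<Rightarrow> 'a \<times> 'b"
  assume f: "\<forall>i. f i \<in> S \<times> U"
  have fS: "fst (f i) \<in> S" and fU: "snd (f i) \<in> U" for i using f by (auto simp: mem_Times_iff)
  obtain \<phi> :: "nat \<Rightarrow> nat" where \<phi>: "strict_mono \<phi>"
      "\<And>i j. i < j \<Longrightarrow> fst (f (\<phi> i)) = fst (f (\<phi> j))"
    using wqo_on_ascending[where f = "\<lambda>i. fst (f i)", OF wqo_on_finite_eq[OF assms(1)] fS] by blast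
  obtain i j where "i < j" "le (snd (f (\<phi> i))) (snd (f (\<phi> j)))"
    by (rule wqo_onE[where f = "\<lambda>i. snd (f (\<phi> i))", OF assms(2) fU])
  then show "\<exists>i j. i < j \<and> fst (f i) = fst (f j) \<and> le (snd (f i)) (snd (f j))"
    using \<phi> by (meson strict_monoD)
qed

definition upset_in :: "('a \<Rightarrow> 'a \<Rightarrow> bool) \<Rightarrow> 'a set \<Rightarrow> 'a set \<Rightarrow> bool" where
  "upset_in le A V \<longleftrightarrow> V \<subseteq> A \<and> (\<forall>a\<in>V. \<forall>b\<in>A. le a b \<longrightarrow> b \<in> V)"

text \<open>Upsets of a well-quasi-order satisfy the ascending chain condition.\<close>
lemma finite_monotone_upsets:
  assumes "wqo_on le A" "wqo_on le' B"
    and mono: "\<And>a a'. a \<in> A \<Longrightarrow> a' \<in> A \<Longrightarrow> le a a' \<Longrightarrow> K a \<subseteq> K a'"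
    and up: "\<And>a. a \<in> A \<Longrightarrow> upset_in le' B (K a)"
  shows "finite (K ` A)"
proof (rule ccontr)
  assume "infinite (K ` A)"
  then obtain h :: "nat \<Rightarrow> 'b set" where h: "inj h" "range h \<subseteq> K ` A"
    by (meson infinite_countable_subset)
  then have "\<forall>i. \<exists>a\<in>A. h i = K a" by blast
  then obtain f where f: "\<And>i. f i \<in> A" "\<And>i. h i = K (f i)" by metis
  obtain \<phi> :: "nat \<Rightarrow> nat" where \<phi>: "strict_mono \<phi>" "\<And>i j. i < j \<Longrightarrow> le (f (\<phi> i)) (f (\<phi> j))"
    using wqo_on_ascending[where f = f, OF assms(1) f(1)] by blast
  have asc: "h (\<phi> i) \<subseteq> h (\<phi> j)" if "i < j" for i j
    using mono f \<phi>(2)[OF that] by simp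
  have "\<exists>w. w \<in> h (\<phi> (Suc i)) - h (\<phi> i)" for i
  proof -
    have "h (\<phi> (Suc i)) \<noteq> h (\<phi> i)"
      using h(1) \<phi>(1) by (metis injD n_not_Suc_n strict_mono_eq)
    then show ?thesis using asc[of i "Suc i"] by blast
  qed
  then obtain w where w: "\<And>i. w i \<in> h (\<phi> (Suc i))" "\<And>i. w i \<notin> h (\<phi> i)" by (metis DiffD1 DiffD2)
  have upw: "upset_in le' B (h i)" for i using up f by simp
  then have wB: "w i \<in> B" for i using w(1) unfolding upset_in_def by blast
  obtain i j where ij: "i < j" "le' (w i) (w j)" by (rule wqo_onE[where f = w, OF assms(2) wB])
  have "w i \<in> h (\<phi> j)" using asc[of "Suc i" j] w(1)[of i] ij(1) by (cases "Suc i = j") auto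
  then have "w j \<in> h (\<phi> j)" using ij(2) upw wB unfolding upset_in_def by blast
  then show False using w(2) by blast
qed

section \<open>Languages with finitely many residuals\<close>

definition residual :: "'a set \<Rightarrow> 'a list set \<Rightarrow> 'a list \<Rightarrow> 'a list set" where
  "residual A L u = {v \<in> lists A. u @ v \<in> L}"

text \<open>The Myhill-Nerode condition, taken as the definition because the alphabets of pairs
  below may be infinite, so that finite automata are not at hand.\<close>

definition regular :: "'a set \<Rightarrow> 'a list set \<Rightarrow> bool" where
  "regular A L \<longleftrightarrow> finite (residual A L ` lists A)"

text \<open>A residual of an upset is again an upset, and it grows when the prefix grows in the
  subword order. With Higman's lemma on both sides this is the situation of
  \<open>finite_monotone_upsets\<close>.\<close>

lemma regular_upset:
  assumes "wqo_on le A" "upset_in (list_emb le) (lists A) V"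
  shows "regular A V"
  unfolding regular_def
proof (rule finite_monotone_upsets[OF higman[OF assms(1)] higman[OF assms(1)]])
  show "residual A V a \<subseteq> residual A V a'"
    if "a \<in> lists A" "a' \<in> lists A" "list_emb le a a'" for a a'
  proof
    fix v assume v: "v \<in> residual A V a"
    then have "v \<in> lists A" "a @ v \<in> V" unfolding residual_def by auto
    moreover have "list_emb le v v"
      by (rule list_emb_refl) (use v assms(1) in \<open>auto simp: residual_def intro: wqo_on_refl\<close>)
    moreover from this have "list_emb le (a @ v) (a' @ v)" using that(3) by (rule list_emb_append_mono[rotated])
    moreover have "a' @ v \<in> lists A" using that(2) \<open>v \<in> lists A\<close> by simp
    ultimately show "v \<in> residual A V a'" using assms(2) unfolding residual_def upset_in_def by blast
  qed
  show "upset_in (list_emb le) (lists A) (residual A V a)" if "a \<in> lists A" for a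
    unfolding upset_in_def
  proof (intro conjI ballI impI)
    fix v v' assume v: "v \<in> residual A V a" "v' \<in> lists A" "list_emb le v v'"
    have "list_emb le a a"
      by (rule list_emb_refl) (use that assms(1) in \<open>auto intro: wqo_on_refl\<close>)
    then have "list_emb le (a @ v) (a @ v')" using v(3) by (rule list_emb_append_mono)
    moreover have "a @ v' \<in> lists A" using that v(2) by simp
    ultimately show "v' \<in> residual A V a"
      using v assms(2) unfolding residual_def upset_in_def by blast
  qed (auto simp: residual_def)
qed

text \<open>The product construction, phrased for residuals.\<close>

lemma regular_comb:
  assumes "regular A L" "regular A M"
    and "\<And>u. u \<in> lists A \<Longrightarrow> residual A N u = F (residual A L u) (residual A M u)"
  shows "regular A N"
proof -
  have "residual A N ` lists A \<subseteq> (\<lambda>(X, Y). F X Y) ` (residual A L ` lists A \<times> residual A M ` lists A)"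
    using assms(3) by auto
  then show ?thesis using assms(1,2) unfolding regular_def by (meson finite_SigmaI finite_imageI finite_subset)
qed

lemma regular_Diff: "regular A L \<Longrightarrow> regular A M \<Longrightarrow> regular A (L - M)"
  by (erule (1) regular_comb[where F = "(-)"]) (auto simp: residual_def)

lemma regular_lists: "regular A (lists A)"
proof -
  have "residual A (lists A) ` lists A \<subseteq> {lists A}" by (auto simp: residual_def)
  then show ?thesis unfolding regular_def using finite_subset by blast
qed

text \<open>The complement is an upset for the subsequence order. Languages of words that describe
  hereditary structure are shown to be regular in this way, with no automaton.\<close>

lemma regular_downset:
  assumes "finite A" "D \<subseteq> lists A" "\<And>u v. v \<in> D \<Longrightarrow> subseq u v \<Longrightarrow> u \<in> D"
  shows "regular A D"
proof -
  have "regular A (lists A - D)"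
    by (rule regular_upset[OF wqo_on_finite_eq[OF assms(1)]]) (use assms in \<open>auto simp: upset_in_def\<close>)
  then have "regular A (lists A - (lists A - D))" by (rule regular_Diff[OF regular_lists])
  moreover have "lists A - (lists A - D) = D" using assms(2) by blast
  ultimately show ?thesis by (simp only:)
qed

text \<open>The subset construction: a residual of the image is the image of a union of residuals,
  one for each preimage of the prefix. It serves to guess extra data along a word and then forget
  it.\<close>

lemma regular_map:
  assumes "regular B L" "h ` B \<subseteq> A" "L \<subseteq> lists B"
  shows "regular A (map h ` L)"
proof -
  have "residual A (map h ` L) u =
      map h ` \<Union> (residual B L ` {t \<in> lists B. map h t = u})" if "u \<in> lists A" for u
  proof (intro equalityI subsetI)
    fix v assume v: "v \<in> residual A (map h ` L) u"
    then obtain t where t: "t \<in> L" "map h t = u @ v" unfolding residual_def by force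
    define t1 t2 where "t1 = take (length u) t" and "t2 = drop (length u) t"
    have tt: "t = t1 @ t2" unfolding t1_def t2_def by simp
    have "map h t1 = u" "map h t2 = v"
      using t(2) unfolding t1_def t2_def take_map[symmetric] drop_map[symmetric] by simp_all
    moreover have "t1 \<in> lists B" "t2 \<in> lists B" using t(1) assms(3) tt by auto
    ultimately show "v \<in> map h ` \<Union> (residual B L ` {t \<in> lists B. map h t = u})"
      using t(1) tt unfolding residual_def by blast
  next
    fix v assume "v \<in> map h ` \<Union> (residual B L ` {t \<in> lists B. map h t = u})"
    then obtain t1 t2 where t: "t1 \<in> lists B" "map h t1 = u" "t2 \<in> lists B" "t1 @ t2 \<in> L" "v = map h t2"
      unfolding residual_def by blast
    then have "set t2 \<subseteq> B" by auto
    then have "h x \<in> A" if "x \<in> set t2" for x using that assms(2) by blast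
    then have "v \<in> lists A" "u @ v = map h (t1 @ t2)" using t(2,5) by auto
    then show "v \<in> residual A (map h ` L) u" using t(4) unfolding residual_def by blast
  qed
  moreover have "residual B L ` {t \<in> lists B. map h t = u} \<in> Pow (residual B L ` lists B)" for u
    by blast
  ultimately have "residual A (map h ` L) ` lists A \<subseteq> (\<lambda>X. map h ` \<Union> X) ` Pow (residual B L ` lists B)"
    by (metis (no_types, lifting) image_eqI image_subsetI)
  then show ?thesis using assms(1) unfolding regular_def by (meson finite_Pow_iff finite_imageI finite_subset)
qed

section \<open>Generating functions of words over a graded well-quasi-order\<close>

text \<open>Strong rationality carried over to a graded well-quasi-order. A subclass is the
  complement of an upset, so rationality for all upsets covers all subclasses; upsets are the
  convenient side because their residuals are monotone.\<close>

definition strongly_rational_wqo :: "('a \<Rightarrow> 'a \<Rightarrow> bool) \<Rightarrow> ('a \<Rightarrow> nat) \<Rightarrow> 'a set \<Rightarrow> bool" where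
  "strongly_rational_wqo le sz U \<longleftrightarrow> wqo_on le U \<and> finite_levels sz U \<and>
     (\<forall>V. upset_in le U V \<longrightarrow> rational_fps (gf sz V))"

text \<open>The elements at which \<open>h\<close> contains \<open>X\<close> form an upset, whose
  series is rational. Subtracting the fibres over strictly larger values leaves the fibre over
  \<open>X\<close>, and there are only finitely many values.\<close>

lemma rational_gf_fibre:
  assumes U: "strongly_rational_wqo le sz U" and fin: "finite (h ` U)"
    and mono: "\<And>a b. a \<in> U \<Longrightarrow> b \<in> U \<Longrightarrow> le a b \<Longrightarrow> h a \<subseteq> (h b :: 'c set)"
  shows "rational_fps (gf sz {a \<in> U. h a = X})"
proof (induction "card {Y \<in> h ` U. X \<subset> Y}" arbitrary: X rule: less_induct)
  case less
  define I where "I = {Y \<in> h ` U. X \<subset> Y}"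
  have fl: "finite_levels sz V" if "V \<subseteq> U" for V
    using U that finite_levels_subset unfolding strongly_rational_wqo_def by blast
  have finI: "finite I" unfolding I_def using fin by simp
  have "upset_in le U {a \<in> U. X \<subseteq> h a}" unfolding upset_in_def using mono by blast
  then have r: "rational_fps (gf sz {a \<in> U. X \<subseteq> h a})"
    using U unfolding strongly_rational_wqo_def by blast
  have "rational_fps (gf sz {a \<in> U. h a = Y})" if "Y \<in> I" for Y
  proof (rule less)
    have "{Z \<in> h ` U. Y \<subset> Z} \<subset> {Z \<in> h ` U. X \<subset> Z}" using that unfolding I_def by blast
    then show "card {Z \<in> h ` U. Y \<subset> Z} < card {Z \<in> h ` U. X \<subset> Z}"
      using fin by (intro psubset_card_mono) auto
  qed
  then have r': "rational_fps (\<Sum>Y\<in>I. gf sz {a \<in> U. h a = Y})" by (rule rational_fps_sum)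
  have "gf sz (\<Union>Y\<in>I. {a \<in> U. h a = Y}) = (\<Sum>Y\<in>I. gf sz {a \<in> U. h a = Y})"
    using finI by (intro gf_UN fl) auto
  moreover have "{a \<in> U. h a = X} = {a \<in> U. X \<subseteq> h a} - (\<Union>Y\<in>I. {a \<in> U. h a = Y})"
    unfolding I_def by auto
  moreover have "gf sz ({a \<in> U. X \<subseteq> h a} - (\<Union>Y\<in>I. {a \<in> U. h a = Y})) =
      gf sz {a \<in> U. X \<subseteq> h a} - gf sz (\<Union>Y\<in>I. {a \<in> U. h a = Y})"
    by (intro gf_Diff fl) (auto simp: I_def)
  ultimately show ?case using r r' by (simp only: rational_fps_diff)
qed

definition letter_le :: "('a \<Rightarrow> 'a \<Rightarrow> bool) \<Rightarrow> 's \<times> 'a \<Rightarrow> 's \<times> 'a \<Rightarrow> bool" where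
  "letter_le le a b \<longleftrightarrow> fst a = fst b \<and> le (snd a) (snd b)"

lemma wqo_on_letter_le: "finite S \<Longrightarrow> wqo_on le U \<Longrightarrow> wqo_on (letter_le le) (S \<times> U)"
  unfolding letter_le_def[abs_def] by (rule wqo_on_Times_eq)

definition word_size :: "('a \<Rightarrow> nat) \<Rightarrow> ('s \<times> 'a) list \<Rightarrow> nat" where
  "word_size sz u = (\<Sum>a\<leftarrow>u. sz (snd a))"

lemma word_size_simps [simp]:
  "word_size sz [] = 0" "word_size sz (a # u) = sz (snd a) + word_size sz u"
  by (simp_all add: word_size_def)

text \<open>Positive sizes bound both the length of a word and the sizes of its letters.\<close>

lemma finite_levels_words:
  assumes "finite S" "finite_levels sz U" "\<And>a. a \<in> U \<Longrightarrow> 0 < sz a"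
  shows "finite_levels (word_size sz) (lists (S \<times> U))"
  unfolding finite_levels_def
proof
  fix n
  define B where "B = S \<times> (\<Union>m\<le>n. {a \<in> U. sz a = m})"
  have "finite B" using assms(1,2) unfolding B_def finite_levels_def by auto
  have "set u \<subseteq> B \<and> length u \<le> n" if "u \<in> lists (S \<times> U)" "word_size sz u \<le> n" for u
    using that
  proof (induction u rule: list.induct)
    case (Cons a u)
    have "0 < sz (snd a)" using assms(3)[of "snd a"] Cons.prems(1) by (auto simp: mem_Times_iff)
    moreover have "a \<in> B" using Cons.prems unfolding B_def by auto
    moreover have "word_size sz u \<le> n - sz (snd a)" "word_size sz u \<le> n" using Cons.prems(2) by auto
    moreover have len: "length u \<le> word_size sz u" using Cons.prems(1)
    proof (induction u rule: list.induct)
      case (Cons b u)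
      then show ?case using assms(3)[of "snd b"] by (fastforce simp: mem_Times_iff)
    qed simp
    ultimately show ?case using Cons by auto
  qed simp
  then have "{u \<in> lists (S \<times> U). word_size sz u = n} \<subseteq> {u. set u \<subseteq> B \<and> length u \<le> n}" by blast
  then show "finite {u \<in> lists (S \<times> U). word_size sz u = n}"
    using finite_lists_length_le[OF \<open>finite B\<close>] finite_subset by blast
qed

lemma residual_snoc: "u \<in> lists A \<Longrightarrow> a \<in> A \<Longrightarrow> residual A (residual A L u) [a] = residual A L (u @ [a])"
  by (auto simp: residual_def)

text \<open>\<open>Can\<close> need not be an upset. It sees only the first components, so raising
  the second component of a letter changes nothing in it, and the residuals of the intersection are
  still monotone in that component, as \<open>rational_gf_fibre\<close> requires.\<close>

theorem rational_gf_words: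
  assumes U: "strongly_rational_wqo le sz U" and pos: "\<And>a. a \<in> U \<Longrightarrow> 0 < sz a"
    and S: "finite S" and Can: "regular S Can"
    and V: "upset_in (list_emb (letter_le le)) (lists (S \<times> U)) V"
  shows "rational_fps (gf (word_size sz) {u \<in> V. map fst u \<in> Can})"
proof -
  define A where "A = S \<times> U"
  define L where "L = {u \<in> V. map fst u \<in> Can}"
  have wqoU: "wqo_on le U" and flU: "finite_levels sz U"
    using U unfolding strongly_rational_wqo_def by auto
  have wqoA: "wqo_on (letter_le le) A" unfolding A_def by (rule wqo_on_letter_le[OF S wqoU])
  have fl: "finite_levels (word_size sz) K" if "K \<subseteq> lists A" for K
    using finite_levels_subset[OF finite_levels_words[OF S flU pos]] that unfolding A_def by blast
  have regL: "regular A L"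
  proof (rule regular_comb[where F = "(\<inter>)"])
    show "regular A V" using regular_upset[OF wqoA] V unfolding A_def by blast
    show "regular A {u \<in> lists A. map fst u \<in> Can}"
    proof -
      have fst_lists: "map fst v \<in> lists S" if "v \<in> lists A" for v
        using that by (induction v) (auto simp: A_def)
      have "residual A {u \<in> lists A. map fst u \<in> Can} u =
          {v \<in> lists A. map fst v \<in> residual S Can (map fst u)}" if "u \<in> lists A" for u
        using that fst_lists by (auto simp: residual_def simp del: in_lists_conv_set)
      moreover have "residual S Can (map fst u) \<in> residual S Can ` lists S" if "u \<in> lists A" for u
        using fst_lists[OF that] by (rule imageI)
      ultimately have "residual A {u \<in> lists A. map fst u \<in> Can} ` lists A \<subseteq>
          (\<lambda>K. {v \<in> lists A. map fst v \<in> K}) ` residual S Can ` lists S"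
        by (simp add: image_subset_iff del: in_lists_conv_set)
      then show ?thesis using Can unfolding regular_def by (meson finite_imageI finite_subset)
    qed
  qed (auto simp: residual_def L_def)
  define \<K> where "\<K> = residual A L ` lists A"
  define G where "G K K' = {a \<in> A. residual A K [a] = K'}" for K K'
  define c where "c K = gf (word_size sz) (K \<inter> {[]})" for K :: "('b \<times> 'a) list set"
  define g where "g K K' = gf (\<lambda>a. sz (snd a)) (G K K')" for K K'
  have fin\<K>: "finite \<K>" using regL unfolding \<K>_def regular_def .
  have sub: "K \<subseteq> lists A" if "K \<in> \<K>" for K using that unfolding \<K>_def residual_def by blast
  have der: "residual A K [a] \<in> \<K>" if K: "K \<in> \<K>" and a: "a \<in> A" for K a
  proof -
    obtain u where u: "K = residual A L u" "u \<in> lists A" using K unfolding \<K>_def by blast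
    have "residual A K [a] = residual A L (u @ [a])" unfolding u(1) by (rule residual_snoc[OF u(2) a])
    moreover have "u @ [a] \<in> lists A" using u(2) a by simp
    ultimately show ?thesis unfolding \<K>_def by (simp only: imageI)
  qed
  have flA: "finite_levels (\<lambda>a. sz (snd a)) G'" if "G' \<subseteq> A" for G'
  proof -
    have "{a \<in> A. sz (snd a) = n} = S \<times> {a \<in> U. sz a = n}" for n unfolding A_def by auto
    then have "finite_levels (\<lambda>a. sz (snd a)) A" using S flU unfolding finite_levels_def by simp
    then show ?thesis using that finite_levels_subset by blast
  qed
  have eq: "gf (word_size sz) K = c K + (\<Sum>K'\<in>\<K>. g K K' * gf (word_size sz) K')" if K: "K \<in> \<K>" for K
  proof -
    \<comment> \<open>The words of \<open>K\<close> whose first letter leads from \<open>K\<close>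
      to \<open>K'\<close>. Together with the empty word, if it is in \<open>K\<close>, these are
      disjoint parts that exhaust \<open>K\<close>.\<close>
    define J where "J K' = (\<lambda>(a, v). a # v) ` (G K K' \<times> K')" for K'
    have J_sub: "J K' \<subseteq> lists A" if "K' \<in> \<K>" for K'
    proof
      fix w assume "w \<in> J K'"
      then obtain a v where w: "w = a # v" "a \<in> A" "v \<in> K'" unfolding J_def G_def by auto
      moreover have "v \<in> lists A" using w(3) sub[OF that] by blast
      ultimately show "w \<in> lists A" by simp
    qed
    have "K = (K \<inter> {[]}) \<union> (\<Union>K'\<in>\<K>. J K')"
    proof (intro equalityI subsetI)
      fix w assume w: "w \<in> K"
      show "w \<in> (K \<inter> {[]}) \<union> (\<Union>K'\<in>\<K>. J K')"
      proof (cases w)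
        case (Cons a v)
        have av: "a \<in> A" "v \<in> lists A" using w sub[OF K] unfolding Cons by auto
        then have "v \<in> residual A K [a]" using w unfolding Cons residual_def by simp
        then have "w \<in> J (residual A K [a])" using av(1) unfolding J_def G_def Cons by auto
        then show ?thesis using der[OF K av(1)] by blast
      qed (use w in simp)
    next
      fix w assume "w \<in> (K \<inter> {[]}) \<union> (\<Union>K'\<in>\<K>. J K')"
      then show "w \<in> K" unfolding J_def G_def residual_def by auto
    qed
    then have "gf (word_size sz) K = gf (word_size sz) ((K \<inter> {[]}) \<union> (\<Union>K'\<in>\<K>. J K'))" by simp
    also have "\<dots> = c K + gf (word_size sz) (\<Union>K'\<in>\<K>. J K')"
      unfolding c_def using J_sub by (intro gf_Un fl) (auto simp: J_def)
    also have "gf (word_size sz) (\<Union>K'\<in>\<K>. J K') = (\<Sum>K'\<in>\<K>. gf (word_size sz) (J K'))"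
      by (intro gf_UN fin\<K> fl J_sub) (auto simp: J_def G_def)
    also have "\<dots> = (\<Sum>K'\<in>\<K>. g K K' * gf (word_size sz) K')"
    proof (rule sum.cong)
      fix K' assume K': "K' \<in> \<K>"
      have "gf (\<lambda>(a, v). sz (snd a) + word_size sz v) (G K K' \<times> K') = gf (word_size sz) (J K')"
        unfolding J_def by (rule gf_bij[where h = "\<lambda>(a, v). a # v"]) (auto simp: bij_betw_def inj_on_def)
      moreover have "gf (\<lambda>(a, v). sz (snd a) + word_size sz v) (G K K' \<times> K') =
          g K K' * gf (word_size sz) K'"
        unfolding g_def by (intro gf_Times flA fl sub K') (auto simp: G_def)
      ultimately show "gf (word_size sz) (J K') = g K K' * gf (word_size sz) K'" by simp
    qed simp
    finally show ?thesis .
  qed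
  have c_rat: "rational_fps (c K)" for K
  proof -
    have "gf (word_size sz) {[] :: ('b \<times> 'a) list} = 1"
    proof -
      have "card {a. a = [] \<and> word_size sz (a :: ('b \<times> 'a) list) = n} = (if n = 0 then 1 else 0)" for n
      proof -
        have "{a. a = [] \<and> word_size sz (a :: ('b \<times> 'a) list) = n} = (if n = 0 then {[]} else {})" by auto
        then show ?thesis by simp
      qed
      then show ?thesis by (simp add: fps_eq_iff gf_nth)
    qed
    then show ?thesis unfolding c_def by (cases "[] \<in> K") (simp_all add: Int_insert_right)
  qed
  have g_rat: "rational_fps (g K K') \<and> fps_nth (g K K') 0 = 0" if K: "K \<in> \<K>" and K': "K' \<in> \<K>" for K K'
  proof
    obtain u where u: "K = residual A L u" "u \<in> lists A" using K unfolding \<K>_def by blast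
    have fib: "rational_fps (gf sz {a \<in> U. residual A K [(s, a)] = K'})" if s: "s \<in> S" for s
    proof (rule rational_gf_fibre[OF U])
      have "(\<lambda>a. residual A K [(s, a)]) ` U \<subseteq> \<K>" using der[OF K] s unfolding A_def by auto
      then show "finite ((\<lambda>a. residual A K [(s, a)]) ` U)" using fin\<K> finite_subset by blast
      show "residual A K [(s, a)] \<subseteq> residual A K [(s, b)]" if ab: "a \<in> U" "b \<in> U" "le a b" for a b
      proof
        fix v assume "v \<in> residual A K [(s, a)]"
        then have v: "v \<in> lists A" "u @ (s, a) # v \<in> V" "map fst (u @ (s, a) # v) \<in> Can"
          unfolding u(1) residual_def L_def by auto
        have refl: "list_emb (letter_le le) w w" if "w \<in> lists A" for w
          using that wqo_on_refl[OF wqoA] by (intro list_emb_refl) auto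
        have "list_emb (letter_le le) (u @ (s, a) # v) (u @ (s, b) # v)"
          by (intro list_emb_append_mono list_emb_Cons2 refl v u(2)) (simp add: letter_le_def ab)
        moreover have "u @ (s, b) # v \<in> lists A" using u(2) v(1) s ab unfolding A_def by simp
        ultimately have "u @ (s, b) # v \<in> V" using V v(2) unfolding upset_in_def A_def by blast
        then show "v \<in> residual A K [(s, b)]"
          using v s ab unfolding u(1) residual_def L_def A_def by simp
      qed
    qed
    have "G K K' = (\<Union>s\<in>S. Pair s ` {a \<in> U. residual A K [(s, a)] = K'})"
      unfolding G_def A_def by auto
    moreover have "gf (\<lambda>a. sz (snd a)) (\<Union>s\<in>S. Pair s ` {a \<in> U. residual A K [(s, a)] = K'}) =
        (\<Sum>s\<in>S. gf (\<lambda>a. sz (snd a)) (Pair s ` {a \<in> U. residual A K [(s, a)] = K'}))"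
      by (intro gf_UN S flA) (auto simp: A_def)
    moreover have "gf (\<lambda>a. sz (snd a)) (Pair s ` {a \<in> U. residual A K [(s, a)] = K'}) =
        gf sz {a \<in> U. residual A K [(s, a)] = K'}" for s
      by (rule gf_bij[symmetric]) (auto simp: bij_betw_def inj_on_def)
    ultimately have "g K K' = (\<Sum>s\<in>S. gf sz {a \<in> U. residual A K [(s, a)] = K'})"
      unfolding g_def by simp
    then show "rational_fps (g K K')" using fib by (simp add: rational_fps_sum)
    \<comment> \<open>Letters of size zero do not exist; this gives the zero constant terms that
      make the pivots of the linear system invertible.\<close>
    have "{a \<in> G K K'. sz (snd a) = 0} = {}" using pos unfolding G_def A_def by fastforce
    then show "fps_nth (g K K') 0 = 0" unfolding g_def gf_nth by (simp only: card.empty of_nat_0)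
  qed
  have "rational_fps (gf (word_size sz) (residual A L []))"
    by (rule rational_linear_system[OF fin\<K> eq c_rat g_rat]) (auto simp: \<K>_def)
  moreover have "residual A L [] = L" using V unfolding residual_def L_def upset_in_def A_def by auto
  ultimately show ?thesis unfolding L_def by simp
qed

section \<open>Permutations as point sets\<close>

lemma list_emb_nth:
  "list_emb R xs ys \<longleftrightarrow> (\<exists>f. strict_mono_on {..<length xs} f \<and> f ` {..<length xs} \<subseteq> {..<length ys} \<and>
     (\<forall>i<length xs. R (xs ! i) (ys ! f i)))"
proof
  assume "list_emb R xs ys"
  then show "\<exists>f. strict_mono_on {..<length xs} f \<and> f ` {..<length xs} \<subseteq> {..<length ys} \<and>
     (\<forall>i<length xs. R (xs ! i) (ys ! f i))"
  proof induction
    case (list_emb_Nil ys)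
    then show ?case by simp
  next
    case (list_emb_Cons xs ys y)
    then obtain f where f: "strict_mono_on {..<length xs} f" "f ` {..<length xs} \<subseteq> {..<length ys}"
      "\<forall>i<length xs. R (xs ! i) (ys ! f i)" by blast
    then show ?case
      by (intro exI[of _ "\<lambda>i. Suc (f i)"]) (auto simp: strict_mono_on_def)
  next
    case (list_emb_Cons2 x y xs ys)
    then obtain f where f: "strict_mono_on {..<length xs} f" "f ` {..<length xs} \<subseteq> {..<length ys}"
      "\<forall>i<length xs. R (xs ! i) (ys ! f i)" by blast
    have fl: "f i < length ys" if "i < length xs" for i using f(2) that by blast
    define g where "g i = (case i of 0 \<Rightarrow> 0 | Suc j \<Rightarrow> Suc (f j))" for i
    have "strict_mono_on {..<length (x # xs)} g"
      using f(1) unfolding strict_mono_on_def g_def by (auto split: nat.splits)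
    moreover have "g ` {..<length (x # xs)} \<subseteq> {..<length (y # ys)}"
      using fl unfolding g_def by (auto split: nat.splits)
    moreover have "\<forall>i<length (x # xs). R ((x # xs) ! i) ((y # ys) ! g i)"
      using f(3) list_emb_Cons2.hyps(1) unfolding g_def by (auto split: nat.splits simp: nth_Cons)
    ultimately show ?case by blast
  qed
next
  assume "\<exists>f. strict_mono_on {..<length xs} f \<and> f ` {..<length xs} \<subseteq> {..<length ys} \<and>
     (\<forall>i<length xs. R (xs ! i) (ys ! f i))"
  then show "list_emb R xs ys"
  proof (induction ys arbitrary: xs)
    case Nil
    then show ?case by (cases xs) auto
  next
    case (Cons y ys)
    then obtain f where f: "strict_mono_on {..<length xs} f" "f ` {..<length xs} \<subseteq> {..<length (y # ys)}"
      "\<forall>i<length xs. R (xs ! i) ((y # ys) ! f i)" by blast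
    show ?case
    proof (cases xs)
      case xs: (Cons x xs')
      have mono: "f i < f j" if "i < j" "j < length xs" for i j
        using f(1) that unfolding strict_mono_on_def by auto
      have bound: "f i < Suc (length ys)" if "i < length xs" for i using f(2) that by auto
      show ?thesis
      proof (cases "f 0 = 0")
        case True
        have pos: "0 < f (Suc i)" if "i < length xs'" for i
          using mono[of 0 "Suc i"] that xs by simp
        have "list_emb R xs' ys"
        proof (rule Cons.IH, intro exI[of _ "\<lambda>i. f (Suc i) - 1"] conjI)
          show "strict_mono_on {..<length xs'} (\<lambda>i. f (Suc i) - 1)"
            unfolding strict_mono_on_def
          proof (intro allI impI, elim conjE)
            fix r s assume rs: "r \<in> {..<length xs'}" "s \<in> {..<length xs'}" "r < s"
            then show "f (Suc r) - 1 < f (Suc s) - 1"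
              using mono[of "Suc r" "Suc s"] pos[of r] xs by simp
          qed
          show "(\<lambda>i. f (Suc i) - 1) ` {..<length xs'} \<subseteq> {..<length ys}"
          proof (intro image_subsetI)
            fix i assume "i \<in> {..<length xs'}"
            then show "f (Suc i) - 1 \<in> {..<length ys}" using bound[of "Suc i"] pos[of i] xs by auto
          qed
          show "\<forall>i<length xs'. R (xs' ! i) (ys ! (f (Suc i) - 1))"
          proof (intro allI impI)
            fix i assume i: "i < length xs'"
            then show "R (xs' ! i) (ys ! (f (Suc i) - 1))"
              using f(3)[rule_format, of "Suc i"] pos[OF i] xs by (simp add: nth_Cons')
          qed
        qed
        moreover have "R x y" using f(3)[rule_format, of 0] True xs by simp
        ultimately show ?thesis using xs by blast
      next
        case False
        have pos: "0 < f i" if "i < length xs" for i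
          using mono[of 0 i] that False by (cases "i = 0") auto
        have "list_emb R xs ys"
        proof (rule Cons.IH, intro exI[of _ "\<lambda>i. f i - 1"] conjI)
          show "strict_mono_on {..<length xs} (\<lambda>i. f i - 1)"
            unfolding strict_mono_on_def
          proof (intro allI impI, elim conjE)
            fix r s assume rs: "r \<in> {..<length xs}" "s \<in> {..<length xs}" "r < s"
            then show "f r - 1 < f s - 1" using mono[of r s] pos[of r] by simp
          qed
          show "(\<lambda>i. f i - 1) ` {..<length xs} \<subseteq> {..<length ys}"
          proof (intro image_subsetI)
            fix i assume "i \<in> {..<length xs}"
            then show "f i - 1 \<in> {..<length ys}" using bound[of i] pos[of i] by auto
          qed
          show "\<forall>i<length xs. R (xs ! i) (ys ! (f i - 1))"
          proof (intro allI impI)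
            fix i assume i: "i < length xs"
            then show "R (xs ! i) (ys ! (f i - 1))"
              using f(3)[rule_format, of i] pos[OF i] by (simp add: nth_Cons')
          qed
        qed
        then show ?thesis by blast
      qed
    qed simp
  qed
qed

lemma contains_pattern_nth:
  "contains_pattern \<pi> \<sigma> \<longleftrightarrow> (\<exists>f. strict_mono_on {..<length \<sigma>} f \<and> f ` {..<length \<sigma>} \<subseteq> {..<length \<pi>} \<and>
     (\<forall>i<length \<sigma>. \<forall>j<length \<sigma>. \<pi> ! f i < \<pi> ! f j \<longleftrightarrow> \<sigma> ! i < \<sigma> ! j))"
proof
  assume "contains_pattern \<pi> \<sigma>"
  then obtain xs where xs: "subseq xs \<pi>" "order_isomorphic xs \<sigma>"
    unfolding contains_pattern_def by blast
  then obtain f where f: "strict_mono_on {..<length xs} f" "f ` {..<length xs} \<subseteq> {..<length \<pi>}"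
    "\<forall>i<length xs. xs ! i = \<pi> ! f i" unfolding list_emb_nth by blast
  then show "\<exists>f. strict_mono_on {..<length \<sigma>} f \<and> f ` {..<length \<sigma>} \<subseteq> {..<length \<pi>} \<and>
     (\<forall>i<length \<sigma>. \<forall>j<length \<sigma>. \<pi> ! f i < \<pi> ! f j \<longleftrightarrow> \<sigma> ! i < \<sigma> ! j)"
    using xs(2) unfolding order_isomorphic_def by (metis (no_types, lifting))
next
  assume "\<exists>f. strict_mono_on {..<length \<sigma>} f \<and> f ` {..<length \<sigma>} \<subseteq> {..<length \<pi>} \<and>
     (\<forall>i<length \<sigma>. \<forall>j<length \<sigma>. \<pi> ! f i < \<pi> ! f j \<longleftrightarrow> \<sigma> ! i < \<sigma> ! j)"
  then obtain f where f: "strict_mono_on {..<length \<sigma>} f" "f ` {..<length \<sigma>} \<subseteq> {..<length \<pi>}"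
    "\<forall>i<length \<sigma>. \<forall>j<length \<sigma>. \<pi> ! f i < \<pi> ! f j \<longleftrightarrow> \<sigma> ! i < \<sigma> ! j" by blast
  define xs where "xs = map (\<lambda>i. \<pi> ! f i) [0..<length \<sigma>]"
  have "subseq xs \<pi>" unfolding list_emb_nth xs_def using f by (intro exI[of _ f]) auto
  moreover have "order_isomorphic xs \<sigma>" unfolding order_isomorphic_def xs_def using f(3) by auto
  ultimately show "contains_pattern \<pi> \<sigma>" unfolding contains_pattern_def by blast
qed

lemma contains_pattern_refl [simp]: "contains_pattern \<pi> \<pi>"
  unfolding contains_pattern_nth by (rule exI[of _ id]) (simp add: strict_mono_on_def)

lemma contains_pattern_trans:
  assumes "contains_pattern \<pi> \<sigma>" "contains_pattern \<sigma> \<tau>"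
  shows "contains_pattern \<pi> \<tau>"
proof -
  obtain f where f: "strict_mono_on {..<length \<sigma>} f" "f ` {..<length \<sigma>} \<subseteq> {..<length \<pi>}"
    "\<forall>i<length \<sigma>. \<forall>j<length \<sigma>. \<pi> ! f i < \<pi> ! f j \<longleftrightarrow> \<sigma> ! i < \<sigma> ! j"
    using assms(1) unfolding contains_pattern_nth by blast
  obtain g where g: "strict_mono_on {..<length \<tau>} g" "g ` {..<length \<tau>} \<subseteq> {..<length \<sigma>}"
    "\<forall>i<length \<tau>. \<forall>j<length \<tau>. \<sigma> ! g i < \<sigma> ! g j \<longleftrightarrow> \<tau> ! i < \<tau> ! j"
    using assms(2) unfolding contains_pattern_nth by blast
  have gl: "g i < length \<sigma>" if "i < length \<tau>" for i using g(2) that by blast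
  show ?thesis
    unfolding contains_pattern_nth
  proof (intro exI[of _ "\<lambda>i. f (g i)"] conjI)
    show "strict_mono_on {..<length \<tau>} (\<lambda>i. f (g i))"
      using f(1) g(1) gl unfolding strict_mono_on_def by simp
    show "(\<lambda>i. f (g i)) ` {..<length \<tau>} \<subseteq> {..<length \<pi>}" using f(2) gl by blast
    show "\<forall>i<length \<tau>. \<forall>j<length \<tau>. \<pi> ! f (g i) < \<pi> ! f (g j) \<longleftrightarrow> \<tau> ! i < \<tau> ! j"
      using f(3) g(3) gl by simp
  qed
qed

definition pattern_le :: "nat list \<Rightarrow> nat list \<Rightarrow> bool" where
  "pattern_le \<sigma> \<pi> \<longleftrightarrow> contains_pattern \<pi> \<sigma>"

lemma transp_pattern_le: "transp pattern_le"
  unfolding pattern_le_def by (intro transpI) (rule contains_pattern_trans)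

lemma is_perm_iff: "is_perm \<pi> \<longleftrightarrow> distinct \<pi> \<and> set \<pi> = {1..length \<pi>}"
  unfolding is_perm_def permutations_of_set_def by auto

lemma is_perm_distinct_bounded:
  assumes "distinct \<pi>" "set \<pi> \<subseteq> {1..length \<pi>}"
  shows "is_perm \<pi>"
  unfolding is_perm_iff using assms card_subset_eq[of "{1..length \<pi>}" "set \<pi>"] distinct_card by force

text \<open>The entry of a permutation is its own rank, which is why the relative order determines
  the permutation in \<open>perm_eqI\<close>.\<close>

lemma perm_rank:
  assumes "is_perm \<pi>" "i < length \<pi>"
  shows "card {j. j < length \<pi> \<and> \<pi> ! j \<le> \<pi> ! i} = \<pi> ! i"
proof -
  have "inj_on (nth \<pi>) {j. j < length \<pi> \<and> \<pi> ! j \<le> \<pi> ! i}"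
    using assms(1) unfolding is_perm_iff by (auto simp: inj_on_def nth_eq_iff_index_eq)
  then have "card {j. j < length \<pi> \<and> \<pi> ! j \<le> \<pi> ! i} = card (nth \<pi> ` {j. j < length \<pi> \<and> \<pi> ! j \<le> \<pi> ! i})"
    by (simp add: card_image)
  also have "nth \<pi> ` {j. j < length \<pi> \<and> \<pi> ! j \<le> \<pi> ! i} = {v \<in> set \<pi>. v \<le> \<pi> ! i}"
    by (auto simp: set_conv_nth)
  also have "{v \<in> set \<pi>. v \<le> \<pi> ! i} = {1..\<pi> ! i}"
    using assms nth_mem[OF assms(2)] unfolding is_perm_iff by auto
  finally show ?thesis by simp
qed

lemma perm_eqI:
  assumes "is_perm \<pi>" "is_perm \<sigma>" "length \<pi> = length \<sigma>"
    and "\<And>i j. i < length \<sigma> \<Longrightarrow> j < length \<sigma> \<Longrightarrow> \<pi> ! i < \<pi> ! j \<longleftrightarrow> \<sigma> ! i < \<sigma> ! j"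
  shows "\<pi> = \<sigma>"
proof (rule nth_equalityI[OF assms(3)])
  fix i assume i: "i < length \<pi>"
  have "{j. j < length \<pi> \<and> \<pi> ! j \<le> \<pi> ! i} = {j. j < length \<sigma> \<and> \<sigma> ! j \<le> \<sigma> ! i}"
    using assms(3,4) i by (auto simp: not_less[symmetric])
  then show "\<pi> ! i = \<sigma> ! i"
    using perm_rank[OF assms(1) i] perm_rank[OF assms(2), of i] i assms(3) by simp
qed

lemma finite_perms: "finite {\<pi>. is_perm \<pi> \<and> length \<pi> = n}"
proof -
  have "{\<pi>. is_perm \<pi> \<and> length \<pi> = n} \<subseteq> permutations_of_set {1..n}" unfolding is_perm_def by auto
  then show ?thesis by (rule finite_subset) (rule finite_permutations_of_set)
qed

section \<open>Point sets up to order isomorphism\<close>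

definition points :: "'a set \<Rightarrow> ('a \<Rightarrow> nat) \<Rightarrow> ('a \<Rightarrow> nat) \<Rightarrow> bool" where
  "points P x y \<longleftrightarrow> finite P \<and> inj_on x P \<and> inj_on y P"

text \<open>Only comparisons matter, so coordinates may be arbitrary natural numbers. Subsets of a
  permutation and the points of an inflated word can then be compared without renumbering
  them.\<close>

definition embeds :: "('a \<Rightarrow> 'b) \<Rightarrow> 'a set \<Rightarrow> ('a \<Rightarrow> nat) \<Rightarrow> ('a \<Rightarrow> nat) \<Rightarrow>
    'b set \<Rightarrow> ('b \<Rightarrow> nat) \<Rightarrow> ('b \<Rightarrow> nat) \<Rightarrow> bool" where
  "embeds f P x y Q x' y' \<longleftrightarrow> f ` P \<subseteq> Q \<and> (\<forall>p\<in>P. \<forall>q\<in>P.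
     (x p < x q \<longleftrightarrow> x' (f p) < x' (f q)) \<and> (y p < y q \<longleftrightarrow> y' (f p) < y' (f q)))"

definition shape :: "nat list \<Rightarrow> 'a set \<Rightarrow> ('a \<Rightarrow> nat) \<Rightarrow> ('a \<Rightarrow> nat) \<Rightarrow> bool" where
  "shape \<pi> P x y \<longleftrightarrow> is_perm \<pi> \<and> (\<exists>f. bij_betw f {..<length \<pi>} P \<and>
     embeds f {..<length \<pi>} (\<lambda>i. i) (nth \<pi>) P x y)"

lemma points_subset: "points P x y \<Longrightarrow> Q \<subseteq> P \<Longrightarrow> points Q x y"
  unfolding points_def by (meson finite_subset inj_on_subset)

lemma points_perm: "is_perm \<pi> \<Longrightarrow> points {..<length \<pi>} (\<lambda>i. i) (nth \<pi>)"
  unfolding points_def is_perm_iff by (auto simp: inj_on_def nth_eq_iff_index_eq)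

lemma shape_self: "is_perm \<pi> \<Longrightarrow> shape \<pi> {..<length \<pi>} (\<lambda>i. i) (nth \<pi>)"
  unfolding shape_def embeds_def by (intro conjI exI[of _ id]) auto

lemma shape_length: "shape \<pi> P x y \<Longrightarrow> length \<pi> = card P"
  unfolding shape_def using bij_betw_same_card by force

lemma embeds_comp:
  "embeds f P x y Q x' y' \<Longrightarrow> embeds g Q x' y' R x'' y'' \<Longrightarrow> embeds (\<lambda>p. g (f p)) P x y R x'' y''"
  unfolding embeds_def by (auto simp: image_subset_iff)

lemma embeds_inv:
  assumes "embeds f P x y Q x' y'" "bij_betw f P Q"
  shows "embeds (inv_into P f) Q x' y' P x y"
  unfolding embeds_def
proof (intro conjI ballI)
  show "inv_into P f ` Q \<subseteq> P" using assms(2) by (metis bij_betw_imp_surj_on bij_betw_inv_into subset_refl)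
  fix p q assume pq: "p \<in> Q" "q \<in> Q"
  have fg: "f (inv_into P f p) = p" "f (inv_into P f q) = q" "inv_into P f p \<in> P" "inv_into P f q \<in> P"
    using assms(2) pq by (auto simp: bij_betw_def f_inv_into_f inv_into_into)
  then show "(x' p < x' q) = (x (inv_into P f p) < x (inv_into P f q))"
    "(y' p < y' q) = (y (inv_into P f p) < y (inv_into P f q))"
    using assms(1) unfolding embeds_def by metis+
qed

lemma embeds_inj: "points P x y \<Longrightarrow> embeds f P x y Q x' y' \<Longrightarrow> inj_on f P"
  unfolding embeds_def points_def inj_on_def by (metis linorder_neq_iff)

text \<open>Standardisation: positions are ranks with respect to \<open>x\<close>, values are ranks
  with respect to \<open>y\<close>.\<close>

lemma ex_shape:
  assumes "points P x y"
  shows "\<exists>\<pi>. shape \<pi> P x y"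
proof -
  have fin: "finite P" and ix: "inj_on x P" and iy: "inj_on y P" using assms unfolding points_def by auto
  define xs where "xs = sorted_list_of_set (x ` P)"
  define f where "f i = the_inv_into P x (xs ! i)" for i
  have len: "length xs = card P" using fin ix unfolding xs_def by (simp add: card_image)
  have sxs: "set xs = x ` P" using fin unfolding xs_def by simp
  have fP: "f i \<in> P" and xf: "x (f i) = xs ! i" if "i < card P" for i
    using that nth_mem[of i xs] len sxs ix unfolding f_def
    by (auto intro: the_inv_into_into simp: f_the_inv_into_f)
  have srt: "sorted_wrt (<) xs" unfolding xs_def by simp
  have xmono: "x (f i) < x (f j) \<longleftrightarrow> i < j" if "i < card P" "j < card P" for i j
    using that xf srt len by (metis linorder_neqE_nat not_less_iff_gr_or_eq sorted_wrt_nth_less)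
  have bij: "bij_betw f {..<card P} P"
  proof -
    have "inj_on f {..<card P}" using xmono by (auto simp: inj_on_def) (metis less_irrefl linorder_neqE_nat)
    moreover from this have "f ` {..<card P} = P"
      using fP fin by (intro card_subset_eq) (auto simp: card_image)
    ultimately show ?thesis unfolding bij_betw_def by blast
  qed
  define \<pi> where "\<pi> = map (\<lambda>i. card {q \<in> P. y q \<le> y (f i)}) [0..<card P]"
  have ymono: "card {q \<in> P. y q \<le> y p} < card {q \<in> P. y q \<le> y p'}" if "p \<in> P" "p' \<in> P" "y p < y p'" for p p'
  proof (rule psubset_card_mono)
    show "finite {q \<in> P. y q \<le> y p'}" using fin by simp
    have "p' \<in> {q \<in> P. y q \<le> y p'}" "p' \<notin> {q \<in> P. y q \<le> y p}" using that by auto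
    moreover have "{q \<in> P. y q \<le> y p} \<subseteq> {q \<in> P. y q \<le> y p'}" using that(3) by auto
    ultimately show "{q \<in> P. y q \<le> y p} \<subset> {q \<in> P. y q \<le> y p'}" by blast
  qed
  have yiff: "\<pi> ! i < \<pi> ! j \<longleftrightarrow> y (f i) < y (f j)" if ij: "i < card P" "j < card P" for i j
  proof -
    have e: "\<pi> ! i = card {q \<in> P. y q \<le> y (f i)}" "\<pi> ! j = card {q \<in> P. y q \<le> y (f j)}"
      unfolding \<pi>_def using ij by simp_all
    consider "y (f i) < y (f j)" | "y (f i) = y (f j)" | "y (f j) < y (f i)" by linarith
    then show ?thesis
      using ymono[OF fP[OF ij(1)] fP[OF ij(2)]] ymono[OF fP[OF ij(2)] fP[OF ij(1)]] e
      by cases auto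
  qed
  have lp: "length \<pi> = card P" unfolding \<pi>_def by simp
  have "is_perm \<pi>"
  proof (rule is_perm_distinct_bounded)
    show "distinct \<pi>"
      unfolding distinct_conv_nth lp
    proof (intro allI impI)
      fix i j assume ij: "i < card P" "j < card P" "i \<noteq> j"
      then have "f i \<noteq> f j" using bij unfolding bij_betw_def inj_on_def by auto
      then have "y (f i) \<noteq> y (f j)" using iy fP ij unfolding inj_on_def by blast
      then show "\<pi> ! i \<noteq> \<pi> ! j" using yiff[of i j] yiff[of j i] ij by linarith
    qed
    show "set \<pi> \<subseteq> {1..length \<pi>}"
    proof
      fix v assume "v \<in> set \<pi>"
      then obtain i where i: "i < card P" "v = card {q \<in> P. y q \<le> y (f i)}" unfolding \<pi>_def by auto
      have "card {q \<in> P. y q \<le> y (f i)} \<le> card P" using fin by (intro card_mono) auto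
      moreover have "{q \<in> P. y q \<le> y (f i)} \<noteq> {}" using fP[OF i(1)] by auto
      ultimately show "v \<in> {1..length \<pi>}" using fin unfolding lp i(2)
        by (simp add: Suc_le_eq card_gt_0_iff)
    qed
  qed
  moreover have "embeds f {..<length \<pi>} (\<lambda>i. i) (nth \<pi>) P x y"
    unfolding embeds_def lp using fP xmono yiff by auto
  ultimately show ?thesis unfolding shape_def using bij lp by metis
qed

lemma shape_embeds_contains:
  assumes "shape \<pi> P x y" "shape \<sigma> Q x' y'" "embeds f Q x' y' P x y"
  shows "contains_pattern \<pi> \<sigma>"
proof -
  obtain g where g: "bij_betw g {..<length \<pi>} P" "embeds g {..<length \<pi>} (\<lambda>i. i) (nth \<pi>) P x y"
    using assms(1) unfolding shape_def by blast
  obtain h where h: "embeds h {..<length \<sigma>} (\<lambda>i. i) (nth \<sigma>) Q x' y'"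
    using assms(2) unfolding shape_def by blast
  define k where "k i = inv_into {..<length \<pi>} g (f (h i))" for i
  have "embeds k {..<length \<sigma>} (\<lambda>i. i) (nth \<sigma>) {..<length \<pi>} (\<lambda>i. i) (nth \<pi>)"
    unfolding k_def by (rule embeds_comp[OF embeds_comp[OF h assms(3)] embeds_inv[OF g(2,1)]])
  then show ?thesis unfolding contains_pattern_nth embeds_def strict_mono_on_def
    by (intro exI[of _ k]) auto
qed

lemma contains_embeds:
  assumes "contains_pattern \<pi> \<sigma>"
  shows "\<exists>f. embeds f {..<length \<sigma>} (\<lambda>i. i) (nth \<sigma>) {..<length \<pi>} (\<lambda>i. i) (nth \<pi>)"
proof -
  obtain f where f: "strict_mono_on {..<length \<sigma>} f" "f ` {..<length \<sigma>} \<subseteq> {..<length \<pi>}"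
    "\<forall>i<length \<sigma>. \<forall>j<length \<sigma>. \<pi> ! f i < \<pi> ! f j \<longleftrightarrow> \<sigma> ! i < \<sigma> ! j"
    using assms unfolding contains_pattern_nth by blast
  have "f i < f j \<longleftrightarrow> i < j" if "i < length \<sigma>" "j < length \<sigma>" for i j
    using f(1) that unfolding strict_mono_on_def by (metis lessThan_iff linorder_neqE_nat less_asym less_irrefl)
  then show ?thesis using f unfolding embeds_def by (intro exI[of _ f]) auto
qed

lemma shape_contains_embeds:
  assumes "shape \<pi> P x y" "shape \<sigma> Q x' y'" "contains_pattern \<pi> \<sigma>"
  shows "\<exists>f. embeds f Q x' y' P x y"
proof -
  obtain g where g: "embeds g {..<length \<pi>} (\<lambda>i. i) (nth \<pi>) P x y"
    using assms(1) unfolding shape_def by blast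
  obtain h where h: "bij_betw h {..<length \<sigma>} Q" "embeds h {..<length \<sigma>} (\<lambda>i. i) (nth \<sigma>) Q x' y'"
    using assms(2) unfolding shape_def by blast
  obtain f where "embeds f {..<length \<sigma>} (\<lambda>i. i) (nth \<sigma>) {..<length \<pi>} (\<lambda>i. i) (nth \<pi>)"
    using contains_embeds[OF assms(3)] by blast
  then show ?thesis using embeds_comp[OF embeds_comp[OF embeds_inv[OF h(2,1)]] g] by blast
qed

lemma contains_same_length:
  assumes "is_perm \<pi>" "is_perm \<sigma>" "contains_pattern \<pi> \<sigma>" "length \<pi> = length \<sigma>"
  shows "\<pi> = \<sigma>"
proof -
  obtain xs where xs: "subseq xs \<pi>" "order_isomorphic xs \<sigma>"
    using assms(3) unfolding contains_pattern_def by blast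
  then have "xs = \<pi>" using assms(4) unfolding order_isomorphic_def by (metis subseq_same_length)
  then show ?thesis using xs(2) perm_eqI[OF assms(1,2,4)] unfolding order_isomorphic_def by simp
qed

lemma shape_unique:
  assumes "shape \<pi> P x y" "shape \<sigma> Q x' y'" "embeds f Q x' y' P x y" "card P = card Q"
  shows "\<pi> = \<sigma>"
  using shape_embeds_contains[OF assms(1-3)] shape_length[OF assms(1)] shape_length[OF assms(2)] assms
  by (intro contains_same_length) (auto simp: shape_def)

section \<open>Inflations\<close>

text \<open>Two-digit numbers in base \<open>B\<close> compare lexicographically. Composite
  coordinates and cell numbers below are built this way, which keeps them natural numbers.\<close>

lemma lex_key_less:
  fixes k k' a b B :: nat
  assumes "a < B" "b < B"
  shows "k * B + a < k' * B + b \<longleftrightarrow> k < k' \<or> (k = k' \<and> a < b)"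
proof -
  have aux: "m * B + c < n * B + d" if "m < n" "c < B" for m n c d
  proof -
    have "m * B + c < Suc m * B" using that(2) by simp
    also have "\<dots> \<le> n * B" using that(1) by (intro mult_right_mono) auto
    finally show ?thesis by simp
  qed
  show ?thesis
    using aux[of k k' a b] aux[of k' k b a] assms by (metis add_less_cancel_left linorder_neqE_nat order_less_asym)
qed

text \<open>The functions \<open>kx w\<close> and \<open>ky w\<close> are the coordinates of the points encoded by the letters of \<open>w\<close>.\<close>
locale skeleton =
  fixes kx ky :: "'s list \<Rightarrow> nat \<Rightarrow> nat"
  assumes inj_kx: "inj_on (kx w) {..<length w}" and inj_ky: "inj_on (ky w) {..<length w}"
    and key_subword: "\<And>v w f. strict_mono_on {..<length v} f \<Longrightarrow> f ` {..<length v} \<subseteq> {..<length w} \<Longrightarrow>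
      (\<And>i. i < length v \<Longrightarrow> v ! i = w ! f i) \<Longrightarrow>
      embeds f {..<length v} (kx v) (ky v) {..<length w} (kx w) (ky w)"
begin

definition ipts :: "('s \<times> nat list) list \<Rightarrow> (nat \<times> nat) set" where
  "ipts u = (SIGMA i:{..<length u}. {..<length (snd (u ! i))})"

text \<open>The base exceeds every position and every value inside a block; values run up to the
  length of the block, hence the \<open>Suc\<close>.\<close>

definition ix :: "('s \<times> nat list) list \<Rightarrow> nat \<times> nat \<Rightarrow> nat" where
  "ix u p = kx (map fst u) (fst p) * Suc (word_size length u) + snd p"

definition iy :: "('s \<times> nat list) list \<Rightarrow> nat \<times> nat \<Rightarrow> nat" where
  "iy u p = ky (map fst u) (fst p) * Suc (word_size length u) + snd (u ! fst p) ! snd p"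

definition perm_word :: "('s \<times> nat list) list \<Rightarrow> bool" where
  "perm_word u \<longleftrightarrow> (\<forall>a\<in>set u. is_perm (snd a) \<and> snd a \<noteq> [])"

lemma perm_word_nth:
  assumes "perm_word u" "i < length u"
  shows "is_perm (snd (u ! i))" "snd (u ! i) \<noteq> []"
  using assms unfolding perm_word_def by auto

lemma ipts_iff: "p \<in> ipts u \<longleftrightarrow> fst p < length u \<and> snd p < length (snd (u ! fst p))"
  unfolding ipts_def by (cases p) auto

lemma length_block_le: "i < length u \<Longrightarrow> length (snd (u ! i)) \<le> word_size length u"
  unfolding word_size_def by (rule member_le_sum_list) auto

lemma block_value_le:
  assumes "perm_word u" "p \<in> ipts u"
  shows "snd (u ! fst p) ! snd p < Suc (word_size length u)"
proof -
  have "snd (u ! fst p) ! snd p \<in> set (snd (u ! fst p))" using assms(2) unfolding ipts_iff by simp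
  then show ?thesis
    using perm_word_nth(1)[OF assms(1), of "fst p"] length_block_le[of "fst p" u] assms(2)
    unfolding ipts_iff is_perm_iff by auto
qed

lemma ix_less:
  assumes "p \<in> ipts u" "q \<in> ipts u"
  shows "ix u p < ix u q \<longleftrightarrow> (if fst p = fst q then snd p < snd q
    else kx (map fst u) (fst p) < kx (map fst u) (fst q))"
proof -
  have "snd p < Suc (word_size length u)" "snd q < Suc (word_size length u)"
    using assms length_block_le[of "fst p" u] length_block_le[of "fst q" u] unfolding ipts_iff by auto
  moreover have "kx (map fst u) (fst p) = kx (map fst u) (fst q) \<longleftrightarrow> fst p = fst q"
    using inj_onD[OF inj_kx[of "map fst u"], of "fst p" "fst q"] assms unfolding ipts_iff by auto
  ultimately show ?thesis unfolding ix_def by (subst lex_key_less) auto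
qed

lemma iy_less:
  assumes "perm_word u" "p \<in> ipts u" "q \<in> ipts u"
  shows "iy u p < iy u q \<longleftrightarrow> (if fst p = fst q then snd (u ! fst p) ! snd p < snd (u ! fst q) ! snd q
    else ky (map fst u) (fst p) < ky (map fst u) (fst q))"
proof -
  have "ky (map fst u) (fst p) = ky (map fst u) (fst q) \<longleftrightarrow> fst p = fst q"
    using inj_onD[OF inj_ky[of "map fst u"], of "fst p" "fst q"] assms unfolding ipts_iff by auto
  then show ?thesis
    unfolding iy_def using block_value_le[OF assms(1,2)] block_value_le[OF assms(1,3)]
    by (subst lex_key_less) auto
qed

lemma points_ipts:
  assumes "perm_word u"
  shows "points (ipts u) (ix u) (iy u)"
  unfolding points_def
proof (intro conjI inj_onI)
  show "finite (ipts u)" unfolding ipts_def by blast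
  fix p q assume pq: "p \<in> ipts u" "q \<in> ipts u"
  have kxn: "kx (map fst u) (fst p) \<noteq> kx (map fst u) (fst q)"
    and kyn: "ky (map fst u) (fst p) \<noteq> ky (map fst u) (fst q)" if "fst p \<noteq> fst q"
    using inj_onD[OF inj_kx[of "map fst u"], of "fst p" "fst q"]
      inj_onD[OF inj_ky[of "map fst u"], of "fst p" "fst q"] pq that unfolding ipts_iff by auto
  {
    assume "ix u p = ix u q"
    then have "\<not> ix u p < ix u q" "\<not> ix u q < ix u p" by simp_all
    then show "p = q"
      unfolding ix_less[OF pq] ix_less[OF pq(2,1)] using kxn by (auto simp: prod_eq_iff split: if_splits)
  next
    assume "iy u p = iy u q"
    then have n: "\<not> iy u p < iy u q" "\<not> iy u q < iy u p" by simp_all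
    then have f: "fst p = fst q"
      unfolding iy_less[OF assms pq] iy_less[OF assms pq(2,1)] using kyn by (auto split: if_splits)
    then have "snd (u ! fst p) ! snd p = snd (u ! fst p) ! snd q"
      using n unfolding iy_less[OF assms pq] iy_less[OF assms pq(2,1)] by auto
    then show "p = q"
      using perm_word_nth(1)[OF assms, of "fst p"] pq f unfolding ipts_iff is_perm_iff
      by (auto simp: nth_eq_iff_index_eq prod_eq_iff)
  }
qed

lemma card_ipts: "card (ipts u) = word_size length u"
proof -
  have "card (ipts u) = (\<Sum>i<length u. length (snd (u ! i)))" unfolding ipts_def by simp
  also have "\<dots> = word_size length u"
    unfolding word_size_def by (simp add: sum_list_sum_nth atLeast0LessThan)
  finally show ?thesis .
qed

definition infl :: "('s \<times> nat list) list \<Rightarrow> nat list" where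
  "infl u = (SOME \<pi>. shape \<pi> (ipts u) (ix u) (iy u))"

lemma shape_infl: "perm_word u \<Longrightarrow> shape (infl u) (ipts u) (ix u) (iy u)"
  unfolding infl_def by (rule someI_ex) (rule ex_shape[OF points_ipts])

lemma length_infl: "perm_word u \<Longrightarrow> length (infl u) = word_size length u"
  using shape_length[OF shape_infl] card_ipts by simp

lemma is_perm_infl: "perm_word u \<Longrightarrow> is_perm (infl u)"
  using shape_infl unfolding shape_def by blast

text \<open>By \<open>key_subword\<close> a subword keeps the relative position of different blocks,
  and each block embeds in the block of the matching letter; the two maps combine to one
  embedding.\<close>

lemma infl_mono:
  assumes "list_emb (letter_le pattern_le) u v" "perm_word u" "perm_word v"
  shows "contains_pattern (infl v) (infl u)"
proof -
  obtain f where f: "strict_mono_on {..<length u} f" "f ` {..<length u} \<subseteq> {..<length v}"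
    "\<And>i. i < length u \<Longrightarrow> letter_le pattern_le (u ! i) (v ! f i)"
    using assms(1) unfolding list_emb_nth by blast
  have fl: "f i < length v" if "i < length u" for i using f(2) that by blast
  have fst_eq: "fst (u ! i) = fst (v ! f i)"
    and cont: "contains_pattern (snd (v ! f i)) (snd (u ! i))" if "i < length u" for i
    using f(3)[OF that] unfolding letter_le_def pattern_le_def by auto
  have emb: "embeds f {..<length u} (kx (map fst u)) (ky (map fst u))
      {..<length v} (kx (map fst v)) (ky (map fst v))"
    using key_subword[of "map fst u" f "map fst v"] f(1,2) fl fst_eq by simp
  have "\<exists>g. embeds g {..<length (snd (u ! i))} (\<lambda>i. i) (nth (snd (u ! i)))
      {..<length (snd (v ! f i))} (\<lambda>i. i) (nth (snd (v ! f i)))" if "i < length u" for i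
    using contains_embeds[OF cont[OF that]] .
  then obtain g where g: "\<And>i. i < length u \<Longrightarrow>
      embeds (g i) {..<length (snd (u ! i))} (\<lambda>i. i) (nth (snd (u ! i)))
      {..<length (snd (v ! f i))} (\<lambda>i. i) (nth (snd (v ! f i)))" by metis
  define F where "F p = (f (fst p), g (fst p) (snd p))" for p
  have Fin: "F p \<in> ipts v" if "p \<in> ipts u" for p
    using that fl g[of "fst p"] unfolding ipts_iff F_def embeds_def by auto
  have f_inj: "f i = f j \<longleftrightarrow> i = j" if "i < length u" "j < length u" for i j
    using f(1) that by (metis lessThan_iff inj_on_def strict_mono_on_imp_inj_on)
  have "embeds F (ipts u) (ix u) (iy u) (ipts v) (ix v) (iy v)"
    unfolding embeds_def
  proof (intro conjI ballI)
    show "F ` ipts u \<subseteq> ipts v" using Fin by blast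
    fix p q assume pq: "p \<in> ipts u" "q \<in> ipts u"
    then have l: "fst p < length u" "fst q < length u" unfolding ipts_iff by auto
    have lb: "snd p < length (snd (u ! fst p))" "snd q < length (snd (u ! fst q))"
      using pq unfolding ipts_iff by auto
    have same: "(snd p < snd q \<longleftrightarrow> snd (F p) < snd (F q)) \<and>
        (snd (u ! fst p) ! snd p < snd (u ! fst p) ! snd q \<longleftrightarrow>
         snd (v ! f (fst p)) ! snd (F p) < snd (v ! f (fst p)) ! snd (F q))" if "fst p = fst q"
      using g[OF l(1)] lb that unfolding embeds_def F_def by simp
    have diff: "(kx (map fst u) (fst p) < kx (map fst u) (fst q) \<longleftrightarrow>
          kx (map fst v) (f (fst p)) < kx (map fst v) (f (fst q))) \<and>
        (ky (map fst u) (fst p) < ky (map fst u) (fst q) \<longleftrightarrow>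
          ky (map fst v) (f (fst p)) < ky (map fst v) (f (fst q)))"
      using emb l unfolding embeds_def by simp
    have fF: "fst (F p) = f (fst p)" "fst (F q) = f (fst q)" unfolding F_def by simp_all
    show "(ix u p < ix u q) = (ix v (F p) < ix v (F q))"
      unfolding ix_less[OF pq] ix_less[OF Fin[OF pq(1)] Fin[OF pq(2)]] fF
      using same diff f_inj[OF l] by simp
    show "(iy u p < iy u q) = (iy v (F p) < iy v (F q))"
      unfolding iy_less[OF assms(2) pq] iy_less[OF assms(3) Fin[OF pq(1)] Fin[OF pq(2)]] fF
      using same diff f_inj[OF l] by simp
  qed
  then show ?thesis by (rule shape_embeds_contains[OF shape_infl[OF assms(3)] shape_infl[OF assms(2)]])
qed

text \<open>By \<open>inj\<close>, words and permutations correspond one to one, so an upset of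
  permutations is counted by counting words; monotonicity of \<open>infl\<close> turns the upset
  into a condition on the subword order.\<close>

theorem strongly_rational_inflations:
  assumes U: "strongly_rational_wqo pattern_le length U"
    and Uperm: "\<And>\<alpha>. \<alpha> \<in> U \<Longrightarrow> is_perm \<alpha> \<and> \<alpha> \<noteq> []"
    and S: "finite S" and Can: "regular S Can"
    and C: "\<And>\<pi> \<sigma>. \<pi> \<in> C \<Longrightarrow> is_perm \<sigma> \<Longrightarrow> contains_pattern \<pi> \<sigma> \<Longrightarrow> \<sigma> \<in> C"
    and inj: "inj_on infl {u \<in> lists (S \<times> U). map fst u \<in> Can}"
  shows "strongly_rational_wqo pattern_le length (C \<inter> infl ` {u \<in> lists (S \<times> U). map fst u \<in> Can})"
proof -
  define A where "A = S \<times> U"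
  define L where "L = {u \<in> lists A. map fst u \<in> Can}"
  define T where "T = C \<inter> infl ` L"
  let ?le = "list_emb (letter_le pattern_le) :: ('s \<times> nat list) list \<Rightarrow> _"
  have wU: "wqo_on pattern_le U" using U unfolding strongly_rational_wqo_def by blast
  have wA: "wqo_on (letter_le pattern_le) A" unfolding A_def by (rule wqo_on_letter_le[OF S wU])
  have wL: "wqo_on ?le (lists A)" by (rule higman[OF wA])
  have tr: "?le u w" if "?le u v" "?le v w" for u v w
  proof -
    have "transp ?le" using wL unfolding wqo_on_def by (rule conjunct1)
    then show ?thesis using that by (rule transpD)
  qed
  have refl: "?le u u" if "u \<in> lists A" for u using wqo_on_refl[OF wL that] .
  have pw: "perm_word u" if "u \<in> lists A" for u
    using that Uperm unfolding perm_word_def A_def by (fastforce simp: mem_Times_iff)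
  have LA: "u \<in> lists A" if "u \<in> L" for u using that unfolding L_def by simp
  have Tperm: "is_perm \<pi>" if "\<pi> \<in> T" for \<pi>
    using that is_perm_infl pw LA unfolding T_def by blast
  have fl: "finite_levels length T"
    unfolding finite_levels_def
  proof
    fix n
    have "{a \<in> T. length a = n} \<subseteq> {\<pi>. is_perm \<pi> \<and> length \<pi> = n}" using Tperm by blast
    then show "finite {a \<in> T. length a = n}" by (rule finite_subset) (rule finite_perms)
  qed
  have wqoT: "wqo_on pattern_le T"
    unfolding wqo_on_def
  proof (intro conjI transp_pattern_le allI impI)
    fix f :: "nat \<Rightarrow> nat list" assume "\<forall>i. f i \<in> T"
    then have "\<forall>i. \<exists>u\<in>L. f i = infl u" unfolding T_def by blast
    then obtain u where u: "\<And>i. u i \<in> L" "\<And>i. f i = infl (u i)" by metis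
    obtain i j where "i < j" "?le (u i) (u j)"
      using wqo_onE[OF wL, of u] LA[OF u(1)] by blast
    then show "\<exists>i j. i < j \<and> pattern_le (f i) (f j)"
      using infl_mono pw LA u unfolding pattern_le_def by metis
  qed
  have "rational_fps (gf length V)" if V: "upset_in pattern_le T V" for V
  proof -
    define up where "up Q = {u \<in> lists A. \<exists>u'\<in>L. Q (infl u') \<and> ?le u' u}" for Q
    have up: "upset_in ?le (lists A) (up Q)" for Q unfolding upset_in_def up_def using tr by blast
    \<comment> \<open>Words above something outside \<open>C\<close> are put into \<open>M\<close>
      as well, so that \<open>N\<close> is a subset of \<open>M\<close> and the series may be
      subtracted. A word in \<open>M\<close> but not in \<open>N\<close> whose cells are canonical
      inflates to a member of \<open>C\<close> and lies above a word that inflates into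
      \<open>V\<close>.\<close>
    define M N where "M = up (\<lambda>\<pi>. \<pi> \<in> V \<or> \<pi> \<notin> C)" and "N = up (\<lambda>\<pi>. \<pi> \<notin> C)"
    have rat: "rational_fps (gf (word_size length) {u \<in> up Q. map fst u \<in> Can})" for Q
      using rational_gf_words[OF U _ S Can] Uperm up[of Q] unfolding A_def by blast
    have flL: "finite_levels (word_size length) (lists A)"
      using U Uperm unfolding A_def strongly_rational_wqo_def by (intro finite_levels_words S) auto
    have "{u \<in> L. infl u \<in> V} = {u \<in> M. map fst u \<in> Can} - {u \<in> N. map fst u \<in> Can}"
    proof (intro equalityI subsetI)
      fix u assume "u \<in> {u \<in> L. infl u \<in> V}"
      then have u: "u \<in> L" "infl u \<in> V" by auto
      then have "u \<in> M" using refl[OF LA[OF u(1)]] LA[OF u(1)] unfolding M_def up_def by blast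
      moreover have "u \<notin> N"
      proof
        assume "u \<in> N"
        then obtain u' where u': "u' \<in> L" "infl u' \<notin> C" "?le u' u" unfolding N_def up_def by blast
        have "infl u \<in> C" using u(2) V unfolding upset_in_def T_def by blast
        then show False
          using C[OF _ is_perm_infl infl_mono[OF u'(3)]] u' u(1) pw LA by blast
      qed
      ultimately show "u \<in> {u \<in> M. map fst u \<in> Can} - {u \<in> N. map fst u \<in> Can}"
        using u(1) unfolding L_def by blast
    next
      fix u assume "u \<in> {u \<in> M. map fst u \<in> Can} - {u \<in> N. map fst u \<in> Can}"
      then have u: "u \<in> M" "u \<notin> N" "map fst u \<in> Can" by auto
      have uA: "u \<in> lists A" using u(1) unfolding M_def up_def by blast
      then have uL: "u \<in> L" using u(3) unfolding L_def by blast
      have "infl u \<in> C" using u(2) uA uL refl unfolding N_def up_def by blast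
      then have uT: "infl u \<in> T" using uL unfolding T_def by blast
      obtain u' where u': "u' \<in> L" "infl u' \<in> V \<or> infl u' \<notin> C" "?le u' u"
        using u(1) unfolding M_def up_def by blast
      have "infl u' \<in> V" using u(2) u' uA unfolding N_def up_def by blast
      moreover have "pattern_le (infl u') (infl u)"
        unfolding pattern_le_def using infl_mono[OF u'(3)] u' uL pw LA by blast
      ultimately have "infl u \<in> V" using V uT unfolding upset_in_def by blast
      then show "u \<in> {u \<in> L. infl u \<in> V}" using uL by blast
    qed
    moreover have "gf (word_size length) ({u \<in> M. map fst u \<in> Can} - {u \<in> N. map fst u \<in> Can}) =
        gf (word_size length) {u \<in> M. map fst u \<in> Can} - gf (word_size length) {u \<in> N. map fst u \<in> Can}"
      by (intro gf_Diff finite_levels_subset[OF flL]) (auto simp: M_def N_def up_def)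
    ultimately have "rational_fps (gf (word_size length) {u \<in> L. infl u \<in> V})"
      using rat by (simp add: rational_fps_diff M_def N_def)
    moreover have "gf (word_size length) {u \<in> L. infl u \<in> V} = gf length V"
    proof (rule gf_bij)
      show "bij_betw infl {u \<in> L. infl u \<in> V} V"
      proof (rule bij_betw_imageI)
        show "inj_on infl {u \<in> L. infl u \<in> V}"
          using inj unfolding L_def A_def by (rule inj_on_subset) blast
        show "infl ` {u \<in> L. infl u \<in> V} = V" using V unfolding upset_in_def T_def by blast
      qed
      show "length (infl u) = word_size length u" if "u \<in> {u \<in> L. infl u \<in> V}" for u
        using that length_infl pw LA by blast
    qed
    ultimately show ?thesis by simp
  qed
  then show ?thesis
    using fl wqoT unfolding strongly_rational_wqo_def T_def L_def A_def by blast
qed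

text \<open>The conclusion on \<open>\<tau>\<close> also excludes nontrivial automorphisms: with one
  of them, two different distributions of blocks over the same word could give the same
  permutation.\<close>

definition rigid :: "'s list set \<Rightarrow> bool" where
  "rigid Can \<longleftrightarrow> (\<forall>w\<in>Can. \<forall>w'\<in>Can. \<forall>\<tau>. bij_betw \<tau> {..<length w} {..<length w'} \<and>
     embeds \<tau> {..<length w} (kx w) (ky w) {..<length w'} (kx w') (ky w') \<longrightarrow>
     w = w' \<and> (\<forall>i<length w. \<tau> i = i))"

text \<open>\<open>E\<close> recovers the blocks from the bare point set and is invariant under
  isomorphism. An isomorphism of two inflations thus permutes the blocks and induces an isomorphism
  of the skeletons, which rigidity makes the identity; the blocks then agree one by one.\<close>

lemma infl_inj:
  assumes rig: "rigid Can"
    and iso: "\<And>P x y Q x' y' f p q. bij_betw f P Q \<Longrightarrow> embeds f P x y Q x' y' \<Longrightarrow> p \<in> P \<Longrightarrow> q \<in> P \<Longrightarrow>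
      E P x y p q = E Q x' y' (f p) (f q)"
    and E: "\<And>u p q. u \<in> L \<Longrightarrow> p \<in> ipts u \<Longrightarrow> q \<in> ipts u \<Longrightarrow>
      fst p = fst q \<longleftrightarrow> E (ipts u) (ix u) (iy u) p q"
    and L: "\<And>u. u \<in> L \<Longrightarrow> perm_word u \<and> map fst u \<in> Can"
  shows "inj_on infl L"
proof (rule inj_onI)
  fix u v assume u: "u \<in> L" and v: "v \<in> L" and eq: "infl u = infl v"
  have pu: "perm_word u" "map fst u \<in> Can" and pv: "perm_word v" "map fst v \<in> Can" using L u v by auto
  obtain f where f: "embeds f (ipts u) (ix u) (iy u) (ipts v) (ix v) (iy v)"
    using shape_contains_embeds[OF shape_infl[OF pv(1)] shape_infl[OF pu(1)]] eq by auto
  have "inj_on f (ipts u)" by (rule embeds_inj[OF points_ipts[OF pu(1)] f])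
  moreover have "f ` ipts u = ipts v"
  proof (rule card_subset_eq)
    show "finite (ipts v)" using points_ipts[OF pv(1)] unfolding points_def by blast
    show "f ` ipts u \<subseteq> ipts v" using f unfolding embeds_def by blast
    show "card (f ` ipts u) = card (ipts v)"
      using card_image[OF \<open>inj_on f (ipts u)\<close>] length_infl[OF pu(1)] length_infl[OF pv(1)] eq
      by (simp add: card_ipts)
  qed
  ultimately have bij: "bij_betw f (ipts u) (ipts v)" unfolding bij_betw_def by blast
  have fin: "f p \<in> ipts v" if "p \<in> ipts u" for p using bij that unfolding bij_betw_def by blast
  have blocks: "fst p = fst q \<longleftrightarrow> fst (f p) = fst (f q)" if "p \<in> ipts u" "q \<in> ipts u" for p q
    using E[OF u that] E[OF v fin[OF that(1)] fin[OF that(2)]] iso[OF bij f that] by simp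
  \<comment> \<open>Blocks are nonempty, so the point with index 0 can represent its block.\<close>
  define \<tau> where "\<tau> i = fst (f (i, 0))" for i
  have base: "(i, 0) \<in> ipts u" if "i < length u" for i
    using perm_word_nth(2)[OF pu(1) that] that unfolding ipts_iff by simp
  have basev: "(i, 0) \<in> ipts v" if "i < length v" for i
    using perm_word_nth(2)[OF pv(1) that] that unfolding ipts_iff by simp
  have \<tau>: "fst (f p) = \<tau> (fst p)" if "p \<in> ipts u" for p
    using blocks[OF that base[of "fst p"]] that unfolding \<tau>_def ipts_iff by simp
  have \<tau>_inj: "inj_on \<tau> {..<length u}"
    using blocks[OF base base] unfolding \<tau>_def inj_on_def by auto
  have "\<tau> ` {..<length u} = {..<length v}"
  proof (intro equalityI subsetI)
    fix k assume "k \<in> \<tau> ` {..<length u}"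
    then show "k \<in> {..<length v}" using fin[OF base] unfolding \<tau>_def ipts_iff by auto
  next
    fix k assume "k \<in> {..<length v}"
    then have "(k, 0) \<in> f ` ipts u" using basev bij unfolding bij_betw_def by simp
    then obtain p where p: "p \<in> ipts u" "f p = (k, 0)" by (metis imageE)
    then have "k = \<tau> (fst p)" using \<tau>[OF p(1)] by simp
    then show "k \<in> \<tau> ` {..<length u}" using p(1) unfolding ipts_iff by simp
  qed
  then have \<tau>_bij: "bij_betw \<tau> {..<length (map fst u)} {..<length (map fst v)}"
    using \<tau>_inj unfolding bij_betw_def by simp
  have "embeds \<tau> {..<length (map fst u)} (kx (map fst u)) (ky (map fst u))
      {..<length (map fst v)} (kx (map fst v)) (ky (map fst v))"
    unfolding embeds_def
  proof (intro conjI ballI)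
    show "\<tau> ` {..<length (map fst u)} \<subseteq> {..<length (map fst v)}"
      using \<tau>_bij unfolding bij_betw_def by simp
    fix i j assume ij: "i \<in> {..<length (map fst u)}" "j \<in> {..<length (map fst u)}"
    then have b: "(i, 0) \<in> ipts u" "(j, 0) \<in> ipts u" using base by auto
    have ne: "\<tau> i = \<tau> j \<longleftrightarrow> i = j" using blocks[OF b] unfolding \<tau>_def by simp
    have "ix u (i, 0) < ix u (j, 0) \<longleftrightarrow> ix v (f (i, 0)) < ix v (f (j, 0))"
      "iy u (i, 0) < iy u (j, 0) \<longleftrightarrow> iy v (f (i, 0)) < iy v (f (j, 0))"
      using f b unfolding embeds_def by blast+
    then show "(kx (map fst u) i < kx (map fst u) j) = (kx (map fst v) (\<tau> i) < kx (map fst v) (\<tau> j))"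
      "(ky (map fst u) i < ky (map fst u) j) = (ky (map fst v) (\<tau> i) < ky (map fst v) (\<tau> j))"
      unfolding ix_less[OF b] iy_less[OF pu(1) b] ix_less[OF fin[OF b(1)] fin[OF b(2)]]
        iy_less[OF pv(1) fin[OF b(1)] fin[OF b(2)]] \<tau>_def[symmetric]
      using ne by (auto split: if_splits)
  qed
  then have "map fst u = map fst v \<and> (\<forall>i<length (map fst u). \<tau> i = i)"
    using rig[unfolded rigid_def, rule_format, OF pu(2) pv(2), of \<tau>] \<tau>_bij by blast
  then have w: "map fst u = map fst v" and id: "\<And>i. i < length u \<Longrightarrow> \<tau> i = i" by simp_all
  have len: "length u = length v" using w by (metis length_map)
  show "u = v"
  proof (rule nth_equalityI[OF len])
    fix i assume i: "i < length u"
    have "fst (u ! i) = fst (v ! i)" using w i len by (metis nth_map)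
    moreover have "snd (u ! i) = snd (v ! i)"
    proof -
      define B B' where "B = {p \<in> ipts u. fst p = i}" and "B' = {p \<in> ipts v. fst p = i}"
      have fB: "fst (f p) = fst p" if "p \<in> ipts u" for p
        using \<tau>[OF that] id that unfolding ipts_iff by simp
      have bB: "bij_betw f B B'"
        unfolding bij_betw_def
      proof
        show "inj_on f B" using bij unfolding bij_betw_def B_def by (auto intro: inj_on_subset)
        show "f ` B = B'"
        proof (intro equalityI subsetI)
          fix q assume q: "q \<in> B'"
          then have "q \<in> f ` ipts u" using bij by (simp add: bij_betw_def B'_def)
          then obtain p where p: "p \<in> ipts u" "f p = q" by blast
          then have "p \<in> B" using q fB[OF p(1)] unfolding B_def B'_def by simp
          then show "q \<in> f ` B" using p(2) by blast
        qed (use fin fB in \<open>auto simp: B_def B'_def\<close>)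
      qed
      have sB: "shape (snd (u ! i)) B (ix u) (iy u)"
      proof -
        have "bij_betw (Pair i) {..<length (snd (u ! i))} B"
          unfolding bij_betw_def B_def using i by (auto simp: ipts_iff inj_on_def image_iff)
        moreover have "embeds (Pair i) {..<length (snd (u ! i))} (\<lambda>i. i) (nth (snd (u ! i))) B (ix u) (iy u)"
          unfolding embeds_def B_def using i by (auto simp: ipts_iff ix_less iy_less[OF pu(1)])
        ultimately show ?thesis unfolding shape_def using perm_word_nth(1)[OF pu(1) i] by blast
      qed
      have iv: "i < length v" using i len by simp
      have sB': "shape (snd (v ! i)) B' (ix v) (iy v)"
      proof -
        have "bij_betw (Pair i) {..<length (snd (v ! i))} B'"
          unfolding bij_betw_def B'_def using iv by (auto simp: ipts_iff inj_on_def image_iff)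
        moreover have "embeds (Pair i) {..<length (snd (v ! i))} (\<lambda>i. i) (nth (snd (v ! i))) B' (ix v) (iy v)"
          unfolding embeds_def B'_def using iv by (auto simp: ipts_iff ix_less iy_less[OF pv(1)])
        ultimately show ?thesis unfolding shape_def using perm_word_nth(1)[OF pv(1) iv] by blast
      qed
      have "embeds f B (ix u) (iy u) B' (ix v) (iy v)"
        using f bB unfolding embeds_def bij_betw_def B_def by blast
      then show ?thesis using shape_unique[OF sB' sB] bij_betw_same_card[OF bB] by simp
    qed
    ultimately show "u ! i = v ! i" by (simp add: prod_eq_iff)
  qed
qed

text \<open>Surjectivity, to go with \<open>infl_inj\<close>: the fibres of \<open>b\<close> become
  the blocks, and \<open>ord\<close> says that points of distinct blocks compare like the letters of
  \<open>w\<close>.\<close>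

lemma ex_inflation:
  assumes P: "points P x y" and sh: "shape \<pi> P x y"
    and b: "b ` P = {..<length w}"
    and ord: "\<And>p q. p \<in> P \<Longrightarrow> q \<in> P \<Longrightarrow> b p \<noteq> b q \<Longrightarrow>
      (x p < x q \<longleftrightarrow> kx w (b p) < kx w (b q)) \<and> (y p < y q \<longleftrightarrow> ky w (b p) < ky w (b q))"
    and U: "\<And>i \<alpha>. i < length w \<Longrightarrow> shape \<alpha> {p \<in> P. b p = i} x y \<Longrightarrow> \<alpha> \<in> U"
    and w: "w \<in> lists S"
  shows "\<exists>u\<in>lists (S \<times> U). map fst u = w \<and> \<pi> = infl u"
proof -
  have "\<forall>i. \<exists>\<alpha>. shape \<alpha> {p \<in> P. b p = i} x y"
  proof
    fix i
    have "{p \<in> P. b p = i} \<subseteq> P" by blast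
    then show "\<exists>\<alpha>. shape \<alpha> {p \<in> P. b p = i} x y" by (rule ex_shape[OF points_subset[OF P]])
  qed
  then obtain \<alpha> where \<alpha>: "\<And>i. shape (\<alpha> i) {p \<in> P. b p = i} x y" by metis
  then have "\<forall>i. \<exists>g. bij_betw g {..<length (\<alpha> i)} {p \<in> P. b p = i} \<and>
      embeds g {..<length (\<alpha> i)} (\<lambda>i. i) (nth (\<alpha> i)) {p \<in> P. b p = i} x y"
    unfolding shape_def by blast
  then have "\<exists>g. \<forall>i. bij_betw (g i) {..<length (\<alpha> i)} {p \<in> P. b p = i} \<and>
      embeds (g i) {..<length (\<alpha> i)} (\<lambda>i. i) (nth (\<alpha> i)) {p \<in> P. b p = i} x y"
    by (rule choice)
  then obtain g where g: "\<And>i. bij_betw (g i) {..<length (\<alpha> i)} {p \<in> P. b p = i}"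
      "\<And>i. embeds (g i) {..<length (\<alpha> i)} (\<lambda>i. i) (nth (\<alpha> i)) {p \<in> P. b p = i} x y" by blast
  define u where "u = map (\<lambda>i. (w ! i, \<alpha> i)) [0..<length w]"
  have lu: "length u = length w" and ui: "\<And>i. i < length w \<Longrightarrow> u ! i = (w ! i, \<alpha> i)"
    unfolding u_def by simp_all
  have mf: "map fst u = w" by (rule nth_equalityI) (simp_all add: lu ui)
  have wS: "w ! i \<in> S" if "i < length w" for i using w that by (auto dest: nth_mem)
  have uA: "u \<in> lists (S \<times> U)"
    using U[OF _ \<alpha>] wS unfolding u_def by auto
  have pw: "perm_word u"
    unfolding perm_word_def
  proof
    fix a assume "a \<in> set u"
    then obtain i where i: "i < length w" "a = (w ! i, \<alpha> i)" unfolding u_def by auto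
    have "i \<in> b ` P" using b i(1) by simp
    then have "card {p \<in> P. b p = i} \<noteq> 0" using P unfolding points_def by auto
    then have "\<alpha> i \<noteq> []" using shape_length[OF \<alpha>[of i]] by auto
    then show "is_perm (snd a) \<and> snd a \<noteq> []" using \<alpha>[of i] i(2) unfolding shape_def by simp
  qed
  define F where "F p = g (fst p) (snd p)" for p
  have FB: "F p \<in> P" "b (F p) = fst p" if "p \<in> ipts u" for p
    using that g(1)[of "fst p"] lu ui unfolding ipts_iff F_def bij_betw_def by auto
  have emb: "embeds F (ipts u) (ix u) (iy u) P x y"
    unfolding embeds_def
  proof (intro conjI ballI)
    show "F ` ipts u \<subseteq> P" using FB by blast
    fix p q assume pq: "p \<in> ipts u" "q \<in> ipts u"
    then have l: "fst p < length w" "fst q < length w" "snd p < length (\<alpha> (fst p))" "snd q < length (\<alpha> (fst q))"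
      unfolding ipts_iff using lu ui by auto
    have same: "(x (F p) < x (F q) \<longleftrightarrow> snd p < snd q) \<and>
        (y (F p) < y (F q) \<longleftrightarrow> \<alpha> (fst p) ! snd p < \<alpha> (fst p) ! snd q)" if "fst p = fst q"
      using g(2)[of "fst p"] l that unfolding embeds_def F_def by simp
    have diff: "(x (F p) < x (F q) \<longleftrightarrow> kx w (fst p) < kx w (fst q)) \<and>
        (y (F p) < y (F q) \<longleftrightarrow> ky w (fst p) < ky w (fst q))" if "fst p \<noteq> fst q"
      using ord[OF FB(1)[OF pq(1)] FB(1)[OF pq(2)]] FB(2)[OF pq(1)] FB(2)[OF pq(2)] that by simp
    show "(ix u p < ix u q) = (x (F p) < x (F q))"
      unfolding ix_less[OF pq] mf using same diff by simp
    show "(iy u p < iy u q) = (y (F p) < y (F q))"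
      unfolding iy_less[OF pw pq] mf using same diff ui l by simp
  qed
  have "card P = card (ipts u)"
  proof -
    have "inj_on F (ipts u)" by (rule embeds_inj[OF points_ipts[OF pw] emb])
    moreover have "F ` ipts u = P"
    proof (intro equalityI subsetI)
      fix p assume p: "p \<in> P"
      then have "b p < length w" using b by blast
      moreover have "p \<in> g (b p) ` {..<length (\<alpha> (b p))}" using g(1)[of "b p"] p unfolding bij_betw_def by blast
      then obtain j where "j < length (\<alpha> (b p))" "p = g (b p) j" by blast
      ultimately have "(b p, j) \<in> ipts u" "F (b p, j) = p" unfolding ipts_iff F_def using lu ui by auto
      then show "p \<in> F ` ipts u" by (metis imageI)
    qed (use FB in blast)
    ultimately show ?thesis using card_image by metis
  qed
  then have "\<pi> = infl u" by (rule shape_unique[OF sh shape_infl[OF pw] emb])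
  then show ?thesis using uA mf by blast
qed

end

section \<open>Inversion graphs without induced paths on five vertices\<close>

text \<open>The flag selects the increasing relation, which belongs to direct sums, or the
  decreasing one, which belongs to skew sums; both decompositions are then treated at once.\<close>

definition before :: "bool \<Rightarrow> ('a \<Rightarrow> nat) \<Rightarrow> ('a \<Rightarrow> nat) \<Rightarrow> 'a \<Rightarrow> 'a \<Rightarrow> bool" where
  "before r x y p q \<longleftrightarrow> x p < x q \<and> (if r then y p < y q else y q < y p)"

definition cut :: "bool \<Rightarrow> 'a set \<Rightarrow> ('a \<Rightarrow> nat) \<Rightarrow> ('a \<Rightarrow> nat) \<Rightarrow> 'a set \<Rightarrow> bool" where
  "cut r P x y D \<longleftrightarrow> D \<subseteq> P \<and> (\<forall>p\<in>D. \<forall>q\<in>P - D. before r x y p q)"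

text \<open>The summands of the finest direct or skew sum, obtained as the classes of points that no
  cut separates.\<close>

definition component :: "bool \<Rightarrow> 'a set \<Rightarrow> ('a \<Rightarrow> nat) \<Rightarrow> ('a \<Rightarrow> nat) \<Rightarrow> 'a \<Rightarrow> 'a set" where
  "component r P x y p = {q \<in> P. \<forall>D. cut r P x y D \<longrightarrow> (p \<in> D \<longleftrightarrow> q \<in> D)}"

lemma before_trans: "before r x y p q \<Longrightarrow> before r x y q s \<Longrightarrow> before r x y p s"
  unfolding before_def by (auto split: if_splits)

lemma component_subset: "component r P x y p \<subseteq> P"
  unfolding component_def by blast

lemma component_self: "p \<in> P \<Longrightarrow> p \<in> component r P x y p"
  unfolding component_def by blast

lemma component_eq: "q \<in> component r P x y p \<Longrightarrow> component r P x y q = component r P x y p"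
  unfolding component_def by blast

lemma component_before:
  assumes "p \<in> P" "q \<in> P" "q \<notin> component r P x y p"
  shows "(\<forall>p'\<in>component r P x y p. \<forall>q'\<in>component r P x y q. before r x y p' q') \<or>
    (\<forall>p'\<in>component r P x y p. \<forall>q'\<in>component r P x y q. before r x y q' p')"
proof -
  obtain D where D: "cut r P x y D" "p \<in> D \<longleftrightarrow> q \<notin> D"
    using assms unfolding component_def by blast
  then have "p' \<in> D \<longleftrightarrow> p \<in> D" if "p' \<in> component r P x y p" for p'
    using that unfolding component_def by blast
  moreover have "q' \<in> D \<longleftrightarrow> q \<in> D" if "q' \<in> component r P x y q" for q'
    using that D unfolding component_def by blast
  ultimately show ?thesis
    using D component_subset[of r P x y p] component_subset[of r P x y q] unfolding cut_def by blast
qed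

text \<open>A cut inside a component becomes a cut of \<open>P\<close> once the points before the
  component are added, and that would separate points of one class.\<close>

lemma component_no_cut:
  assumes D: "cut r (component r P x y p) x y D" and p: "p \<in> P"
  shows "D = {} \<or> D = component r P x y p"
proof (rule ccontr)
  define J where "J = component r P x y p"
  assume "\<not> ?thesis"
  then obtain a b where ab: "a \<in> D" "b \<in> J" "b \<notin> D" using D unfolding cut_def J_def by blast
  have DJ: "D \<subseteq> J" using D unfolding cut_def J_def by blast
  have J: "J \<subseteq> P" unfolding J_def by (rule component_subset)
  have out: "(\<forall>j\<in>J. before r x y e j) \<or> (\<forall>j\<in>J. before r x y j e)" if "e \<in> P" "e \<notin> J" for e
    using component_before[OF p that(1) that(2)[unfolded J_def]] component_self[OF that(1), of r x y]
    unfolding J_def by blast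
  define E where "E = D \<union> {e \<in> P - J. \<forall>j\<in>J. before r x y e j}"
  have "cut r P x y E"
    unfolding cut_def
  proof (intro conjI ballI)
    show "E \<subseteq> P" using DJ J unfolding E_def by blast
    fix u v assume u: "u \<in> E" and v: "v \<in> P - E"
    show "before r x y u v"
    proof (cases "v \<in> J")
      case True
      then show ?thesis using u v D unfolding E_def cut_def J_def by blast
    next
      case False
      then have "\<forall>j\<in>J. before r x y j v" using out[of v] v unfolding E_def by blast
      then show ?thesis using u DJ ab(2) before_trans[of r x y u b v] unfolding E_def by blast
    qed
  qed
  then have "a \<in> E \<longleftrightarrow> b \<in> E" using ab DJ unfolding J_def component_def by blast
  then show False using ab DJ unfolding E_def by blast
qed

text \<open>Exchanging the coordinates preserves direct sums, so results on splitting by horizontal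
  lines carry over to vertical ones.\<close>

lemma before_True_swap: "before True x y p q = before True y x p q"
  unfolding before_def by auto

lemma cut_True_swap: "cut True P x y D = cut True P y x D"
  unfolding cut_def before_True_swap[of x y] ..

lemma component_True_swap: "component True P x y p = component True P y x p"
  unfolding component_def cut_True_swap[of P x y] ..

section \<open>The inversion graph: induced paths, cliques and intervals\<close>

definition adj :: "('a \<Rightarrow> nat) \<Rightarrow> ('a \<Rightarrow> nat) \<Rightarrow> 'a \<Rightarrow> 'a \<Rightarrow> bool" where
  "adj x y p q \<longleftrightarrow> before False x y p q \<or> before False x y q p"

lemma adj_iff: "adj x y p q \<longleftrightarrow> (x p < x q \<and> y q < y p) \<or> (x q < x p \<and> y p < y q)"
  unfolding adj_def before_def by simp

lemma adj_sym: "adj x y p q \<longleftrightarrow> adj x y q p"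
  unfolding adj_def by blast

lemma adj_swap: "adj x y p q \<longleftrightarrow> adj y x p q"
  unfolding adj_iff by blast

definition P5_free :: "'a set \<Rightarrow> ('a \<Rightarrow> nat) \<Rightarrow> ('a \<Rightarrow> nat) \<Rightarrow> bool" where
  "P5_free P x y \<longleftrightarrow> (\<forall>a\<in>P. \<forall>b\<in>P. \<forall>c\<in>P. \<forall>d\<in>P. \<forall>e\<in>P.
     \<not> (adj x y a b \<and> adj x y b c \<and> adj x y c d \<and> adj x y d e \<and> \<not> adj x y a c \<and> \<not> adj x y a d \<and>
        \<not> adj x y a e \<and> \<not> adj x y b d \<and> \<not> adj x y b e \<and> \<not> adj x y c e))"

lemma P5_freeD:
  assumes "P5_free P x y" "a \<in> P" "b \<in> P" "c \<in> P" "d \<in> P" "e \<in> P"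
    "adj x y a b" "adj x y b c" "adj x y c d" "adj x y d e" "\<not> adj x y a c" "\<not> adj x y a d"
    "\<not> adj x y a e" "\<not> adj x y b d" "\<not> adj x y b e" "\<not> adj x y c e"
  shows False
  using assms unfolding P5_free_def by blast

lemma P5_free_swap: "P5_free P x y \<longleftrightarrow> P5_free P y x"
  unfolding P5_free_def adj_swap[of x y] ..

definition clique :: "('a \<Rightarrow> nat) \<Rightarrow> ('a \<Rightarrow> nat) \<Rightarrow> 'a set \<Rightarrow> bool" where
  "clique x y A \<longleftrightarrow> (\<forall>p\<in>A. \<forall>q\<in>A. p \<noteq> q \<longrightarrow> adj x y p q)"

lemma clique_swap: "clique x y A \<longleftrightarrow> clique y x A"
  unfolding clique_def adj_swap[of x y] ..

definition cliques_le :: "nat \<Rightarrow> 'a set \<Rightarrow> ('a \<Rightarrow> nat) \<Rightarrow> ('a \<Rightarrow> nat) \<Rightarrow> bool" where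
  "cliques_le k P x y \<longleftrightarrow> (\<forall>A\<subseteq>P. clique x y A \<longrightarrow> card A \<le> k)"

definition interval :: "'a set \<Rightarrow> ('a \<Rightarrow> nat) \<Rightarrow> ('a \<Rightarrow> nat) \<Rightarrow> 'a set \<Rightarrow> bool" where
  "interval P x y I \<longleftrightarrow> I \<subseteq> P \<and> (\<forall>e\<in>P - I.
     ((\<forall>p\<in>I. x e < x p) \<or> (\<forall>p\<in>I. x p < x e)) \<and> ((\<forall>p\<in>I. y e < y p) \<or> (\<forall>p\<in>I. y p < y e)))"

definition simple :: "'a set \<Rightarrow> ('a \<Rightarrow> nat) \<Rightarrow> ('a \<Rightarrow> nat) \<Rightarrow> bool" where
  "simple P x y \<longleftrightarrow> (\<forall>I. interval P x y I \<longrightarrow> card I \<le> 1 \<or> I = P)"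

lemma points_swap: "points P x y \<longleftrightarrow> points P y x"
  unfolding points_def by blast

lemma points_neq:
  assumes "points P x y" "p \<in> P" "q \<in> P" "p \<noteq> q"
  shows "x p \<noteq> x q" "y p \<noteq> y q"
  using assms unfolding points_def inj_on_def by blast+

text \<open>The part of the component below the horizontal line through \<open>b\<close> is not a
  cut, so some inversion of the component straddles that line.\<close>

lemma component_crossing:
  assumes "points P x y" "R \<subseteq> P" "p \<in> R" "J = component True R x y p" "b \<in> P" "b \<notin> J"
    and "u \<in> J" "v \<in> J" "y u < y b" "y b < y v"
  obtains k k' where "k \<in> J" "k' \<in> J" "x k' < x k" "y k < y b" "y b < y k'"
proof -
  define D where "D = {j \<in> J. y j < y b}"
  have "\<not> cut True J x y D"
  proof
    assume "cut True J x y D"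
    then have "D = {} \<or> D = J" using component_no_cut[OF _ assms(3)] unfolding assms(4) by blast
    moreover have "u \<in> D" "v \<notin> D" using assms(7-10) unfolding D_def by auto
    ultimately show False using assms(8) by blast
  qed
  then obtain k k' where k: "k \<in> D" "k' \<in> J - D" "\<not> before True x y k k'"
    unfolding cut_def D_def by blast
  have JP: "J \<subseteq> P" using component_subset assms(2) unfolding assms(4) by (rule order_trans)
  have "y k' \<noteq> y b" using points_neq(2)[OF assms(1) _ assms(5), of k'] k(2) JP assms(6) by blast
  then have y: "y k < y b" "y b < y k'" using k(1,2) unfolding D_def by auto
  moreover have "x k' \<noteq> x k" using points_neq(1)[OF assms(1), of k' k] k(1,2) JP y unfolding D_def by force
  then have "x k' < x k" using k(3) y unfolding before_def by auto
  ultimately show thesis using that k(1,2) unfolding D_def by blast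
qed

section \<open>Sum components of a box that are split from outside\<close>

definition splits :: "('a \<Rightarrow> nat) \<Rightarrow> 'a set \<Rightarrow> 'a \<Rightarrow> bool" where
  "splits y J e \<longleftrightarrow> (\<exists>u\<in>J. \<exists>v\<in>J. y u < y e \<and> y e < y v)"

text \<open>If \<open>e\<close> and \<open>e'\<close> were not inverted, an inversion
  \<open>k\<close>, \<open>k'\<close> of one component across the line through its splitting point
  would begin an induced path on five vertices: \<open>k k' e v' e'\<close> when both lie to the
  right, \<open>k' k e' u e\<close> when both lie to the left.\<close>

lemma splitters_adj:
  assumes P: "points P x y" and free: "P5_free P x y" and R: "R \<subseteq> P"
    and J: "p \<in> R" "J = component True R x y p" and J': "p' \<in> R" "J' = component True R x y p'"
    and e: "e \<in> P" "e \<notin> J" "splits y J e" and e': "e' \<in> P" "e' \<notin> J'" "splits y J' e'"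
    and ord: "\<And>j j'. j \<in> J \<Longrightarrow> j' \<in> J' \<Longrightarrow> before True x y j j'"
    and side: "(\<forall>q\<in>R. x q < x e \<and> x q < x e') \<or> (\<forall>q\<in>R. x e < x q \<and> x e' < x q)"
  shows "adj x y e e'"
proof (rule ccontr)
  assume na: "\<not> adj x y e e'"
  obtain u v where uv: "u \<in> J" "v \<in> J" "y u < y e" "y e < y v" using e(3) unfolding splits_def by blast
  obtain u' v' where uv': "u' \<in> J'" "v' \<in> J'" "y u' < y e'" "y e' < y v'" using e'(3) unfolding splits_def by blast
  have sub: "J \<subseteq> R" "J' \<subseteq> R" unfolding J(2) J'(2) by (rule component_subset)+
  have vu': "before True x y v u'" using ord uv uv' by blast
  have ee': "y e < y e'" using vu' uv uv' unfolding before_def by simp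
  from side show False
  proof
    assume s: "\<forall>q\<in>R. x q < x e \<and> x q < x e'"
    obtain k k' where k: "k \<in> J" "k' \<in> J" "x k' < x k" "y k < y e" "y e < y k'"
      by (rule component_crossing[OF P R J e(1,2) uv])
    have b: "before True x y k v'" "before True x y k' v'" "before True x y k' u'" "before True x y k u'"
      using ord k uv' by blast+
    have xs: "x k < x e" "x k < x e'" "x k' < x e" "x k' < x e'" "x v' < x e" "x v' < x e'"
      using s k sub uv' by blast+
    show False
      by (rule P5_freeD[OF free, of k k' e v' e'])
        (use k uv' sub R e(1) e'(1) na b xs ee' in \<open>auto simp: adj_iff before_def\<close>)
  next
    assume s: "\<forall>q\<in>R. x e < x q \<and> x e' < x q"
    obtain k k' where k: "k \<in> J'" "k' \<in> J'" "x k' < x k" "y k < y e'" "y e' < y k'"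
      by (rule component_crossing[OF P R J' e'(1,2) uv'])
    have b: "before True x y u k" "before True x y u k'" "before True x y v k" "before True x y v k'"
      using ord k uv by blast+
    have xs: "x e < x k" "x e' < x k" "x e < x k'" "x e' < x k'" "x e < x u" "x e' < x u"
      using s k sub uv by blast+
    show False
      by (rule P5_freeD[OF free, of k' k e' u e])
        (use k uv sub R e(1) e'(1) na b xs ee' in \<open>auto simp: adj_iff before_def\<close>)
  qed
qed

text \<open>Splitting points on one side, one for each component, are pairwise inverted and
  therefore form a clique.\<close>

lemma card_split_components:
  assumes P: "points P x y" and free: "P5_free P x y" and cl: "cliques_le l P x y" and R: "R \<subseteq> P"
    and comp: "\<And>J. J \<in> \<J> \<Longrightarrow> \<exists>p\<in>R. J = component True R x y p"
    and spl: "\<And>J. J \<in> \<J> \<Longrightarrow> \<exists>e\<in>P. splits y J e \<and> Q e"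
    and side: "(\<forall>e. Q e \<longrightarrow> (\<forall>q\<in>R. x q < x e)) \<or> (\<forall>e. Q e \<longrightarrow> (\<forall>q\<in>R. x e < x q))"
  shows "finite \<J> \<and> card \<J> \<le> l"
proof -
  have finP: "finite P" using P unfolding points_def by blast
  obtain \<epsilon> where \<epsilon>: "\<And>J. J \<in> \<J> \<Longrightarrow> \<epsilon> J \<in> P \<and> splits y J (\<epsilon> J) \<and> Q (\<epsilon> J)" using spl by metis
  have notin: "\<epsilon> J \<notin> R" if "J \<in> \<J>" for J
    using side \<epsilon>[OF that] by blast
  have adj: "adj x y (\<epsilon> J) (\<epsilon> J')" if JJ: "J \<in> \<J>" "J' \<in> \<J>" "J \<noteq> J'" for J J'
  proof -
    obtain p p' where p: "p \<in> R" "J = component True R x y p" and p': "p' \<in> R" "J' = component True R x y p'"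
      using comp JJ by meson
    have sub: "J \<subseteq> R" "J' \<subseteq> R" unfolding p(2) p'(2) by (rule component_subset)+
    have ne: "\<epsilon> J \<notin> J" "\<epsilon> J' \<notin> J'" using notin JJ sub by blast+
    have p'J: "p' \<notin> J" using component_eq[of p' True R x y p] p p' JJ(3) by blast
    then consider "\<forall>j\<in>J. \<forall>j'\<in>J'. before True x y j j'" | "\<forall>j\<in>J. \<forall>j'\<in>J'. before True x y j' j"
      using component_before[OF p(1) p'(1) p'J[unfolded p(2)]] unfolding p(2) p'(2) by blast
    then show ?thesis
    proof cases
      case 1
      show ?thesis
        by (rule splitters_adj[OF P free R p p' _ ne(1) _ _ ne(2)]) (use 1 \<epsilon> JJ side in blast)+
    next
      case 2
      have "adj x y (\<epsilon> J') (\<epsilon> J)"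
        by (rule splitters_adj[OF P free R p' p _ ne(2) _ _ ne(1)]) (use 2 \<epsilon> JJ side in blast)+
      then show ?thesis using adj_sym by metis
    qed
  qed
  have inj: "inj_on \<epsilon> \<J>"
  proof (rule inj_onI, rule ccontr)
    fix J J' assume "J \<in> \<J>" "J' \<in> \<J>" "\<epsilon> J = \<epsilon> J'" "J \<noteq> J'"
    then show False using adj[of J J'] unfolding adj_iff by simp
  qed
  have sub: "\<epsilon> ` \<J> \<subseteq> P" using \<epsilon> by blast
  moreover have "clique x y (\<epsilon> ` \<J>)" unfolding clique_def using adj by blast
  ultimately have "card (\<epsilon> ` \<J>) \<le> l" using cl unfolding cliques_le_def by blast
  then show ?thesis using card_image[OF inj] finite_imageD[OF finite_subset[OF sub finP] inj] by simp
qed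

text \<open>What the argument uses of an axis-parallel rectangle: an outside point whose horizontal
  line cuts the box is to its left or right, and one whose vertical line cuts it is above or
  below.\<close>

definition boxlike :: "'a set \<Rightarrow> ('a \<Rightarrow> nat) \<Rightarrow> ('a \<Rightarrow> nat) \<Rightarrow> 'a set \<Rightarrow> bool" where
  "boxlike P x y R \<longleftrightarrow> R \<subseteq> P \<and> (\<forall>e\<in>P - R.
     (splits y R e \<longrightarrow> (\<forall>q\<in>R. x q < x e) \<or> (\<forall>q\<in>R. x e < x q)) \<and>
     (splits x R e \<longrightarrow> (\<forall>q\<in>R. y q < y e) \<or> (\<forall>q\<in>R. y e < y q)))"

lemma splits_mono: "splits y J e \<Longrightarrow> J \<subseteq> R \<Longrightarrow> splits y R e"
  unfolding splits_def by blast

text \<open>A component with at least two points that is not all of \<open>P\<close> is no interval,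
  so some point splits it. That point is outside \<open>R\<close>, since the other components lie
  entirely before or after, hence on one of four sides with at most \<open>l\<close> split
  components each; the extra 1 stands for \<open>P\<close> itself.\<close>

lemma card_nontrivial_components:
  assumes P: "points P x y" and free: "P5_free P x y" and cl: "cliques_le l P x y"
    and simple: "simple P x y" and R: "boxlike P x y R"
    and \<J>: "\<J> = {J. \<exists>p\<in>R. J = component True R x y p \<and> 2 \<le> card J}"
  shows "finite \<J> \<and> card \<J> \<le> 4 * l + 1"
proof -
  define Spl where "Spl f Q = {J \<in> \<J>. \<exists>e\<in>P. splits f J e \<and> Q e}" for f :: "'a \<Rightarrow> nat" and Q
  define A B C D where "A = Spl y (\<lambda>e. \<forall>q\<in>R. x q < x e)" and "B = Spl y (\<lambda>e. \<forall>q\<in>R. x e < x q)"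
    and "C = Spl x (\<lambda>e. \<forall>q\<in>R. y q < y e)" and "D = Spl x (\<lambda>e. \<forall>q\<in>R. y e < y q)"
  have RP: "R \<subseteq> P" using R unfolding boxlike_def by blast
  have A: "finite A \<and> card A \<le> l"
    unfolding A_def
    by (rule card_split_components[OF P free cl RP, where Q = "\<lambda>e. \<forall>q\<in>R. x q < x e"])
      (auto simp: Spl_def \<J>)
  have B: "finite B \<and> card B \<le> l"
    unfolding B_def
    by (rule card_split_components[OF P free cl RP, where Q = "\<lambda>e. \<forall>q\<in>R. x e < x q"])
      (auto simp: Spl_def \<J>)
  have P': "points P y x" and free': "P5_free P y x" and cl': "cliques_le l P y x"
    using P free cl points_swap P5_free_swap clique_swap unfolding cliques_le_def by metis+
  have C: "finite C \<and> card C \<le> l"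
    unfolding C_def
    by (rule card_split_components[OF P' free' cl' RP, where Q = "\<lambda>e. \<forall>q\<in>R. y q < y e"])
      (auto simp: Spl_def \<J> component_True_swap[of R y x])
  have D: "finite D \<and> card D \<le> l"
    unfolding D_def
    by (rule card_split_components[OF P' free' cl' RP, where Q = "\<lambda>e. \<forall>q\<in>R. y e < y q"])
      (auto simp: Spl_def \<J> component_True_swap[of R y x])
  have "J \<in> A \<union> B \<union> C \<union> D \<union> {P}" if J: "J \<in> \<J>" for J
  proof (rule ccontr)
    assume nJ: "J \<notin> A \<union> B \<union> C \<union> D \<union> {P}"
    obtain p where p: "p \<in> R" "J = component True R x y p" "2 \<le> card J" using J unfolding \<J> by blast
    have JR: "J \<subseteq> R" unfolding p(2) by (rule component_subset)
    have "\<not> interval P x y J" using simple p(3) nJ unfolding simple_def by fastforce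
    then obtain e where e: "e \<in> P" "e \<notin> J"
      "\<not> ((\<forall>p\<in>J. x e < x p) \<or> (\<forall>p\<in>J. x p < x e)) \<or> \<not> ((\<forall>p\<in>J. y e < y p) \<or> (\<forall>p\<in>J. y p < y e))"
      using JR RP unfolding interval_def by blast
    have ne: "x j \<noteq> x e" "y j \<noteq> y e" if "j \<in> J" for j
      using points_neq[OF P, of j e] e that JR RP by blast+
    have spl: "splits x J e \<or> splits y J e"
      using e(3) ne unfolding splits_def by (meson linorder_neqE_nat)
    have "e \<notin> R"
    proof
      assume "e \<in> R"
      then have "(\<forall>j\<in>J. before True x y j e) \<or> (\<forall>j\<in>J. before True x y e j)"
        using component_before[OF p(1) _ e(2)[unfolded p(2)]] component_self[of e R True x y]
        unfolding p(2) by blast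
      then show False using spl unfolding splits_def before_def by force
    qed
    then have "(splits y J e \<longrightarrow> (\<forall>q\<in>R. x q < x e) \<or> (\<forall>q\<in>R. x e < x q)) \<and>
      (splits x J e \<longrightarrow> (\<forall>q\<in>R. y q < y e) \<or> (\<forall>q\<in>R. y e < y q))"
      using R e(1) splits_mono[OF _ JR] unfolding boxlike_def by blast
    then show False using nJ spl e(1) J unfolding A_def B_def C_def D_def Spl_def by blast
  qed
  then have sub: "\<J> \<subseteq> A \<union> B \<union> C \<union> D \<union> {P}" by blast
  have fin: "finite (A \<union> B \<union> C \<union> D \<union> {P})" using A B C D by blast
  have "card \<J> \<le> card (A \<union> B \<union> C \<union> D \<union> {P})" by (rule card_mono[OF fin sub])
  also have "\<dots> \<le> card A + card B + card C + card D + 1"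
    using card_Un_le[of A B] card_Un_le[of "A \<union> B" C] card_Un_le[of "A \<union> B \<union> C" D]
      card_Un_le[of "A \<union> B \<union> C \<union> D" "{P}"] by simp
  also have "\<dots> \<le> 4 * l + 1" using A B C D by simp
  finally show ?thesis using finite_subset[OF sub fin] by blast
qed

lemma before_step:
  assumes "points P x y" "q \<in> P" "e \<in> P" "before True x y p e" "p = q \<or> adj x y p q"
    and "q \<noteq> e" "\<not> adj x y q e"
  shows "before True x y q e"
  using assms points_neq[OF assms(1-3,6)] unfolding before_def adj_iff by auto

text \<open>
  The leftmost and the rightmost point of a component are joined by a path with at most three
  edges. Each further point lies above and to the right of the leftmost point, and the relative
  position cannot change along the path without an inversion.
\<close>
lemma component_dominating:
  assumes P: "points P x y" and free: "P5_free P x y" and R: "R \<subseteq> P"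
    and J: "p \<in> R" "J = component True R x y p"
  obtains C where "C \<subseteq> J" "finite C" "card C \<le> 4" "\<And>e. e \<in> J \<Longrightarrow> e \<in> C \<or> (\<exists>c\<in>C. adj x y c e)"
proof -
  have JP: "J \<subseteq> P" using component_subset R unfolding J(2) by (rule order_trans)
  have finJ: "finite J" using P JP finite_subset unfolding points_def by blast
  have Jne: "J \<noteq> {}" using component_self[OF J(1)] unfolding J(2) by blast
  define t where "t = arg_min_on x J"
  have t: "t \<in> J" "\<And>j. j \<in> J \<Longrightarrow> x t \<le> x j"
    using arg_min_if_finite[OF finJ Jne, of x] unfolding t_def by (auto simp: not_less)
  have "Max (x ` J) \<in> x ` J" using finJ Jne by simp
  then obtain w where w0: "w \<in> J" "x w = Max (x ` J)" by (metis imageE)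
  have w: "w \<in> J" "\<And>j. j \<in> J \<Longrightarrow> x j \<le> x w" using w0 finJ by simp_all
  define step where "step a b \<longleftrightarrow> a = b \<or> adj x y a b" for a b
  \<comment> \<open>The points at distance at most three from \<open>t\<close> in the component. An
    edge leaving this set would extend a path \<open>t a b d\<close> to an induced path on five
    vertices, so the set is a cut and exhausts \<open>J\<close>.\<close>
  define D where "D = {q \<in> J. \<exists>a\<in>J. \<exists>b\<in>J. step t a \<and> step a b \<and> step b q}"
  have before_t: "before True x y t e" if "e \<in> J" "e \<noteq> t" "\<not> adj x y t e" for e
  proof -
    have "x t \<noteq> x e" "y t \<noteq> y e" using points_neq[OF P, of t e] that t(1) JP by blast+
    then show ?thesis using t(2)[OF that(1)] that(3) unfolding before_def adj_iff by auto
  qed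
  have non: "\<not> adj x y d e" if d: "d \<in> D" and e: "e \<in> J" "e \<notin> D" for d e
  proof
    assume de: "adj x y d e"
    obtain a b where ab: "a \<in> J" "b \<in> J" "step t a" "step a b" "step b d" and dJ: "d \<in> J"
      using d unfolding D_def by blast
    have far: "\<not> (step t a' \<and> step a' b' \<and> step b' e)" if "a' \<in> J" "b' \<in> J" for a' b'
      using e that unfolding D_def by blast
    have n: "\<not> adj x y t e" "\<not> adj x y a e" "\<not> adj x y b e"
      using far[OF t(1) t(1)] far[OF ab(1) ab(1)] far[OF ab(1,2)] ab unfolding step_def by blast+
    moreover have "\<not> adj x y t d" "\<not> adj x y a d" "\<not> adj x y t b"
      using far[OF t(1) dJ] far[OF ab(1) dJ] far[OF ab(2) dJ] ab de unfolding step_def by blast+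
    moreover have "t \<noteq> a" "a \<noteq> b" "b \<noteq> d"
      using far[OF ab(2) dJ] far[OF ab(1) dJ] ab de far[OF ab(1) ab(2)] unfolding step_def by blast+
    ultimately show False
      using P5_freeD[OF free, of t a b d e] ab de t(1) dJ e(1) JP unfolding step_def by blast
  qed
  have tD: "t \<in> D" using t(1) unfolding D_def step_def by blast
  have "cut True J x y D"
    unfolding cut_def
  proof (intro conjI ballI)
    fix d e assume d: "d \<in> D" and e: "e \<in> J - D"
    obtain a b where ab: "a \<in> J" "b \<in> J" "step t a" "step a b" "step b d" and dJ: "d \<in> J"
      using d unfolding D_def by blast
    have abD: "a \<in> D" "b \<in> D" using ab t(1) unfolding D_def step_def by blast+
    have ok: "q \<in> P \<and> e \<in> P \<and> q \<noteq> e \<and> \<not> adj x y q e" if "q \<in> D" for q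
      using that non e JP unfolding D_def by blast
    have "before True x y t e" using before_t ok[OF tD] e by blast
    then have "before True x y a e" using before_step[OF P] ok[OF abD(1)] ab(3) unfolding step_def by blast
    then have "before True x y b e" using before_step[OF P] ok[OF abD(2)] ab(4) unfolding step_def by blast
    then show "before True x y d e" using before_step[OF P] ok[OF d] ab(5) unfolding step_def by blast
  qed (auto simp: D_def)
  then have "D = J" using component_no_cut[OF _ J(1), of True x y D] tD unfolding J(2) by blast
  then obtain a b where ab: "a \<in> J" "b \<in> J" "step t a" "step a b" "step b w" using w(1) unfolding D_def by blast
  show thesis
  proof (rule that[of "{t, a, b, w}"])
    show "card {t, a, b, w} \<le> 4" by (rule order_trans[OF card_insert_le_m1[of 4]]) (auto simp: card_insert_if)
    fix e assume e: "e \<in> J"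
    show "e \<in> {t, a, b, w} \<or> (\<exists>c\<in>{t, a, b, w}. adj x y c e)"
    proof (rule ccontr)
      assume c: "\<not> ?thesis"
      have ok: "q \<in> P \<and> e \<in> P \<and> q \<noteq> e \<and> \<not> adj x y q e" if "q \<in> {t, a, b, w}" for q
        using that c e JP ab t(1) w(1) by blast
      have "before True x y t e" using before_t ok[of t] e by blast
      then have "before True x y a e" using before_step[OF P] ok[of a] ab(3) unfolding step_def by blast
      then have "before True x y b e" using before_step[OF P] ok[of b] ab(4) unfolding step_def by blast
      then have "before True x y w e" using before_step[OF P] ok[of w] ab(5) unfolding step_def by blast
      then show False using w(2)[OF e] unfolding before_def by simp
    qed
  qed (use ab t(1) w(1) in auto)
qed

section \<open>Lines that separate all inversions\<close>

definition separated :: "nat set \<Rightarrow> ('a \<Rightarrow> nat) \<Rightarrow> 'a \<Rightarrow> 'a \<Rightarrow> bool" where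
  "separated X x p q \<longleftrightarrow> (\<exists>c\<in>X. (x p < c \<and> c \<le> x q) \<or> (x q < c \<and> c \<le> x p))"

lemma separated_mono: "separated X x p q \<Longrightarrow> X \<subseteq> X' \<Longrightarrow> separated X' x p q"
  unfolding separated_def by blast

text \<open>At most \<open>4 * l + 1\<close> components, four dominating points in each, and for
  every such point two lines around it and the lines of two quadrants whose clique number is smaller
  by one.\<close>

fun line_bound :: "nat \<Rightarrow> nat \<Rightarrow> nat" where
  "line_bound l 0 = 0"
| "line_bound l (Suc k) = (4 * l + 1) * (4 * (2 + 2 * line_bound l k))"

text \<open>Induction on the clique number of a box. The two points of an inversion share a
  component. If neither is a dominating point, the first is inverted with a dominating point
  \<open>c\<close>. If the second lies in the same quadrant at \<open>c\<close>, the induction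
  hypothesis for that quadrant applies; otherwise a line next to \<open>c\<close> separates the
  two.\<close>

lemma inversion_lines:
  assumes P: "points P x y" and free: "P5_free P x y" and cl: "cliques_le l P x y"
    and simple: "simple P x y" and R: "boxlike P x y R" and k: "cliques_le k R x y"
  shows "\<exists>X Y. finite X \<and> finite Y \<and> card X \<le> line_bound l k \<and> card Y \<le> line_bound l k \<and>
    (\<forall>p\<in>R. \<forall>q\<in>R. adj x y p q \<longrightarrow> separated X x p q \<or> separated Y y p q)"
  using R k
proof (induction k arbitrary: R)
  case 0
  have "R = {}"
  proof (rule ccontr)
    assume "R \<noteq> {}"
    then obtain p where "p \<in> R" by blast
    then have "card {p} \<le> 0" using 0 unfolding cliques_le_def clique_def by blast
    then show False by simp
  qed
  then show ?case by (intro exI[of _ "{}"]) simp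
next
  case (Suc k)
  define \<J> where "\<J> = {J. \<exists>p\<in>R. J = component True R x y p \<and> 2 \<le> card J}"
  have RP: "R \<subseteq> P" using Suc.prems unfolding boxlike_def by blast
  have finR: "finite R" using RP P finite_subset unfolding points_def by blast
  have \<J>: "finite \<J>" "card \<J> \<le> 4 * l + 1"
    using card_nontrivial_components[OF P free cl simple Suc.prems(1) \<J>_def] by auto
  have "\<exists>C. C \<subseteq> J \<and> finite C \<and> card C \<le> 4 \<and> (\<forall>e\<in>J. e \<in> C \<or> (\<exists>c\<in>C. adj x y c e))" if J: "J \<in> \<J>" for J
  proof -
    obtain p where p: "p \<in> R" "J = component True R x y p" using J unfolding \<J>_def by blast
    show ?thesis by (rule component_dominating[OF P free RP p]) blast
  qed
  then obtain C where C: "\<And>J. J \<in> \<J> \<Longrightarrow> C J \<subseteq> J \<and> finite (C J) \<and> card (C J) \<le> 4 \<and>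
      (\<forall>e\<in>J. e \<in> C J \<or> (\<exists>c\<in>C J. adj x y c e))" by metis
  \<comment> \<open>The points to the upper left of \<open>c\<close> for \<open>True\<close>, to the
    lower right for \<open>False\<close>; all of them are inverted with \<open>c\<close>.\<close>
  define Q where "Q r c = {p \<in> R. if r then before False x y p c else before False x y c p}" for r c
  have lines: "\<exists>X Y. finite X \<and> finite Y \<and> card X \<le> line_bound l k \<and> card Y \<le> line_bound l k \<and>
    (\<forall>p\<in>Q r c. \<forall>q\<in>Q r c. adj x y p q \<longrightarrow> separated X x p q \<or> separated Y y p q)" if c: "c \<in> R" for r c
  proof (rule Suc.IH)
    \<comment> \<open>A point of \<open>R\<close> outside the quadrant whose line cuts the quadrant
      cannot be on the quadrant's side of \<open>c\<close> in the other coordinate, so it is beside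
      the whole quadrant. For points outside \<open>R\<close> the hypothesis on \<open>R\<close>
      applies.\<close>
    show "boxlike P x y (Q r c)"
      unfolding boxlike_def
    proof (intro conjI ballI impI)
      show "Q r c \<subseteq> P" using RP unfolding Q_def by blast
      fix e assume e: "e \<in> P - Q r c"
      {
        assume s: "splits y (Q r c) e"
        show "(\<forall>q\<in>Q r c. x q < x e) \<or> (\<forall>q\<in>Q r c. x e < x q)"
        proof (cases "e \<in> R")
          case True
          then show ?thesis using s e unfolding Q_def splits_def before_def by (auto split: if_splits)
        next
          case False
          then have "(\<forall>q\<in>R. x q < x e) \<or> (\<forall>q\<in>R. x e < x q)"
            using Suc.prems(1) e splits_mono[OF s, of R] unfolding boxlike_def Q_def by blast
          then show ?thesis unfolding Q_def by blast
        qed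
      next
        assume s: "splits x (Q r c) e"
        show "(\<forall>q\<in>Q r c. y q < y e) \<or> (\<forall>q\<in>Q r c. y e < y q)"
        proof (cases "e \<in> R")
          case True
          then show ?thesis using s e unfolding Q_def splits_def before_def by (auto split: if_splits)
        next
          case False
          then have "(\<forall>q\<in>R. y q < y e) \<or> (\<forall>q\<in>R. y e < y q)"
            using Suc.prems(1) e splits_mono[OF s, of R] unfolding boxlike_def Q_def by blast
          then show ?thesis unfolding Q_def by blast
        qed
      }
    qed
    show "cliques_le k (Q r c) x y"
      unfolding cliques_le_def
    proof (intro allI impI)
      fix A assume A: "A \<subseteq> Q r c" "clique x y A"
      have "clique x y (insert c A)"
        using A unfolding clique_def Q_def adj_def by (auto split: if_splits)
      moreover have "insert c A \<subseteq> R" using A(1) c unfolding Q_def by blast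
      ultimately have "card (insert c A) \<le> Suc k" using Suc.prems(2) unfolding cliques_le_def by blast
      moreover have "c \<notin> A" using A(1) unfolding Q_def before_def by (auto split: if_splits)
      moreover have "finite A" using A(1) finR finite_subset unfolding Q_def by (metis (no_types, lifting) mem_Collect_eq subset_iff)
      ultimately show "card A \<le> k" by simp
    qed
  qed
  then have "\<forall>r c. \<exists>XY. c \<in> R \<longrightarrow> finite (fst XY) \<and> finite (snd XY) \<and> card (fst XY) \<le> line_bound l k \<and>
      card (snd XY) \<le> line_bound l k \<and> (\<forall>p\<in>Q r c. \<forall>q\<in>Q r c. adj x y p q \<longrightarrow>
      separated (fst XY) x p q \<or> separated (snd XY) y p q)"
    by (metis fst_conv snd_conv)
  then obtain L where L: "\<And>r c. c \<in> R \<Longrightarrow> finite (fst (L r c)) \<and> finite (snd (L r c)) \<and>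
      card (fst (L r c)) \<le> line_bound l k \<and> card (snd (L r c)) \<le> line_bound l k \<and>
      (\<forall>p\<in>Q r c. \<forall>q\<in>Q r c. adj x y p q \<longrightarrow> separated (fst (L r c)) x p q \<or> separated (snd (L r c)) y p q)"
    by metis
  \<comment> \<open>A line at \<open>v\<close> separates the coordinates below \<open>v\<close> from
    those that are at least \<open>v\<close>, so the first two lines enclose exactly the coordinate
    of the point \<open>c\<close>.\<close>
  define LX where "LX c = {x c, Suc (x c)} \<union> (fst (L True c) \<union> fst (L False c))" for c
  define LY where "LY c = {y c, Suc (y c)} \<union> (snd (L True c) \<union> snd (L False c))" for c
  define X Y where "X = (\<Union>J\<in>\<J>. \<Union>c\<in>C J. LX c)" and "Y = (\<Union>J\<in>\<J>. \<Union>c\<in>C J. LY c)"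
  have CR: "c \<in> R" if "J \<in> \<J>" "c \<in> C J" for J c
  proof -
    have "J \<subseteq> R" using that(1) component_subset[of True R x y] unfolding \<J>_def by blast
    then show ?thesis using C[OF that(1)] that(2) by blast
  qed
  have bound: "finite (\<Union>J\<in>\<J>. \<Union>c\<in>C J. F c) \<and>
      card (\<Union>J\<in>\<J>. \<Union>c\<in>C J. F c) \<le> (4 * l + 1) * (4 * (2 + 2 * line_bound l k))"
    if F: "\<And>c. c \<in> R \<Longrightarrow> finite (F c) \<and> card (F c) \<le> 2 + 2 * line_bound l k" for F :: "'a \<Rightarrow> nat set"
  proof
    show "finite (\<Union>J\<in>\<J>. \<Union>c\<in>C J. F c)" using \<J>(1) C CR F by blast
    have "card (\<Union>c\<in>C J. F c) \<le> 4 * (2 + 2 * line_bound l k)" if J: "J \<in> \<J>" for J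
    proof -
      have "card (\<Union>c\<in>C J. F c) \<le> (\<Sum>c\<in>C J. card (F c))" using C[OF J] by (intro card_UN_le) blast
      also have "\<dots> \<le> (\<Sum>c\<in>C J. 2 + 2 * line_bound l k)" using F CR[OF J] by (intro sum_mono) blast
      also have "\<dots> = card (C J) * (2 + 2 * line_bound l k)" by simp
      also have "\<dots> \<le> 4 * (2 + 2 * line_bound l k)" using C[OF J] by (intro mult_right_mono) auto
      finally show ?thesis .
    qed
    then have "(\<Sum>J\<in>\<J>. card (\<Union>c\<in>C J. F c)) \<le> (\<Sum>J\<in>\<J>. 4 * (2 + 2 * line_bound l k))" by (intro sum_mono)
    moreover have "card (\<Union>J\<in>\<J>. \<Union>c\<in>C J. F c) \<le> (\<Sum>J\<in>\<J>. card (\<Union>c\<in>C J. F c))"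
      by (rule card_UN_le[OF \<J>(1)])
    moreover have "(\<Sum>J\<in>\<J>. 4 * (2 + 2 * line_bound l k)) \<le> (4 * l + 1) * (4 * (2 + 2 * line_bound l k))"
      using mult_right_mono[OF \<J>(2), of "4 * (2 + 2 * line_bound l k)"] by simp
    ultimately show "card (\<Union>J\<in>\<J>. \<Union>c\<in>C J. F c) \<le> (4 * l + 1) * (4 * (2 + 2 * line_bound l k))" by linarith
  qed
  have card4: "card ({a, Suc a} \<union> (M \<union> N)) \<le> 2 + 2 * n" if "card M \<le> n" "card N \<le> n" for a n and M N :: "nat set"
    using card_Un_le[of "{a, Suc a}" "M \<union> N"] card_Un_le[of M N] that by simp
  have "finite (LX c) \<and> card (LX c) \<le> 2 + 2 * line_bound l k"
    "finite (LY c) \<and> card (LY c) \<le> 2 + 2 * line_bound l k" if "c \<in> R" for c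
    unfolding LX_def LY_def using L[OF that] by (blast intro: card4)+
  then have XY: "finite X \<and> card X \<le> line_bound l (Suc k)" "finite Y \<and> card Y \<le> line_bound l (Suc k)"
    unfolding X_def Y_def line_bound.simps by (intro bound; blast)+
  have "separated X x p q \<or> separated Y y p q" if p: "p \<in> R" and q: "q \<in> R" and pq: "adj x y p q" for p q
  proof -
    define J where "J = component True R x y p"
    have "q \<in> J"
    proof (rule ccontr)
      assume "q \<notin> J"
      then have "before True x y p q \<or> before True x y q p"
        using component_before[OF p q, of True x y] component_self[OF p, of True x y]
          component_self[OF q, of True x y] unfolding J_def by metis
      then show False using pq unfolding adj_iff before_def by auto
    qed
    moreover have pJ: "p \<in> J" using component_self[OF p] unfolding J_def by metis
    moreover have "p \<noteq> q" using pq unfolding adj_iff by auto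
    moreover have "finite J" using finR component_subset[of True R x y p] finite_subset unfolding J_def by blast
    ultimately have "2 \<le> card J" using card_mono[of J "{p, q}"] by simp
    then have J: "J \<in> \<J>" using p unfolding \<J>_def J_def by blast
    have sub: "LX c \<subseteq> X" "LY c \<subseteq> Y" if "c \<in> C J" for c using that J unfolding X_def Y_def by blast+
    have ends: "separated X x p q" if "p \<in> C J \<or> q \<in> C J"
    proof -
      have s: "separated {x a, Suc (x a)} x p q" if "a = p \<or> a = q" for a
        using that pq unfolding separated_def adj_iff by force
      from \<open>p \<in> C J \<or> q \<in> C J\<close> show ?thesis
        using s[of p] s[of q] sub unfolding LX_def by (metis (no_types, lifting) Un_subset_iff separated_mono)
    qed
    show ?thesis
    proof (cases "p \<in> C J \<or> q \<in> C J")
      case False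
      then obtain c where c: "c \<in> C J" "adj x y c p" using C[OF J] pJ by blast
      have cR: "c \<in> R" by (rule CR[OF J c(1)])
      have cq: "x c \<noteq> x q" "y c \<noteq> y q" using points_neq[OF P, of c q] False c(1) cR q RP by blast+
      have "p \<in> Q True c \<or> p \<in> Q False c" using c(2) p unfolding Q_def adj_def by auto
      then obtain r where r: "p \<in> Q r c" by blast
      show ?thesis
      proof (cases "q \<in> Q r c")
        case True
        have "separated (fst (L r c)) x p q \<or> separated (snd (L r c)) y p q"
          using L[OF cR, of r] r True pq by blast
        moreover have "fst (L r c) \<subseteq> X" "snd (L r c) \<subseteq> Y"
          using sub[OF c(1)] unfolding LX_def LY_def by (cases r; simp)+
        ultimately show ?thesis
          using separated_mono[of "fst (L r c)" x p q X] separated_mono[of "snd (L r c)" y p q Y] by blast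
      next
        case nq: False
        have "separated {x c, Suc (x c)} x p q \<or> separated {y c, Suc (y c)} y p q"
          using r nq q cq unfolding Q_def before_def separated_def by (cases r) auto
        moreover have "{x c, Suc (x c)} \<subseteq> X" "{y c, Suc (y c)} \<subseteq> Y"
          using sub[OF c(1)] unfolding LX_def LY_def by blast+
        ultimately show ?thesis
          using separated_mono[of "{x c, Suc (x c)}" x p q X] separated_mono[of "{y c, Suc (y c)}" y p q Y]
          by blast
      qed
    qed (use ends in blast)
  qed
  then show ?case using XY by blast
qed

section \<open>Refining a gridding to an acyclic one\<close>

text \<open>The order in which points have to be read: left to right in each column, bottom to top
  in each row. A linear extension lists the points as a word, and acyclicity guarantees one.\<close>

definition grid_rel :: "'a set \<Rightarrow> ('a \<Rightarrow> nat) \<Rightarrow> ('a \<Rightarrow> nat) \<Rightarrow> ('a \<Rightarrow> nat) \<Rightarrow> ('a \<Rightarrow> nat) \<Rightarrow> ('a \<times> 'a) set" where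
  "grid_rel P x y col row = {(p, q). p \<in> P \<and> q \<in> P \<and>
     ((col p = col q \<and> x p < x q) \<or> (row p = row q \<and> y p < y q))}"

definition good_gridding :: "'a set \<Rightarrow> ('a \<Rightarrow> nat) \<Rightarrow> ('a \<Rightarrow> nat) \<Rightarrow> ('a \<Rightarrow> nat) \<Rightarrow> ('a \<Rightarrow> nat) \<Rightarrow> bool" where
  "good_gridding P x y col row \<longleftrightarrow>
     (\<forall>p\<in>P. \<forall>q\<in>P. (x p < x q \<longrightarrow> col p \<le> col q) \<and> (y p < y q \<longrightarrow> row p \<le> row q)) \<and>
     acyclic (grid_rel P x y col row)"

lemma ex_max_nat:
  fixes f :: "'a \<Rightarrow> nat"
  assumes "finite B" "b \<in> B"
  shows "\<exists>m\<in>B. \<forall>b'\<in>B. f b' \<le> f m"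
proof -
  have "Max (f ` B) \<in> f ` B" using assms by (intro Max_in) auto
  then obtain m where "m \<in> B" "f m = Max (f ` B)" by (metis imageE)
  then show ?thesis using assms(1) by (intro bexI[of _ m]) auto
qed

text \<open>The kind of the last step by which the propagation of cuts arrived at a point.\<close>

datatype move = Origin | Upward | Downward | Leftward | Rightward

locale monotone_gridding =
  fixes P :: "'a set" and x y col row :: "'a \<Rightarrow> nat" and k :: nat
  assumes points: "points P x y" and free: "P5_free P x y"
    and col_mono: "\<And>p q. p \<in> P \<Longrightarrow> q \<in> P \<Longrightarrow> x p \<le> x q \<Longrightarrow> col p \<le> col q"
    and row_mono: "\<And>p q. p \<in> P \<Longrightarrow> q \<in> P \<Longrightarrow> y p \<le> y q \<Longrightarrow> row p \<le> row q"
    and col_le: "\<And>p. p \<in> P \<Longrightarrow> col p \<le> k" and row_le: "\<And>p. p \<in> P \<Longrightarrow> row p \<le> k"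
    and cell_not_adj: "\<And>p q. p \<in> P \<Longrightarrow> q \<in> P \<Longrightarrow> col p = col q \<Longrightarrow> row p = row q \<Longrightarrow> \<not> adj x y p q"
begin

section \<open>Projections between the cells of a row or a column\<close>

lemma finP: "finite P"
  using points unfolding points_def by blast

lemma cell_less:
  assumes "p \<in> P" "q \<in> P" "col p = col q" "row p = row q"
  shows "x p < x q \<longleftrightarrow> y p < y q"
  using cell_not_adj[OF assms] points_neq[OF points assms(1,2)] unfolding adj_iff
  by (metis linorder_neqE_nat order_less_irrefl)

lemma cell_le:
  assumes "p \<in> P" "q \<in> P" "col p = col q" "row p = row q"
  shows "x p \<le> x q \<longleftrightarrow> y p \<le> y q"
  using cell_less[OF assms(2,1)] assms by (simp add: not_less[symmetric])

lemma x_less: "p \<in> P \<Longrightarrow> q \<in> P \<Longrightarrow> col p < col q \<Longrightarrow> x p < x q"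
  using col_mono[of q p] by (meson not_less)

lemma y_less: "p \<in> P \<Longrightarrow> q \<in> P \<Longrightarrow> row p < row q \<Longrightarrow> y p < y q"
  using row_mono[of q p] by (meson not_less)

text \<open>A vertical line just after \<open>a\<close> passes through another cell of the column
  just after such a point \<open>b\<close>. As that cell is increasing, the horizontal line just
  after \<open>b\<close> divides it in the same way; for this reason cuts are propagated along
  \<open>PX\<close> and \<open>PY\<close>.\<close>

definition PX :: "'a \<Rightarrow> 'a \<Rightarrow> bool" where
  "PX a b \<longleftrightarrow> a \<in> P \<and> b \<in> P \<and> col a = col b \<and> row a \<noteq> row b \<and> x b < x a \<and>
     (\<forall>b'\<in>P. col b' = col b \<and> row b' = row b \<and> x b' < x a \<longrightarrow> x b' \<le> x b)"

definition PY :: "'a \<Rightarrow> 'a \<Rightarrow> bool" where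
  "PY a b \<longleftrightarrow> a \<in> P \<and> b \<in> P \<and> row a = row b \<and> col a \<noteq> col b \<and> y b < y a \<and>
     (\<forall>b'\<in>P. col b' = col b \<and> row b' = row b \<and> y b' < y a \<longrightarrow> y b' \<le> y b)"

lemma ex_PX:
  assumes "a \<in> P" "b \<in> P" "col a = col b" "row a \<noteq> row b" "x b < x a"
  obtains b' where "PX a b'" "col b' = col b" "row b' = row b" "x b \<le> x b'" "y b \<le> y b'" "b' \<in> P"
proof -
  define B where "B = {b'\<in>P. col b' = col b \<and> row b' = row b \<and> x b' < x a}"
  have "finite B" "b \<in> B" using finP assms unfolding B_def by auto
  then obtain m where m: "m \<in> B" "\<And>b'. b' \<in> B \<Longrightarrow> x b' \<le> x m"
    using ex_max_nat[of B b] by blast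
  have mb: "m \<in> P" "col m = col b" "row m = row b" "x m < x a" using m(1) unfolding B_def by auto
  have "PX a m" unfolding PX_def using mb m(2) assms unfolding B_def by auto
  moreover have "x b \<le> x m" using m(2) \<open>b \<in> B\<close> by blast
  moreover have "y b \<le> y m" using cell_le[of b m] mb assms(2) \<open>x b \<le> x m\<close> by simp
  ultimately show thesis using that mb by blast
qed

lemma ex_PY:
  assumes "a \<in> P" "b \<in> P" "row a = row b" "col a \<noteq> col b" "y b < y a"
  obtains b' where "PY a b'" "col b' = col b" "row b' = row b" "x b \<le> x b'" "y b \<le> y b'" "b' \<in> P"
proof -
  define B where "B = {b'\<in>P. col b' = col b \<and> row b' = row b \<and> y b' < y a}"
  have "finite B" "b \<in> B" using finP assms unfolding B_def by auto
  then obtain m where m: "m \<in> B" "\<And>b'. b' \<in> B \<Longrightarrow> y b' \<le> y m"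
    using ex_max_nat[of B b] by blast
  have mb: "m \<in> P" "col m = col b" "row m = row b" "y m < y a" using m(1) unfolding B_def by auto
  have "PY a m" unfolding PY_def using mb m(2) assms unfolding B_def by auto
  moreover have "y b \<le> y m" using m(2) \<open>b \<in> B\<close> by blast
  moreover have "x b \<le> x m" using cell_le[of b m] mb assms(2) \<open>y b \<le> y m\<close> by simp
  ultimately show thesis using that mb by blast
qed

lemma PXD:
  assumes "PX a b"
  shows "a \<in> P" "b \<in> P" "col a = col b" "row a \<noteq> row b" "x b < x a"
    "\<And>b'. b' \<in> P \<Longrightarrow> col b' = col b \<Longrightarrow> row b' = row b \<Longrightarrow> x b < x b' \<Longrightarrow> x a < x b'"
proof -
  show *: "a \<in> P" "b \<in> P" "col a = col b" "row a \<noteq> row b" "x b < x a" using assms unfolding PX_def by auto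
  fix b' assume b': "b' \<in> P" "col b' = col b" "row b' = row b" "x b < x b'"
  have "x a \<noteq> x b'" using points_neq(1)[OF points *(1) b'(1)] *(4) b'(3) by auto
  moreover have "\<not> x b' < x a" using assms b' unfolding PX_def by fastforce
  ultimately show "x a < x b'" by simp
qed

lemma PYD:
  assumes "PY a b"
  shows "a \<in> P" "b \<in> P" "row a = row b" "col a \<noteq> col b" "y b < y a"
    "\<And>b'. b' \<in> P \<Longrightarrow> col b' = col b \<Longrightarrow> row b' = row b \<Longrightarrow> y b < y b' \<Longrightarrow> y a < y b'"
proof -
  show *: "a \<in> P" "b \<in> P" "row a = row b" "col a \<noteq> col b" "y b < y a" using assms unfolding PY_def by auto
  fix b' assume b': "b' \<in> P" "col b' = col b" "row b' = row b" "y b < y b'"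
  have "y a \<noteq> y b'" using points_neq(2)[OF points *(1) b'(1)] *(4) b'(2) by auto
  moreover have "\<not> y b' < y a" using assms b' unfolding PY_def by fastforce
  ultimately show "y a < y b'" by simp
qed

lemma PX_unique: "PX a b \<Longrightarrow> PX a b' \<Longrightarrow> row b = row b' \<Longrightarrow> b = b'"
  using PXD(6)[of a b b'] PXD(6)[of a b' b] PXD[of a b] PXD[of a b'] points_neq(1)[OF points, of b b']
  by (metis linorder_neqE_nat order_less_asym)

lemma PY_unique: "PY a b \<Longrightarrow> PY a b' \<Longrightarrow> col b = col b' \<Longrightarrow> b = b'"
  using PYD(6)[of a b b'] PYD(6)[of a b' b] PYD[of a b] PYD[of a b'] points_neq(2)[OF points, of b b']
  by (metis linorder_neqE_nat order_less_asym)

text \<open>The two ways of turning around the corner \<open>b\<close>, with \<open>a\<close> below \<open>b\<close> and \<open>c\<close> to the right of \<open>b\<close>.\<close>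
definition turn1 :: "nat \<Rightarrow> nat \<Rightarrow> nat \<Rightarrow> nat \<Rightarrow> 'a \<Rightarrow> bool" where
  "turn1 i i' j j' c \<longleftrightarrow> (\<exists>a b. PX a b \<and> PY b c \<and> row a < row b \<and> col b < col c \<and>
     col b = i \<and> col c = i' \<and> row a = j \<and> row b = j')"

definition turn2 :: "nat \<Rightarrow> nat \<Rightarrow> nat \<Rightarrow> nat \<Rightarrow> 'a \<Rightarrow> bool" where
  "turn2 i i' j j' a \<longleftrightarrow> (\<exists>c b. PY c b \<and> PX b a \<and> row a < row b \<and> col b < col c \<and>
     col b = i \<and> col c = i' \<and> row a = j \<and> row b = j')"

text \<open>Of two turns with different ends take the one whose corner \<open>b\<close> is to the
  left of the other corner \<open>b'\<close>; then \<open>a b a' b' c'\<close> is an induced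
  path.\<close>

lemma turn1_unique:
  assumes "turn1 i i' j j' c" "turn1 i i' j j' d"
  shows "c = d"
proof -
  have wlog: False if A: "PX a b" "PY b c" "row a < row b" "col b < col c"
    and B: "PX a' b'" "PY b' c'" "row a' = row a" "col c' = col c" "col b' = col b" "row b' = row b"
    and lt: "x b < x b'" and ne: "c \<noteq> c'" for a b c a' b' c'
  proof -
    note a = PXD[OF A(1)] and c = PYD[OF A(2)] and a' = PXD[OF B(1)] and c' = PYD[OF B(2)]
    have bb: "y b < y b'" using cell_less[OF a(2) a'(2)] B(5,6) lt by simp
    have ab': "x a < x b'" using a(6)[OF a'(2) B(5,6) lt] .
    have bc': "y b < y c'"
    proof (rule ccontr)
      assume "\<not> y b < y c'"
      moreover have "b \<noteq> c'" using A(4) B(4) by auto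
      then have "y b \<noteq> y c'" by (rule points_neq(2)[OF points a(2) c'(2)])
      ultimately have "y c' < y b" by simp
      then have "\<not> y c < y c'" using c(6)[OF c'(2)] c'(3) c(3) B(4,6) by auto
      moreover have "y c < y b'" using c(5) bb by simp
      then have "\<not> y c' < y c" using c'(6)[OF c(2)] c(3) c'(3) B(4,6) by auto
      ultimately show False using points_neq(2)[OF points c(2) c'(2) ne] by simp
    qed
    have aa: "x a < x a'" using ab' a'(5) by simp
    have ya: "y a < y b" "y a' < y b" "y a < y b'" "y a' < y b'" "y a < y c'" "y a' < y c'"
      using y_less[OF a(1,2)] y_less[OF a'(1) a(2)] y_less[OF a(1) a'(2)] y_less[OF a'(1,2)]
        y_less[OF a(1) c'(2)] y_less[OF a'(1) c'(2)] A(3) B(3,6) c'(3) by simp_all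
    have xc: "x b < x c'" "x b' < x c'" "x a < x c'" "x a' < x c'"
      using x_less[OF a(2) c'(2)] x_less[OF a'(2) c'(2)] x_less[OF a(1) c'(2)] x_less[OF a'(1) c'(2)]
        A(4) B(4,5) a(3) a'(3) by simp_all
    have yaa: "y a < y a'" using cell_less[OF a(1) a'(1)] a(3) a'(3) B(3,5) aa by simp
    show False
      by (rule P5_freeD[OF free, of a b a' b' c'])
        (use a(1,2,5) a'(1,2,5) c'(2,5) ab' aa yaa bb bc' lt ya xc in \<open>auto simp: adj_iff\<close>)
  qed
  obtain a b where A: "PX a b" "PY b c" "row a < row b" "col b < col c"
      "col b = i" "col c = i'" "row a = j" "row b = j'" using assms(1) unfolding turn1_def by blast
  obtain a' b' where B: "PX a' b'" "PY b' d" "row a' < row b'" "col b' < col d"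
      "col b' = i" "col d = i'" "row a' = j" "row b' = j'" using assms(2) unfolding turn1_def by blast
  show "c = d"
  proof (rule ccontr)
    assume ne: "c \<noteq> d"
    consider "b = b'" | "x b < x b'" | "x b' < x b"
      using points_neq(1)[OF points, of b b'] PXD(2)[OF A(1)] PXD(2)[OF B(1)] by (meson linorder_neqE_nat)
    then show False
    proof cases
      case 1
      then show False using PY_unique[OF A(2)] B A ne by auto
    next
      case 2
      show False by (rule wlog[OF A(1-4) B(1,2)]) (use A B 2 ne in auto)
    next
      case 3
      show False by (rule wlog[OF B(1-4) A(1,2)]) (use A B 3 ne in auto)
    qed
  qed
qed

text \<open>Three ends would give the induced path \<open>a3 b2 c1 b3 c2\<close>. Two ends are not
  excluded in this way, which accounts for the bound 2 in \<open>card_V\<close>.\<close>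

lemma turn2_three:
  assumes "turn2 i i' j j' a1" "turn2 i i' j j' a2" "turn2 i i' j j' a3"
    and "x a1 < x a2" "x a2 < x a3"
  shows False
proof -
  obtain c1 b1 where A: "PY c1 b1" "PX b1 a1" "row a1 < row b1" "col b1 < col c1"
      "col b1 = i" "col c1 = i'" "row a1 = j" "row b1 = j'" using assms(1) unfolding turn2_def by blast
  obtain c2 b2 where B: "PY c2 b2" "PX b2 a2" "row a2 < row b2" "col b2 < col c2"
      "col b2 = i" "col c2 = i'" "row a2 = j" "row b2 = j'" using assms(2) unfolding turn2_def by blast
  obtain c3 b3 where C: "PY c3 b3" "PX b3 a3" "row a3 < row b3" "col b3 < col c3"
      "col b3 = i" "col c3 = i'" "row a3 = j" "row b3 = j'" using assms(3) unfolding turn2_def by blast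
  note a1 = PXD[OF A(2)] and c1 = PYD[OF A(1)]
  note a2 = PXD[OF B(2)] and c2 = PYD[OF B(1)]
  note a3 = PXD[OF C(2)] and c3 = PYD[OF C(1)]
  have "x b1 < x a2" using a1(6)[of a2] a1 a2 A B assms(4) by simp
  then have b12: "x b1 < x b2" using a2(5) by simp
  have b2a: "x b2 < x a3" using a2(6)[of a3] a2 a3 B C assms(5) by simp
  then have b23: "x b2 < x b3" using a3(5) by simp
  have yb: "y b1 < y b2" "y b2 < y b3"
    using cell_less[OF a1(1) a2(1)] cell_less[OF a2(1) a3(1)] b12 b23 A(5,8) B(5,8) C(5,8) by simp_all
  have ij: "i < i'" "j < j'" using A(3-8) by simp_all
  have rc: "row c1 = j'" "row c2 = j'" using c1(3) c2(3) A(8) B(8) by simp_all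
  have yc: "y c1 < y b2" "y c2 < y b3"
    using c1(6)[OF a2(1)] c2(6)[OF a3(1)] yb A(5,8) B(5,8) C(5,8) by simp_all
  have cc: "x c1 < x c2" "y c1 < y c2"
    using cell_less[OF c1(1) c2(1)] yc(1) c2(5) rc A(6) B(6) by simp_all
  have xc: "x b2 < x c1" "x b3 < x c1" "x b2 < x c2" "x b3 < x c2" "x a3 < x c1" "x a3 < x c2"
    using x_less[OF a2(1) c1(1)] x_less[OF a3(1) c1(1)] x_less[OF a2(1) c2(1)] x_less[OF a3(1) c2(1)]
      x_less[OF a3(2) c1(1)] x_less[OF a3(2) c2(1)] a3(3) ij A(5,6) B(5,6) C(5,6) by simp_all
  have ya: "y a3 < y b2" "y a3 < y b3" "y a3 < y c1" "y a3 < y c2"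
    using y_less[OF a3(2) a2(1)] y_less[OF a3(2) a3(1)] y_less[OF a3(2) c1(1)] y_less[OF a3(2) c2(1)]
      ij rc B(8) C(7,8) by simp_all
  show False
    by (rule P5_freeD[OF free, of a3 b2 c1 b3 c2])
      (use a2(1) a3(1,2,5) c1(1) c2(1,5) yb yc cc xc ya b2a b23 in \<open>auto simp: adj_iff\<close>)
qed

text \<open>The ends of turns, where the propagation of cuts starts. The cuts that arise from them
  break the cycles, see \<open>corner1\<close> and \<open>corner2\<close>.\<close>

definition V :: "'a set" where
  "V = {v. \<exists>i i' j j'. turn1 i i' j j' v \<or> turn2 i i' j j' v}"

lemma V_I1: "PX a b \<Longrightarrow> PY b c \<Longrightarrow> row a < row b \<Longrightarrow> col b < col c \<Longrightarrow> c \<in> V"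
  unfolding V_def turn1_def by blast

lemma V_I2: "PY c b \<Longrightarrow> PX b a \<Longrightarrow> row a < row b \<Longrightarrow> col b < col c \<Longrightarrow> a \<in> V"
  unfolding V_def turn2_def by blast

text \<open>For each of the \<open>Suc k ^ 4\<close> choices of two columns and two rows there is at
  most one end of the first kind, and there are at most two of the second.\<close>

lemma card_V: "finite V \<and> card V \<le> 3 * Suc k ^ 4"
proof -
  define I where "I = {..k} \<times> {..k} \<times> {..k} \<times> {..k}"
  define W where "W = (\<lambda>(i, i', j, j'). {v. turn1 i i' j j' v} \<union> {v. turn2 i i' j j' v})"
  have VP: "V \<subseteq> P" unfolding V_def turn1_def turn2_def using PXD(2) PYD(2) by blast
  have "V \<subseteq> (\<Union>z\<in>I. W z)"
  proof
    fix v assume "v \<in> V"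
    then obtain i i' j j' where t: "turn1 i i' j j' v \<or> turn2 i i' j j' v" unfolding V_def by blast
    have "\<exists>a b c. a \<in> P \<and> b \<in> P \<and> c \<in> P \<and> col b = i \<and> col c = i' \<and> row a = j \<and> row b = j'"
      using t
    proof
      assume "turn1 i i' j j' v"
      then show ?thesis unfolding turn1_def by (blast dest: PXD(1,2) PYD(2))
    next
      assume "turn2 i i' j j' v"
      then show ?thesis unfolding turn2_def by (blast dest: PXD(1,2) PYD(1))
    qed
    then obtain a b c where abc: "a \<in> P" "b \<in> P" "c \<in> P" "col b = i" "col c = i'" "row a = j" "row b = j'"
      by blast
    then have "i \<le> k \<and> i' \<le> k \<and> j \<le> k \<and> j' \<le> k"
      using col_le[OF abc(2)] col_le[OF abc(3)] row_le[OF abc(1)] row_le[OF abc(2)] by simp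
    then show "v \<in> (\<Union>z\<in>I. W z)" using t unfolding I_def W_def by auto
  qed
  moreover have W: "finite (W z) \<and> card (W z) \<le> 3" for z
  proof -
    obtain i i' j j' where z: "z = (i, i', j, j')" by (metis prod_cases4)
    have sub: "{v. turn1 i i' j j' v} \<subseteq> P" "{v. turn2 i i' j j' v} \<subseteq> P"
      unfolding turn1_def turn2_def using PXD(2) PYD(2) by blast+
    have f: "finite {v. turn1 i i' j j' v}" "finite {v. turn2 i i' j j' v}"
      using sub finP finite_subset by blast+
    have "card {v. turn1 i i' j j' v} \<le> 1"
      using f(1) turn1_unique by (intro card_le_Suc0_iff_eq[THEN iffD2, unfolded One_nat_def[symmetric]]) auto
    moreover have "card {v. turn2 i i' j j' v} \<le> 2"
    proof (rule ccontr)
      assume "\<not> ?thesis"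
      then have c: "3 \<le> card (x ` {v. turn2 i i' j j' v})"
        using points sub(2) card_image[of x "{v. turn2 i i' j j' v}"] inj_on_subset
        unfolding points_def by fastforce
      then obtain T where T: "T \<subseteq> x ` {v. turn2 i i' j j' v}" "card T = 3" "finite T"
        by (meson obtain_subset_with_card_n)
      then have "sorted_list_of_set T ! 0 < sorted_list_of_set T ! 1" "sorted_list_of_set T ! 1 < sorted_list_of_set T ! 2"
        using sorted_wrt_nth_less[OF strict_sorted_list_of_set, of 0 1 T]
          sorted_wrt_nth_less[OF strict_sorted_list_of_set, of 1 2 T] by simp_all
      moreover have "sorted_list_of_set T ! n \<in> x ` {v. turn2 i i' j j' v}" if "n < 3" for n
        using T that nth_mem[of n "sorted_list_of_set T"] by auto
      from this[of 0] this[of 1] this[of 2]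
      obtain a1 a2 a3 where "turn2 i i' j j' a1" "sorted_list_of_set T ! 0 = x a1"
          "turn2 i i' j j' a2" "sorted_list_of_set T ! 1 = x a2"
          "turn2 i i' j j' a3" "sorted_list_of_set T ! 2 = x a3" by auto
      ultimately show False using turn2_three by metis
    qed
    ultimately show ?thesis
      using f card_Un_le[of "{v. turn1 i i' j j' v}" "{v. turn2 i i' j j' v}"] unfolding z W_def by simp
  qed
  ultimately have "card V \<le> card (\<Union>z\<in>I. W z)" unfolding I_def by (intro card_mono) auto
  also have "\<dots> \<le> (\<Sum>z\<in>I. card (W z))" by (rule card_UN_le) (simp add: I_def)
  also have "\<dots> \<le> (\<Sum>z\<in>I. 3)" using W by (intro sum_mono) blast
  also have "\<dots> = 3 * Suc k ^ 4" by (simp add: I_def card_cartesian_product power4_eq_xxxx)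
  finally show ?thesis using finite_subset[OF VP finP] by blast
qed

section \<open>Propagation of cuts from the ends of turns\<close>

inductive reach :: "'a \<Rightarrow> move \<Rightarrow> bool" where
  origin: "v \<in> V \<Longrightarrow> reach v Origin"
| vertical: "reach q d \<Longrightarrow> d \<in> {Origin, Leftward, Rightward} \<Longrightarrow> PX q e \<Longrightarrow>
    reach e (if row q < row e then Upward else Downward)"
| horizontal: "reach q d \<Longrightarrow> d \<in> {Origin, Upward, Downward} \<Longrightarrow> PY q e \<Longrightarrow>
    reach e (if col e < col q then Leftward else Rightward)"

text \<open>The points after which a vertical line is drawn: the starting points and those reached
  by a horizontal step. A point reached by a vertical step already has a vertical line directly
  after it in its cell, namely the one of the point that was projected.\<close>

definition QX :: "'a set" where
  "QX = {p. \<exists>d\<in>{Origin, Leftward, Rightward}. reach p d}"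

definition QY :: "'a set" where
  "QY = {p. \<exists>d\<in>{Origin, Upward, Downward}. reach p d}"

lemma QX_step:
  assumes "q \<in> QX" "PX q e"
  shows "e \<in> QY"
proof -
  obtain d where "reach q d" "d \<in> {Origin, Leftward, Rightward}" using assms(1) unfolding QX_def by blast
  then have "reach e (if row q < row e then Upward else Downward)" using assms(2) by (rule vertical)
  then show ?thesis unfolding QY_def by (cases "row q < row e") auto
qed

lemma QY_step:
  assumes "q \<in> QY" "PY q e"
  shows "e \<in> QX"
proof -
  obtain d where "reach q d" "d \<in> {Origin, Upward, Downward}" using assms(1) unfolding QY_def by blast
  then have "reach e (if col e < col q then Leftward else Rightward)" using assms(2) by (rule horizontal)
  then show ?thesis unfolding QX_def by (cases "col e < col q") auto
qed

lemma V_QX: "v \<in> V \<Longrightarrow> v \<in> QX" and V_QY: "v \<in> V \<Longrightarrow> v \<in> QY"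
  unfolding QX_def QY_def using origin by auto

lemma QX_cases: "r \<in> QX \<Longrightarrow> r \<in> QY \<or> (\<exists>q\<in>QY. PY q r)"
  unfolding QX_def QY_def by (auto elim: reach.cases split: if_splits intro: origin)

lemma QY_cases: "r \<in> QY \<Longrightarrow> r \<in> QX \<or> (\<exists>q\<in>QX. PX q r)"
  unfolding QX_def QY_def by (auto elim: reach.cases split: if_splits intro: origin)

fun layer :: "nat \<Rightarrow> 'a set" where
  "layer 0 = V"
| "layer (Suc n) = layer n \<union> {e. \<exists>q\<in>layer n. PX q e \<or> PY q e}"

lemma layer_mono: "m \<le> n \<Longrightarrow> layer m \<subseteq> layer n"
  by (induction n) (auto simp: le_Suc_eq)

lemma V_layer: "V \<subseteq> layer n"
  using layer_mono[of 0 n] by simp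

text \<open>A point has at most \<open>Suc k\<close> projections in each of the two directions and
  stays in the next layer itself, whence the factor \<open>2 * k + 3\<close>.\<close>

lemma card_layer: "finite (layer n) \<and> card (layer n) \<le> 3 * Suc k ^ 4 * (2 * k + 3) ^ n"
proof (induction n)
  case 0
  then show ?case using card_V by simp
next
  case (Suc n)
  define N where "N q = {e. PX q e} \<union> {e. PY q e}" for q
  have N: "finite (N q) \<and> card (N q) \<le> 2 * k + 2" for q
  proof -
    have i: "inj_on row {e. PX q e}" "inj_on col {e. PY q e}"
      using PX_unique PY_unique by (auto simp: inj_on_def)
    have s: "row ` {e. PX q e} \<subseteq> {..k}" "col ` {e. PY q e} \<subseteq> {..k}"
      using PXD(2) PYD(2) row_le col_le by auto
    have "finite {e. PX q e}" "finite {e. PY q e}"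
      using finite_imageD[OF finite_subset[OF s(1)] i(1)] finite_imageD[OF finite_subset[OF s(2)] i(2)] by auto
    moreover have "card {e. PX q e} \<le> Suc k" "card {e. PY q e} \<le> Suc k"
      using card_inj_on_le[OF i(1) s(1)] card_inj_on_le[OF i(2) s(2)] by auto
    ultimately show ?thesis
      using card_Un_le[of "{e. PX q e}" "{e. PY q e}"] unfolding N_def by simp
  qed
  have eq: "layer (Suc n) = layer n \<union> (\<Union>q\<in>layer n. N q)" unfolding N_def by auto
  have "card (\<Union>q\<in>layer n. N q) \<le> (\<Sum>q\<in>layer n. card (N q))" using Suc by (intro card_UN_le) blast
  also have "\<dots> \<le> (\<Sum>q\<in>layer n. 2 * k + 2)" using N by (intro sum_mono) blast
  also have "\<dots> = card (layer n) * (2 * k + 2)" by simp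
  finally have "card (layer (Suc n)) \<le> card (layer n) + card (layer n) * (2 * k + 2)"
    unfolding eq using card_Un_le[of "layer n" "\<Union>q\<in>layer n. N q"] by linarith
  also have "\<dots> = card (layer n) * (2 * k + 3)" by (simp add: algebra_simps)
  also have "\<dots> \<le> 3 * Suc k ^ 4 * (2 * k + 3) ^ n * (2 * k + 3)"
    using Suc by (intro mult_right_mono) auto
  finally have "card (layer (Suc n)) \<le> 3 * Suc k ^ 4 * (2 * k + 3) ^ Suc n" by (simp only: power_Suc mult_ac)
  moreover have "finite (layer (Suc n))" unfolding eq using Suc N by blast
  ultimately show ?case by blast
qed

text \<open>Decreases along every step that does not turn around a corner of the above kind.\<close>
fun potential :: "'a \<Rightarrow> move \<Rightarrow> nat" where
  "potential p Origin = 4 * k + 2"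
| "potential p Upward = col p + (k - row p)"
| "potential p Leftward = col p + (k - row p)"
| "potential p Rightward = 2 * k + 1 + (k - col p) + row p"
| "potential p Downward = 2 * k + 1 + (k - col p) + row p"

text \<open>A step that does not lower the potential is a turn, and its end is in \<open>V\<close>,
  which is layer 0. So the depth needed is at most the potential \<open>4 * k + 2\<close> of a
  starting point.\<close>

lemma reach_layer:
  assumes "reach p d"
  shows "p \<in> layer (4 * k + 2 - potential p d) \<and>
    (d = Upward \<longrightarrow> (\<exists>a. PX a p \<and> row a < row p)) \<and> (d = Leftward \<longrightarrow> (\<exists>c. PY c p \<and> col p < col c))"
  using assms
proof induction
  case (origin v)
  then show ?case by simp
next
  case (vertical q d e)
  note D = PXD[OF vertical.hyps(3)]
  have le: "col q \<le> k" "row q \<le> k" "col e \<le> k" "row e \<le> k" using D col_le row_le by blast+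
  define d' where "d' = (if row q < row e then Upward else Downward)"
  have "e \<in> layer (4 * k + 2 - potential e d')"
  proof (cases "d = Leftward \<and> d' = Downward")
    case True
    then obtain c where "PY c q" "col q < col c" using vertical.IH by blast
    moreover have "row e < row q" using True D(4) unfolding d'_def by (auto split: if_splits)
    ultimately have "e \<in> V" using V_I2[OF _ vertical.hyps(3)] D(3) by simp
    then show ?thesis using V_layer by blast
  next
    case False
    then have pot: "potential e d' < potential q d" "potential q d \<le> 4 * k + 2"
      using vertical.hyps(2) le D unfolding d'_def by (auto split: if_splits)
    have "e \<in> layer (Suc (4 * k + 2 - potential q d))" using vertical.IH vertical.hyps(3) by auto
    moreover have "Suc (4 * k + 2 - potential q d) \<le> 4 * k + 2 - potential e d'" using pot by linarith
    ultimately show ?thesis using layer_mono by blast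
  qed
  then show ?case using vertical.hyps(3) unfolding d'_def by auto
next
  case (horizontal q d e)
  note D = PYD[OF horizontal.hyps(3)]
  have le: "col q \<le> k" "row q \<le> k" "col e \<le> k" "row e \<le> k" using D col_le row_le by blast+
  define d' where "d' = (if col e < col q then Leftward else Rightward)"
  have "e \<in> layer (4 * k + 2 - potential e d')"
  proof (cases "d = Upward \<and> d' = Rightward")
    case True
    then obtain a where "PX a q" "row a < row q" using horizontal.IH by blast
    moreover have "col q < col e" using True D(4) unfolding d'_def by (auto split: if_splits)
    ultimately have "e \<in> V" using V_I1[OF _ horizontal.hyps(3)] D(3) by simp
    then show ?thesis using V_layer by blast
  next
    case False
    then have pot: "potential e d' < potential q d" "potential q d \<le> 4 * k + 2"
      using horizontal.hyps(2) le D unfolding d'_def by (auto split: if_splits)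
    have "e \<in> layer (Suc (4 * k + 2 - potential q d))" using horizontal.IH horizontal.hyps(3) by auto
    moreover have "Suc (4 * k + 2 - potential q d) \<le> 4 * k + 2 - potential e d'" using pot by linarith
    ultimately show ?thesis using layer_mono by blast
  qed
  then show ?case using horizontal.hyps(3) unfolding d'_def by auto
qed

lemma Q_layer: "QX \<union> QY \<subseteq> layer (4 * k + 2)"
  unfolding QX_def QY_def using reach_layer layer_mono[OF diff_le_self] by blast

lemma Q_in_P: "QX \<union> QY \<subseteq> P"
proof -
  have "p \<in> P" if "reach p d" for p d
    using that by cases (auto simp: V_def turn1_def turn2_def dest: PXD PYD)
  then show ?thesis unfolding QX_def QY_def by blast
qed

text \<open>The \<open>Suc\<close> puts the line directly after the point, which stays on the
  smaller side.\<close>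

definition XC :: "nat set" where "XC = (\<lambda>q. Suc (x q)) ` QX"
definition YC :: "nat set" where "YC = (\<lambda>q. Suc (y q)) ` QY"

lemma card_cuts:
  "finite XC \<and> card XC \<le> 3 * Suc k ^ 4 * (2 * k + 3) ^ (4 * k + 2)"
  "finite YC \<and> card YC \<le> 3 * Suc k ^ 4 * (2 * k + 3) ^ (4 * k + 2)"
proof -
  have l: "finite (layer (4 * k + 2))" "card (layer (4 * k + 2)) \<le> 3 * Suc k ^ 4 * (2 * k + 3) ^ (4 * k + 2)"
    using card_layer by blast+
  have *: "finite (f ` Q) \<and> card (f ` Q) \<le> 3 * Suc k ^ 4 * (2 * k + 3) ^ (4 * k + 2)"
    if "Q \<subseteq> QX \<union> QY" for Q and f :: "'a \<Rightarrow> nat"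
  proof -
    have Q: "Q \<subseteq> layer (4 * k + 2)" using that Q_layer by (rule order_trans)
    then have fin: "finite Q" using l(1) by (rule finite_subset)
    have "card (f ` Q) \<le> card Q" by (rule card_image_le[OF fin])
    also have "\<dots> \<le> card (layer (4 * k + 2))" by (rule card_mono[OF l(1) Q])
    finally show ?thesis using l(2) fin by simp
  qed
  show "finite XC \<and> card XC \<le> 3 * Suc k ^ 4 * (2 * k + 3) ^ (4 * k + 2)" unfolding XC_def by (rule *) blast
  show "finite YC \<and> card YC \<le> 3 * Suc k ^ 4 * (2 * k + 3) ^ (4 * k + 2)" unfolding YC_def by (rule *) blast
qed

lemma separated_XC: "x p < x q \<Longrightarrow> separated XC x p q \<longleftrightarrow> (\<exists>r\<in>QX. x p \<le> x r \<and> x r < x q)"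
  unfolding separated_def XC_def by (auto simp: less_Suc_eq_le)

lemma separated_YC: "y p < y q \<Longrightarrow> separated YC y p q \<longleftrightarrow> (\<exists>r\<in>QY. y p \<le> y r \<and> y r < y q)"
  unfolding separated_def YC_def by (auto simp: less_Suc_eq_le)

text \<open>Each vertical line that separates two points of a cell is matched by a horizontal one at
  the corresponding place: after the same point, after the point it was projected from, or after its
  projection to the cell. The converse is symmetric.\<close>

lemma coherent:
  assumes p: "p \<in> P" and q: "q \<in> P" and cell: "col p = col q" "row p = row q" and lt: "x p < x q"
  shows "separated XC x p q \<longleftrightarrow> separated YC y p q"
proof
  have ylt: "y p < y q" using cell_less[OF p q cell] lt by blast
  {
    assume "separated XC x p q"
    then obtain r where r: "r \<in> QX" "x p \<le> x r" "x r < x q" using separated_XC[OF lt] by blast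
    have rP: "r \<in> P" using r(1) Q_in_P by blast
    have cr: "col r = col p" using col_mono[OF p rP r(2)] col_mono[OF rP q] r(3) cell by simp
    have "\<exists>s\<in>QY. y p \<le> y s \<and> y s < y q"
    proof (cases "row r = row p")
      case True
      have yr: "y p \<le> y r" "y r < y q"
        using cell_le[OF p rP] cell_less[OF rP q] cr True cell r by simp_all
      from QX_cases[OF r(1)] show ?thesis
      proof
        assume "\<exists>s\<in>QY. PY s r"
        then obtain s where s: "s \<in> QY" "PY s r" by blast
        have "y s < y q" using PYD(6)[OF s(2) q] cr True cell yr by simp
        then show ?thesis using s(1) PYD(5)[OF s(2)] yr(1) by (meson less_imp_le order_trans)
      qed (use yr in blast)
    next
      case False
      then have "x p < x r" using r(2) points_neq(1)[OF points p rP] by (metis le_neq_implies_less)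
      then obtain e where e: "PX r e" "col e = col p" "row e = row p" "y p \<le> y e" "e \<in> P"
        using ex_PX[OF rP p cr False] by metis
      have "x e < x q" using PXD(5)[OF e(1)] r(3) by simp
      then have "y e < y q" using cell_less[OF e(5) q] e cell by simp
      then show ?thesis using QX_step[OF r(1) e(1)] e(4) by blast
    qed
    then show "separated YC y p q" using separated_YC[OF ylt] by blast
  next
    assume "separated YC y p q"
    then obtain r where r: "r \<in> QY" "y p \<le> y r" "y r < y q" using separated_YC[OF ylt] by blast
    have rP: "r \<in> P" using r(1) Q_in_P by blast
    have cr: "row r = row p" using row_mono[OF p rP r(2)] row_mono[OF rP q] r(3) cell by simp
    have "\<exists>s\<in>QX. x p \<le> x s \<and> x s < x q"
    proof (cases "col r = col p")
      case True
      have xr: "x p \<le> x r" "x r < x q"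
        using cell_le[OF p rP] cell_less[OF rP q] cr True cell r by simp_all
      from QY_cases[OF r(1)] show ?thesis
      proof
        assume "\<exists>s\<in>QX. PX s r"
        then obtain s where s: "s \<in> QX" "PX s r" by blast
        have "x s < x q" using PXD(6)[OF s(2) q] cr True cell xr by simp
        then show ?thesis using s(1) PXD(5)[OF s(2)] xr(1) by (meson less_imp_le order_trans)
      qed (use xr in blast)
    next
      case False
      then have "y p < y r" using r(2) points_neq(2)[OF points p rP] by (metis le_neq_implies_less)
      then obtain e where e: "PY r e" "col e = col p" "row e = row p" "x p \<le> x e" "e \<in> P"
        using ex_PY[OF rP p cr False] by metis
      have "y e < y q" using PYD(5)[OF e(1)] r(3) by simp
      then have "x e < x q" using cell_less[OF e(5) q] e cell by simp
      then show ?thesis using QY_step[OF r(1) e(1)] e(4) by blast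
    qed
    then show "separated XC x p q" using separated_XC[OF lt] by blast
  }
qed

text \<open>Projecting \<open>a\<close> to the cell of \<open>b\<close> and on to the cell of
  \<open>c\<close> yields the end \<open>v\<close> of a turn. Its horizontal line separates
  \<open>c\<close> from \<open>b\<close> unless \<open>v\<close> is above \<open>b\<close>; in that
  case projecting \<open>v\<close> back to the cell of \<open>b\<close> gives a point of
  \<open>QX\<close> whose vertical line separates \<open>b\<close> from \<open>a\<close>.\<close>

lemma corner1:
  assumes P: "a \<in> P" "b \<in> P" "c \<in> P"
    and a: "col a = col b" "\<not> separated XC x b a" "row a < row b" "x b < x a"
    and c: "row c = row b" "\<not> separated YC y c b" "col b < col c" "y c < y b"
  shows False
proof -
  obtain m where m: "PX a m" "col m = col b" "row m = row b" "x b \<le> x m" "y b \<le> y m" "m \<in> P"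
    using ex_PX[OF P(1,2) a(1) _ a(4)] a(3) by (metis less_irrefl)
  have "row m = row c" "col m \<noteq> col c" "y c < y m" using m c by simp_all
  then obtain v where v: "PY m v" "col v = col c" "row v = row c" "y c \<le> y v" "v \<in> P"
    using ex_PY[OF m(6) P(3)] by metis
  have vV: "v \<in> V" by (rule V_I1[OF m(1) v(1)]) (use m v a c in simp_all)
  have "\<not> (y c \<le> y v \<and> y v < y b)" using c(2) separated_YC[OF c(4)] V_QY[OF vV] by blast
  moreover have "v \<noteq> b" using v(2) c(3) by auto
  then have "y v \<noteq> y b" by (rule points_neq(2)[OF points v(5) P(2)])
  ultimately have bv: "y b < y v" using v(4) by simp
  have "row v = row b" "col v \<noteq> col b" using v c by simp_all
  then obtain e where e: "PY v e" "col e = col b" "row e = row b" "x b \<le> x e" "e \<in> P"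
    using ex_PY[OF v(5) P(2) _ _ bv] by metis
  have "y e < y m" using PYD(5)[OF e(1)] PYD(5)[OF v(1)] by simp
  then have "x e < x m" using cell_less[OF e(5) m(6)] e m by simp
  then have "x e < x a" using PXD(5)[OF m(1)] by simp
  then show False
    using a(2) separated_XC[OF a(4)] QY_step[OF V_QY[OF vV] e(1)] e(4) by blast
qed

text \<open>The same argument, starting from \<open>c\<close> and going over the cell of
  \<open>b\<close> to that of \<open>a\<close>, with a turn of the second kind.\<close>

lemma corner2:
  assumes P: "a \<in> P" "b \<in> P" "c \<in> P"
    and a: "col a = col b" "\<not> separated XC x a b" "row a < row b" "x a < x b"
    and c: "row c = row b" "\<not> separated YC y b c" "col b < col c" "y b < y c"
  shows False
proof -
  obtain m where m: "PY c m" "col m = col b" "row m = row b" "x b \<le> x m" "y b \<le> y m" "m \<in> P"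
    using ex_PY[OF P(3,2) c(1) _ c(4)] c(3) by (metis less_irrefl)
  have "col m = col a" "row m \<noteq> row a" "x a < x m" using m a by simp_all
  then obtain v where v: "PX m v" "col v = col a" "row v = row a" "x a \<le> x v" "v \<in> P"
    using ex_PX[OF m(6) P(1)] by metis
  have vV: "v \<in> V" by (rule V_I2[OF m(1) v(1)]) (use m v a c in simp_all)
  have "\<not> (x a \<le> x v \<and> x v < x b)" using a(2) separated_XC[OF a(4)] V_QX[OF vV] by blast
  moreover have "v \<noteq> b" using v(3) a(3) by auto
  then have "x v \<noteq> x b" by (rule points_neq(1)[OF points v(5) P(2)])
  ultimately have bv: "x b < x v" using v(4) by simp
  have "col v = col b" "row v \<noteq> row b" using v a by simp_all
  then obtain e where e: "PX v e" "col e = col b" "row e = row b" "y b \<le> y e" "e \<in> P"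
    using ex_PX[OF v(5) P(2) _ _ bv] by metis
  have "x e < x m" using PXD(5)[OF e(1)] PXD(5)[OF v(1)] by simp
  then have "y e < y m" using cell_less[OF e(5) m(6)] e m by simp
  then have "y e < y c" using PYD(5)[OF m(1)] by simp
  then show False
    using c(2) separated_YC[OF c(4)] QX_step[OF V_QX[OF vV] e(1)] e(4) by blast
qed

end

section \<open>The refined gridding and its acyclicity\<close>

definition lines_upto :: "nat set \<Rightarrow> nat \<Rightarrow> nat" where
  "lines_upto X v = card {c \<in> X. c \<le> v}"

lemma lines_upto_mono: "finite X \<Longrightarrow> v \<le> w \<Longrightarrow> lines_upto X v \<le> lines_upto X w"
  unfolding lines_upto_def by (intro card_mono) auto

lemma lines_upto_le: "finite X \<Longrightarrow> lines_upto X v \<le> card X"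
  unfolding lines_upto_def by (intro card_mono) auto

lemma lines_upto_eq_iff:
  assumes "finite X"
  shows "lines_upto X (x p) = lines_upto X (x q) \<longleftrightarrow> \<not> separated X x p q"
proof -
  have *: "lines_upto X v = lines_upto X w \<longleftrightarrow> \<not> (\<exists>c\<in>X. v < c \<and> c \<le> w)" if "v \<le> w" for v w
  proof
    assume "lines_upto X v = lines_upto X w"
    then have "{c \<in> X. c \<le> v} = {c \<in> X. c \<le> w}"
      unfolding lines_upto_def using assms \<open>v \<le> w\<close> by (intro card_subset_eq) auto
    then show "\<not> (\<exists>c\<in>X. v < c \<and> c \<le> w)" by (metis (mono_tags, lifting) mem_Collect_eq not_less)
  next
    assume "\<not> (\<exists>c\<in>X. v < c \<and> c \<le> w)"
    then have "{c \<in> X. c \<le> v} = {c \<in> X. c \<le> w}" using \<open>v \<le> w\<close> by force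
    then show "lines_upto X v = lines_upto X w" unfolding lines_upto_def by simp
  qed
  show ?thesis
  proof (cases "x p \<le> x q")
    case True
    then show ?thesis using *[of "x p" "x q"] unfolding separated_def by force
  next
    case False
    then show ?thesis using *[of "x q" "x p"] unfolding separated_def by force
  qed
qed

lemma separated_sym: "separated X x p q \<longleftrightarrow> separated X x q p"
  unfolding separated_def by blast

context monotone_gridding
begin

definition col' :: "'a \<Rightarrow> nat" where "col' p = col p * Suc (card XC) + lines_upto XC (x p)"
definition row' :: "'a \<Rightarrow> nat" where "row' p = row p * Suc (card YC) + lines_upto YC (y p)"

lemma fin_cuts: "finite XC" "finite YC"
  using card_cuts by blast+

lemma col'_eq: "col' p = col' q \<longleftrightarrow> col p = col q \<and> \<not> separated XC x p q"
  and row'_eq: "row' p = row' q \<longleftrightarrow> row p = row q \<and> \<not> separated YC y p q"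
proof -
  have l: "lines_upto XC v < Suc (card XC)" "lines_upto YC v < Suc (card YC)" for v
    using lines_upto_le fin_cuts by (simp_all add: less_Suc_eq_le)
  have *: "a * B + i = b * B + j \<longleftrightarrow> a = b \<and> i = j" if "i < B" "j < B" for a b i j B :: nat
    using lex_key_less[OF that, of a b] lex_key_less[OF that(2,1), of b a] by (metis linorder_neqE_nat less_irrefl)
  show "col' p = col' q \<longleftrightarrow> col p = col q \<and> \<not> separated XC x p q"
    unfolding col'_def *[OF l(1) l(1)] lines_upto_eq_iff[OF fin_cuts(1)] ..
  show "row' p = row' q \<longleftrightarrow> row p = row q \<and> \<not> separated YC y p q"
    unfolding row'_def *[OF l(2) l(2)] lines_upto_eq_iff[OF fin_cuts(2)] ..
qed

lemma col'_mono: "p \<in> P \<Longrightarrow> q \<in> P \<Longrightarrow> x p \<le> x q \<Longrightarrow> col' p \<le> col' q"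
  unfolding col'_def by (intro add_mono mult_right_mono col_mono lines_upto_mono fin_cuts) auto

lemma row'_mono: "p \<in> P \<Longrightarrow> q \<in> P \<Longrightarrow> y p \<le> y q \<Longrightarrow> row' p \<le> row' q"
  unfolding row'_def by (intro add_mono mult_right_mono row_mono lines_upto_mono fin_cuts) auto

lemma refined_bound:
  assumes "p \<in> P"
  shows "col' p < Suc k * Suc (3 * Suc k ^ 4 * (2 * k + 3) ^ (4 * k + 2))"
    "row' p < Suc k * Suc (3 * Suc k ^ 4 * (2 * k + 3) ^ (4 * k + 2))"
proof -
  have *: "a * Suc m + i < Suc k * Suc M" if "a \<le> k" "i \<le> m" "m \<le> M" for a i m M :: nat
  proof -
    have "a * Suc m + i < Suc a * Suc m" using that by simp
    also have "\<dots> \<le> Suc k * Suc M" using that by (intro mult_mono) auto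
    finally show ?thesis .
  qed
  show "col' p < Suc k * Suc (3 * Suc k ^ 4 * (2 * k + 3) ^ (4 * k + 2))"
    unfolding col'_def using card_cuts(1) col_le[OF assms] lines_upto_le by (intro *) auto
  show "row' p < Suc k * Suc (3 * Suc k ^ 4 * (2 * k + 3) ^ (4 * k + 2))"
    unfolding row'_def using card_cuts(2) row_le[OF assms] lines_upto_le by (intro *) auto
qed

text \<open>
  In the topmost row met by a shortest cycle, the leftmost point has one neighbour below it in
  its column and the other one to the right of it in its row.
\<close>
lemma refined_acyclic: "acyclic (grid_rel P x y col' row')"
proof (rule ccontr)
  define R where "R = grid_rel P x y col' row'"
  assume "\<not> acyclic (grid_rel P x y col' row')"
  then obtain p0 where "(p0, p0) \<in> R\<^sup>+" unfolding R_def acyclic_def by blast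
  then have ex: "\<exists>n. 0 < n \<and> (\<exists>p. (p, p) \<in> R ^^ n)" unfolding trancl_power by blast
  define n where "n = (LEAST n. 0 < n \<and> (\<exists>p. (p, p) \<in> R ^^ n))"
  have n: "0 < n" "\<exists>p. (p, p) \<in> R ^^ n" using LeastI_ex[OF ex] unfolding n_def by auto
  have short: "(p, p) \<notin> R ^^ m" if "0 < m" "m < n" for m p
    using that not_less_Least[of m "\<lambda>n. 0 < n \<and> (\<exists>p. (p, p) \<in> R ^^ n)"] unfolding n_def by blast
  define M where "M = {p. (p, p) \<in> R ^^ n}"
  have RP: "u \<in> P" "v \<in> P" if "(u, v) \<in> R" for u v using that unfolding R_def grid_rel_def by auto
  have MP: "M \<subseteq> P"
  proof
    fix p assume "p \<in> M"
    then have "(p, p) \<in> R ^^ Suc (n - 1)" using n(1) unfolding M_def by simp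
    then obtain q where "(p, q) \<in> R" using relpow_Suc_D2 by metis
    then show "p \<in> P" by (rule RP)
  qed
  obtain p1 where "p1 \<in> M" using n(2) unfolding M_def by blast
  then obtain b1 where b1: "b1 \<in> M" "\<And>p. p \<in> M \<Longrightarrow> row' p \<le> row' b1"
    using ex_max_nat[OF finite_subset[OF MP finP], of p1 row'] by blast
  obtain b where b: "b \<in> M" "row' b = row' b1" "\<And>p. p \<in> M \<Longrightarrow> row' p = row' b1 \<Longrightarrow> col' b \<le> col' p"
    using ex_has_least_nat[of "\<lambda>p. p \<in> M \<and> row' p = row' b1" b1 col'] b1(1) by auto
  have row_max: "row' p \<le> row' b" if "p \<in> M" for p using b1(2)[OF that] b(2) by simp
  have col_min: "col' b \<le> col' p" if "p \<in> M" "row' p = row' b" for p using b(3)[OF that(1)] that(2) b(2) by simp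
  have irr: "(p, p) \<notin> R" for p unfolding R_def grid_rel_def by auto
  have "n \<noteq> 1" using b(1) irr unfolding M_def by auto
  then obtain j where j: "n = Suc (Suc j)" using n(1) by (metis One_nat_def gr0_implies_Suc not0_implies_Suc)
  obtain q where q: "(b, q) \<in> R" "(q, b) \<in> R ^^ Suc j"
    using b(1) relpow_Suc_D2[of b b "Suc j" R] unfolding M_def j by blast
  obtain p where p: "(q, p) \<in> R ^^ j" "(p, b) \<in> R" using q(2) by (rule relpow_Suc_E)
  have qM: "q \<in> M" unfolding M_def j using relpow_Suc_I[OF q(2,1)] by simp
  have pM: "p \<in> M" unfolding M_def j using relpow_Suc_I2[OF p(2) relpow_Suc_I2[OF q(1) p(1)]] by simp
  \<comment> \<open>A relation from \<open>p\<close> to \<open>q\<close> would bypass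
    \<open>b\<close> and shorten the cycle.\<close>
  have npq: "(p, q) \<notin> R"
    using short[of "Suc j" q] relpow_Suc_I[OF p(1), of q] unfolding j by auto
  have P: "p \<in> P" "q \<in> P" "b \<in> P" using RP q(1) p(2) by blast+
  define C W where "C u v \<longleftrightarrow> col' u = col' v \<and> x u < x v" and "W u v \<longleftrightarrow> row' u = row' v \<and> y u < y v" for u v
  have R_iff: "(u, v) \<in> R \<longleftrightarrow> C u v \<or> W u v" if "u \<in> P" "v \<in> P" for u v
    using that unfolding R_def grid_rel_def C_def W_def by blast
  have CW: "C p b \<or> W p b" "C b q \<or> W b q" using R_iff P p(2) q(1) by blast+
  have notCC: "\<not> (C p b \<and> C b q)" using npq R_iff[OF P(1,2)] unfolding C_def by auto
  have notWW: "\<not> (W p b \<and> W b q)" using npq R_iff[OF P(1,2)] unfolding W_def by auto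
  have same_cell: "C u v \<longleftrightarrow> W u v" if "col' u = col' v" "row' u = row' v" "u \<in> P" "v \<in> P" for u v
    using that cell_less[OF that(3,4)] unfolding C_def W_def col'_eq row'_eq by blast
  \<comment> \<open>The corner lemmas speak of the old rows and columns. By \<open>coherent\<close>,
    a point in the refined column of \<open>b\<close> but in another refined row cannot lie in the
    same old row.\<close>
  have lower: "row u < row b" if "u \<in> P" "col' u = col' b" "row' u < row' b" for u
  proof -
    have "y u < y b" using row'_mono[OF P(3) that(1)] that(3) by (meson not_less)
    then have "row u \<le> row b" using row_mono[OF that(1) P(3)] by simp
    moreover have "row u \<noteq> row b"
    proof
      assume e: "row u = row b"
      have c: "col u = col b" "\<not> separated XC x u b" using that(2) unfolding col'_eq by auto
      have "x u < x b" using cell_less[OF that(1) P(3) c(1) e] \<open>y u < y b\<close> by blast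
      then have "\<not> separated YC y u b" using coherent[OF that(1) P(3) c(1) e] c(2) by blast
      then show False using that(3) e row'_eq[of u b] by simp
    qed
    ultimately show ?thesis by simp
  qed
  have righter: "col b < col u" if "u \<in> P" "row' u = row' b" "col' b < col' u" for u
  proof -
    have "x b < x u" using col'_mono[OF that(1) P(3)] that(3) by (meson not_less)
    then have "col b \<le> col u" using col_mono[OF P(3) that(1)] by simp
    moreover have "col b \<noteq> col u"
    proof
      assume e: "col b = col u"
      have c: "row b = row u" "\<not> separated YC y b u"
        using that(2) separated_sym[of YC y b u] unfolding row'_eq by auto
      then have "\<not> separated XC x b u" using coherent[OF P(3) that(1) e c(1) \<open>x b < x u\<close>] by blast
      then show False using that(3) e col'_eq[of b u] by simp
    qed
    ultimately show ?thesis by simp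
  qed
  consider "C p b" "W b q" | "W p b" "C b q" using CW notCC notWW by blast
  then show False
  proof cases
    case 1
    have r: "row' p \<noteq> row' b"
    proof
      assume "row' p = row' b"
      moreover from this have "col' p = col' b" using 1(1) unfolding C_def by simp
      ultimately have "C p b \<longleftrightarrow> W p b" using same_cell P(1,3) by blast
      then show False using 1 notWW by blast
    qed
    have c: "col' q \<noteq> col' b"
    proof
      assume "col' q = col' b"
      then have "row' b = row' q" "col' b = col' q" using 1(2) unfolding W_def by simp_all
      then have "C b q \<longleftrightarrow> W b q" using same_cell P(2,3) by blast
      then show False using 1 notCC by blast
    qed
    have e: "col' p = col' b" "row' q = row' b" using 1 unfolding C_def W_def by simp_all
    have "row p < row b" by (rule lower[OF P(1) e(1)]) (use r row_max[OF pM] in simp)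
    moreover have "col b < col q" by (rule righter[OF P(2) e(2)]) (use c col_min[OF qM e(2)] in simp)
    moreover have "col p = col b \<and> \<not> separated XC x p b" using e(1) unfolding col'_eq .
    moreover have "row q = row b \<and> \<not> separated YC y b q"
      using e(2) unfolding row'_eq separated_sym[of YC y q b] .
    moreover have "x p < x b" "y b < y q" using 1 unfolding C_def W_def by simp_all
    ultimately show False using corner2[OF P(1,3,2)] by blast
  next
    case 2
    have r: "row' q \<noteq> row' b"
    proof
      assume "row' q = row' b"
      then have "row' b = row' q" "col' b = col' q" using 2(2) unfolding C_def by simp_all
      then have "C b q \<longleftrightarrow> W b q" using same_cell P(2,3) by blast
      then show False using 2 notWW by blast
    qed
    have c: "col' p \<noteq> col' b"
    proof
      assume "col' p = col' b"
      moreover from this have "row' p = row' b" using 2(1) unfolding W_def by simp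
      ultimately have "C p b \<longleftrightarrow> W p b" using same_cell P(1,3) by blast
      then show False using 2 notCC by blast
    qed
    have e: "col' q = col' b" "row' p = row' b" using 2 unfolding C_def W_def by simp_all
    have "row q < row b" by (rule lower[OF P(2) e(1)]) (use r row_max[OF qM] in simp)
    moreover have "col b < col p" by (rule righter[OF P(1) e(2)]) (use c col_min[OF pM e(2)] in simp)
    moreover have "col q = col b \<and> \<not> separated XC x b q"
      using e(1) unfolding col'_eq separated_sym[of XC x q b] .
    moreover have "row p = row b \<and> \<not> separated YC y p b" using e(2) unfolding row'_eq .
    moreover have "x b < x q" "y p < y b" using 2 unfolding C_def W_def by simp_all
    ultimately show False using corner1[OF P(2,3,1)] by blast
  qed
qed

end

text \<open>The bound of \<open>refined_bound\<close> for \<open>k = line_bound l l\<close>. What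
  matters is that it does not depend on the point set.\<close>

definition grid_bound :: "nat \<Rightarrow> nat" where
  "grid_bound l = Suc (line_bound l l) *
     Suc (3 * Suc (line_bound l l) ^ 4 * (2 * line_bound l l + 3) ^ (4 * line_bound l l + 2))"

theorem ex_good_gridding:
  assumes P: "points P x y" "P5_free P x y" "cliques_le l P x y" "simple P x y"
  shows "\<exists>col row. good_gridding P x y col row \<and> (\<forall>p\<in>P. col p < grid_bound l \<and> row p < grid_bound l)"
proof -
  have "boxlike P x y P" unfolding boxlike_def by blast
  then obtain X Y where XY: "finite X" "finite Y" "card X \<le> line_bound l l" "card Y \<le> line_bound l l"
    "\<And>p q. p \<in> P \<Longrightarrow> q \<in> P \<Longrightarrow> adj x y p q \<Longrightarrow> separated X x p q \<or> separated Y y p q"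
    using inversion_lines[OF P _ P(3)] by metis
  interpret monotone_gridding P x y "\<lambda>p. lines_upto X (x p)" "\<lambda>p. lines_upto Y (y p)" "line_bound l l"
  proof
    show "points P x y" "P5_free P x y" by (rule P)+
    show "lines_upto X (x p) \<le> lines_upto X (x q)" if "x p \<le> x q" for p q
      by (rule lines_upto_mono[OF XY(1) that])
    show "lines_upto Y (y p) \<le> lines_upto Y (y q)" if "y p \<le> y q" for p q
      by (rule lines_upto_mono[OF XY(2) that])
    show "lines_upto X (x p) \<le> line_bound l l" "lines_upto Y (y p) \<le> line_bound l l" for p
      using lines_upto_le[OF XY(1)] lines_upto_le[OF XY(2)] XY(3,4) by (meson order_trans)+
    show "\<not> adj x y p q" if "p \<in> P" "q \<in> P" "lines_upto X (x p) = lines_upto X (x q)"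
        "lines_upto Y (y p) = lines_upto Y (y q)" for p q
      using XY(5)[OF that(1,2)] that(3,4) unfolding lines_upto_eq_iff[OF XY(1)] lines_upto_eq_iff[OF XY(2)]
      by blast
  qed
  have "good_gridding P x y col' row'"
    unfolding good_gridding_def using refined_acyclic col'_mono row'_mono by simp
  then show ?thesis using refined_bound unfolding grid_bound_def by blast
qed

section \<open>Forbidden patterns and the inversion graph\<close>

lemma contains_of_points:
  assumes sh: "shape \<pi> P x y" and \<sigma>: "is_perm \<sigma>" and ps: "set ps \<subseteq> P" "length ps = length \<sigma>"
    and "\<And>i j. i < length \<sigma> \<Longrightarrow> j < length \<sigma> \<Longrightarrow>
      (i < j \<longleftrightarrow> x (ps ! i) < x (ps ! j)) \<and> (\<sigma> ! i < \<sigma> ! j \<longleftrightarrow> y (ps ! i) < y (ps ! j))"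
  shows "contains_pattern \<pi> \<sigma>"
proof (rule shape_embeds_contains[OF sh shape_self[OF \<sigma>]])
  show "embeds (nth ps) {..<length \<sigma>} (\<lambda>i. i) (nth \<sigma>) P x y"
    unfolding embeds_def using assms by (auto dest: nth_mem)
qed

text \<open>The missing edges force the edges of the path to lead alternately to the left and to the
  right, so the pattern is determined by the direction of the first edge and the order of
  \<open>a\<close> and \<open>c\<close>. The four cases are the two directions of traversing the
  path in each forbidden permutation.\<close>

lemma P5_free_shape:
  assumes sh: "shape \<pi> P x y" and P: "points P x y"
    and av: "\<not> contains_pattern \<pi> [2, 4, 1, 5, 3]" "\<not> contains_pattern \<pi> [3, 1, 5, 2, 4]"
  shows "P5_free P x y"
proof -
  have perms: "is_perm [2, 4, 1, 5, 3]" "is_perm [3, 1, 5, 2, 4]" by (auto simp: is_perm_iff)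
  have A: False if "{a, b, c, d, e} \<subseteq> P" "x a < x b" "x b < x c" "x c < x d" "x d < x e"
    "y c < y a" "y a < y e" "y e < y b" "y b < y d" for a b c d e
    using av(1)
    by (rule notE, intro contains_of_points[OF sh perms(1), of "[a, b, c, d, e]"])
      (use that in \<open>auto simp: less_Suc_eq\<close>)
  have B: False if "{a, b, c, d, e} \<subseteq> P" "x a < x b" "x b < x c" "x c < x d" "x d < x e"
    "y b < y d" "y d < y a" "y a < y e" "y e < y c" for a b c d e
    using av(2)
    by (rule notE, intro contains_of_points[OF sh perms(2), of "[a, b, c, d, e]"])
      (use that in \<open>auto simp: less_Suc_eq\<close>)
  have False if p: "a \<in> P" "b \<in> P" "c \<in> P" "d \<in> P" "e \<in> P"
    and E: "adj x y a b" "adj x y b c" "adj x y c d" "adj x y d e"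
    and N: "\<not> adj x y a c" "\<not> adj x y a d" "\<not> adj x y a e" "\<not> adj x y b d" "\<not> adj x y b e" "\<not> adj x y c e"
    for a b c d e
  proof -
    have ne: "a \<noteq> c" "a \<noteq> d" "a \<noteq> e" "b \<noteq> d" "b \<noteq> e" "c \<noteq> e" using E N adj_sym by metis+
    have nx: "x a \<noteq> x c" "x a \<noteq> x d" "x a \<noteq> x e" "x b \<noteq> x d" "x b \<noteq> x e" "x c \<noteq> x e"
      using points_neq(1)[OF P] p ne by blast+
    have ny: "y a \<noteq> y c" "y a \<noteq> y d" "y a \<noteq> y e" "y b \<noteq> y d" "y b \<noteq> y e" "y c \<noteq> y e"
      using points_neq(2)[OF P] p ne by blast+
    have sub: "{a, c, b, e, d} \<subseteq> P" "{e, c, d, a, b} \<subseteq> P" "{d, e, b, c, a} \<subseteq> P" "{b, a, d, c, e} \<subseteq> P"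
      using p by auto
    from E(1) consider "x a < x b" "y b < y a" | "x b < x a" "y a < y b" unfolding adj_iff by blast
    then show False
    proof cases
      case 1
      have c: "x c < x b" "y b < y c" using E(2) N(1) nx(1) ny(1) 1 unfolding adj_iff by linarith+
      have d: "x c < x d" "y d < y c" using E(3) N(4) nx(4) ny(4) c unfolding adj_iff by linarith+
      have e: "x e < x d" "y d < y e" using E(4) N(6) nx(6) ny(6) d unfolding adj_iff by linarith+
      show False
      proof (cases "x a < x c")
        case True
        have "y a < y c" using N(1) ny(1) True unfolding adj_iff by linarith
        moreover have "y a < y d" using N(2) ny(2) True d unfolding adj_iff by linarith
        moreover have "x b < x d" using N(4) nx(4) calculation 1 unfolding adj_iff by linarith
        moreover have "x b < x e" using N(5) nx(5) calculation 1 e unfolding adj_iff by linarith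
        moreover have "y c < y e" using N(6) ny(6) calculation c unfolding adj_iff by linarith
        ultimately show False using A[OF sub(1)] True c d e 1 by blast
      next
        case False
        then have ca: "x c < x a" using nx(1) by simp
        have "y c < y a" using N(1) ny(1) ca unfolding adj_iff by linarith
        moreover have "y b < y a" using 1 by simp
        moreover have "x d < x a" using N(2) nx(2) calculation d unfolding adj_iff by linarith
        moreover have "y d < y b" using N(4) ny(4) calculation 1 unfolding adj_iff by linarith
        moreover have "y e < y b" using N(5) ny(5) calculation 1 e unfolding adj_iff by linarith
        moreover have "x e < x c" using N(6) nx(6) calculation c unfolding adj_iff by linarith
        ultimately show False using A[OF sub(2)] ca c d e 1 by blast
      qed
    next
      case 2
      have c: "x b < x c" "y c < y b" using E(2) N(1) nx(1) ny(1) 2 unfolding adj_iff by linarith+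
      have d: "x d < x c" "y c < y d" using E(3) N(4) nx(4) ny(4) c unfolding adj_iff by linarith+
      have e: "x d < x e" "y e < y d" using E(4) N(6) nx(6) ny(6) d unfolding adj_iff by linarith+
      show False
      proof (cases "x c < x a")
        case True
        have "y c < y a" using N(1) ny(1) True unfolding adj_iff by linarith
        moreover have "x d < x a" using True d by simp
        moreover have "y d < y a" using N(2) ny(2) calculation unfolding adj_iff by linarith
        moreover have "y d < y b" using calculation 2 by simp
        moreover have "x d < x b" using N(4) nx(4) calculation unfolding adj_iff by linarith
        moreover have "x e < x b" using N(5) nx(5) calculation e unfolding adj_iff by linarith
        moreover have "y e < y c" using N(6) ny(6) calculation c unfolding adj_iff by linarith
        ultimately show False using B[OF sub(3)] True c d e 2 by blast
      next
        case False
        then have ac: "x a < x c" using nx(1) by simp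
        have "y a < y c" using N(1) ny(1) ac unfolding adj_iff by linarith
        moreover have "y a < y d" using calculation d by simp
        moreover have "x a < x d" using N(2) nx(2) calculation unfolding adj_iff by linarith
        moreover have "x b < x d" using calculation 2 by simp
        moreover have "y b < y d" using N(4) ny(4) calculation unfolding adj_iff by linarith
        moreover have "y b < y e" using N(5) ny(5) calculation e unfolding adj_iff by linarith
        moreover have "x c < x e" using N(6) nx(6) calculation c unfolding adj_iff by linarith
        ultimately show False using B[OF sub(4)] ac c d e 2 by blast
      qed
    qed
  qed
  then show ?thesis unfolding P5_free_def by blast
qed

lemma decreasing_perm_nth: "i < l \<Longrightarrow> decreasing_perm l ! i = l - i"
  unfolding decreasing_perm_def by (simp add: rev_nth del: upt_Suc)

lemma length_decreasing_perm [simp]: "length (decreasing_perm l) = l"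
  unfolding decreasing_perm_def by simp

lemma is_perm_decreasing_perm: "is_perm (decreasing_perm l)"
  unfolding is_perm_iff by (auto simp: decreasing_perm_def simp del: upt_Suc)

lemma contains_decreasing_iff:
  assumes sh: "shape \<pi> P x y" and P: "points P x y"
  shows "contains_pattern \<pi> (decreasing_perm l) \<longleftrightarrow> (\<exists>A\<subseteq>P. clique x y A \<and> card A = l)"
proof
  assume "contains_pattern \<pi> (decreasing_perm l)"
  then obtain f where f: "embeds f {..<l} (\<lambda>i. i) (nth (decreasing_perm l)) P x y"
    using shape_contains_embeds[OF sh shape_self[OF is_perm_decreasing_perm]] by auto
  have "inj_on f {..<l}"
    using embeds_inj[OF _ f] points_perm[OF is_perm_decreasing_perm, of l] by simp
  then have "card (f ` {..<l}) = l" by (simp add: card_image)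
  moreover have "f ` {..<l} \<subseteq> P" using f unfolding embeds_def by blast
  moreover have "clique x y (f ` {..<l})"
    unfolding clique_def
  proof (intro ballI impI)
    fix p q assume "p \<in> f ` {..<l}" "q \<in> f ` {..<l}" "p \<noteq> q"
    then obtain i j where ij: "i < l" "j < l" "p = f i" "q = f j" "i \<noteq> j" by blast
    have "(i < j \<longleftrightarrow> x (f i) < x (f j)) \<and> (decreasing_perm l ! i < decreasing_perm l ! j \<longleftrightarrow> y (f i) < y (f j))"
      "(j < i \<longleftrightarrow> x (f j) < x (f i)) \<and> (decreasing_perm l ! j < decreasing_perm l ! i \<longleftrightarrow> y (f j) < y (f i))"
      using f ij(1,2) unfolding embeds_def by simp_all
    then show "adj x y p q" using ij unfolding adj_iff by (auto simp: decreasing_perm_nth)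
  qed
  ultimately show "\<exists>A\<subseteq>P. clique x y A \<and> card A = l" by blast
next
  assume "\<exists>A\<subseteq>P. clique x y A \<and> card A = l"
  then obtain A where A: "A \<subseteq> P" "clique x y A" "card A = l" by blast
  have pA: "points A x y" by (rule points_subset[OF P A(1)])
  obtain \<sigma> where \<sigma>: "shape \<sigma> A x y" using ex_shape[OF pA] by blast
  have len: "length \<sigma> = l" using shape_length[OF \<sigma>] A(3) by simp
  have "\<sigma> = decreasing_perm l"
  proof (rule perm_eqI)
    obtain f where f: "bij_betw f {..<length \<sigma>} A" "embeds f {..<length \<sigma>} (\<lambda>i. i) (nth \<sigma>) A x y"
      using \<sigma> unfolding shape_def by blast
    fix i j assume "i < length (decreasing_perm l)" "j < length (decreasing_perm l)"
    then have ij: "i < length \<sigma>" "j < length \<sigma>" using len by simp_all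
    then have fA: "f i \<in> A" "f j \<in> A" using f(1) unfolding bij_betw_def by auto
    have e: "i < j \<longleftrightarrow> x (f i) < x (f j)" "j < i \<longleftrightarrow> x (f j) < x (f i)"
      "\<sigma> ! i < \<sigma> ! j \<longleftrightarrow> y (f i) < y (f j)" "\<sigma> ! j < \<sigma> ! i \<longleftrightarrow> y (f j) < y (f i)"
      using f(2) ij unfolding embeds_def by auto
    show "(\<sigma> ! i < \<sigma> ! j) = (decreasing_perm l ! i < decreasing_perm l ! j)"
    proof (cases "i = j")
      case False
      then have "f i \<noteq> f j" using e(1,2) by (metis less_irrefl linorder_neqE_nat)
      then have "adj x y (f i) (f j)" using A(2) fA unfolding clique_def by blast
      then show ?thesis using e ij len unfolding adj_iff by (auto simp: decreasing_perm_nth)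
    qed simp
  qed (use \<sigma> len is_perm_decreasing_perm in \<open>auto simp: shape_def\<close>)
  moreover have "embeds id A x y P x y" unfolding embeds_def using A(1) by auto
  ultimately show "contains_pattern \<pi> (decreasing_perm l)" using shape_embeds_contains[OF sh \<sigma>] by metis
qed

lemma cliques_le_iff:
  assumes "shape \<pi> P x y" "points P x y"
  shows "cliques_le k P x y \<longleftrightarrow> \<not> contains_pattern \<pi> (decreasing_perm (Suc k))"
proof -
  have "\<exists>B\<subseteq>P. clique x y B \<and> card B = Suc k" if A: "A \<subseteq> P" "clique x y A" "Suc k \<le> card A" for A
  proof -
    obtain B where "B \<subseteq> A" "card B = Suc k" using obtain_subset_with_card_n[OF A(3)] by metis
    moreover from this have "clique x y B" using A(2) unfolding clique_def by (meson subsetD)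
    ultimately show ?thesis using A(1) by (meson order_trans)
  qed
  then show ?thesis
    unfolding contains_decreasing_iff[OF assms] cliques_le_def by (metis not_less_eq_eq order_refl)
qed

section \<open>Canonical words of simple permutations\<close>

lemma embeds_grid_rel_trancl:
  assumes "embeds f P x y Q x' y'" "(p, q) \<in> (grid_rel P x y (\<lambda>p. col (f p)) (\<lambda>p. row (f p)))\<^sup>+"
  shows "(f p, f q) \<in> (grid_rel Q x' y' col row)\<^sup>+"
proof -
  have step: "(f u, f v) \<in> grid_rel Q x' y' col row"
    if "(u, v) \<in> grid_rel P x y (\<lambda>p. col (f p)) (\<lambda>p. row (f p))" for u v
    using that assms(1) unfolding grid_rel_def embeds_def by auto
  from assms(2) show ?thesis by induction (auto dest: step intro: trancl_into_trancl)
qed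

text \<open>A cycle in the embedded set would map to a cycle in the larger one. Together with
  \<open>interval_vimage\<close> this makes the conditions on marked words below hereditary.\<close>

lemma good_gridding_embeds:
  assumes "embeds f P x y Q x' y'" "good_gridding Q x' y' col row"
  shows "good_gridding P x y (\<lambda>p. col (f p)) (\<lambda>p. row (f p))"
  unfolding good_gridding_def
proof (intro conjI ballI impI)
  show "acyclic (grid_rel P x y (\<lambda>p. col (f p)) (\<lambda>p. row (f p)))"
    unfolding acyclic_def
  proof (intro allI notI)
    fix p assume "(p, p) \<in> (grid_rel P x y (\<lambda>p. col (f p)) (\<lambda>p. row (f p)))\<^sup>+"
    then have "(f p, f p) \<in> (grid_rel Q x' y' col row)\<^sup>+" by (rule embeds_grid_rel_trancl[OF assms(1)])
    then show False using assms(2) unfolding good_gridding_def acyclic_def by blast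
  qed
qed (use assms in \<open>auto simp: good_gridding_def embeds_def image_subset_iff\<close>)

lemma interval_vimage:
  assumes "embeds f P x y Q x' y'" "interval Q x' y' I"
  shows "interval P x y {p \<in> P. f p \<in> I}"
  unfolding interval_def
proof (intro conjI ballI)
  fix e assume "e \<in> P - {p \<in> P. f p \<in> I}"
  then have e: "e \<in> P" "f e \<in> Q - I" using assms(1) unfolding embeds_def by auto
  have *: "((\<forall>p\<in>I. x' (f e) < x' p) \<or> (\<forall>p\<in>I. x' p < x' (f e))) \<and>
      ((\<forall>p\<in>I. y' (f e) < y' p) \<or> (\<forall>p\<in>I. y' p < y' (f e)))"
    using assms(2) e(2) unfolding interval_def by blast
  have **: "(x e < x p \<longleftrightarrow> x' (f e) < x' (f p)) \<and> (x p < x e \<longleftrightarrow> x' (f p) < x' (f e)) \<and>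
      (y e < y p \<longleftrightarrow> y' (f e) < y' (f p)) \<and> (y p < y e \<longleftrightarrow> y' (f p) < y' (f e))" if "p \<in> P" for p
    using assms(1) e(1) that unfolding embeds_def by blast
  show "(\<forall>p\<in>{p \<in> P. f p \<in> I}. x e < x p) \<or> (\<forall>p\<in>{p \<in> P. f p \<in> I}. x p < x e)"
    "(\<forall>p\<in>{p \<in> P. f p \<in> I}. y e < y p) \<or> (\<forall>p\<in>{p \<in> P. f p \<in> I}. y p < y e)"
    using * ** by auto
qed blast

lemma simple_iso:
  assumes "bij_betw f P Q" "embeds f P x y Q x' y'" "simple P x y"
  shows "simple Q x' y'"
  unfolding simple_def
proof (intro allI impI)
  fix I assume I: "interval Q x' y' I"
  define J where "J = {p \<in> P. f p \<in> I}"
  have "interval P x y J" unfolding J_def by (rule interval_vimage[OF assms(2) I])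
  then have J: "card J \<le> 1 \<or> J = P" using assms(3) unfolding simple_def by blast
  have IQ: "I \<subseteq> Q" using I unfolding interval_def by blast
  have fJ: "f ` J = I"
  proof (intro equalityI subsetI)
    fix q assume q: "q \<in> I"
    then have "q \<in> f ` P" using IQ assms(1) unfolding bij_betw_def by blast
    then show "q \<in> f ` J" using q unfolding J_def by blast
  qed (auto simp: J_def)
  moreover have "inj_on f J" using assms(1) unfolding bij_betw_def J_def by (auto intro: inj_on_subset)
  ultimately have "card I = card J" using card_image by metis
  then show "card I \<le> 1 \<or> I = Q" using J fJ assms(1) unfolding bij_betw_def by auto
qed

lemma ex_linear_extension:
  assumes "finite Q" "acyclic R" "R \<subseteq> Q \<times> Q"
  shows "\<exists>ps. distinct ps \<and> set ps = Q \<and> sorted_wrt (\<lambda>p q. (q, p) \<notin> R) ps"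
proof -
  have wf: "wf R" using assms by (meson finite_SigmaI finite_acyclic_wf finite_subset)
  have "\<exists>ps. distinct ps \<and> set ps = A \<and> sorted_wrt (\<lambda>p q. (q, p) \<notin> R) ps" if "finite A" for A
    using that
  proof (induction "card A" arbitrary: A)
    case 0
    then show ?case by simp
  next
    case (Suc n)
    then obtain z where "z \<in> A" by fastforce
    then obtain m where m: "m \<in> A" "\<And>q. (q, m) \<in> R \<Longrightarrow> q \<notin> A" using wfE_min[OF wf] by metis
    have "card (A - {m}) = n" using Suc.hyps(2) Suc.prems m(1) by simp
    then obtain ps where "distinct ps \<and> set ps = A - {m} \<and> sorted_wrt (\<lambda>p q. (q, p) \<notin> R) ps"
      using Suc.hyps(1)[of "A - {m}"] Suc.prems by auto
    then show ?case using m by (intro exI[of _ "m # ps"]) auto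
  qed
  then show ?thesis using assms(1) by blast
qed

text \<open>\<open>lex\<close> compares lists of equal length at their first difference; the lists
  to which it is applied later all enumerate the same points.\<close>

lemma ex_lex_minimal:
  fixes f :: "'b \<Rightarrow> nat list"
  assumes "Q a"
  shows "\<exists>g. Q g \<and> (\<forall>g'. Q g' \<longrightarrow> (f g', f g) \<notin> lex less_than)"
proof -
  have "wf (inv_image (lex less_than) f)" by (intro wf_inv_image wf_lex wf_less_than)
  then obtain z where "z \<in> Collect Q" "\<And>y. (y, z) \<in> inv_image (lex less_than) f \<Longrightarrow> y \<notin> Collect Q"
    by (rule wfE_min[of _ a "Collect Q"]) (use assms in auto)
  then show ?thesis by (auto simp: in_inv_image)
qed

lemma lex_lessI:
  assumes "\<exists>u a b v w. xs = u @ a # v \<and> ys = u @ b # w \<and> (a, b) \<in> less_than" "length xs = length ys"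
  shows "(xs, ys) \<in> lex less_than"
  using assms unfolding lex_conv by blast

lemma ex_sorted_points:
  assumes "points P x y"
  shows "\<exists>L. set L = P \<and> sorted_wrt (<) (map x L)"
proof -
  have fin: "finite P" and inj: "inj_on x P" using assms unfolding points_def by auto
  define zs where "zs = sorted_list_of_set (x ` P)"
  have zs: "set zs = x ` P" "sorted_wrt (<) zs" using fin unfolding zs_def by simp_all
  have "map x (map (inv_into P x) zs) = zs"
    unfolding map_map by (rule map_idI) (simp add: zs(1) f_inv_into_f)
  moreover have "set (map (inv_into P x) zs) = P" using inj zs(1) by simp
  ultimately show ?thesis using zs(2) by metis
qed

text \<open>The letter \<open>s\<close> stands for the cell in column \<open>s div K\<close> and row \<open>s mod K\<close> of a \<open>K\<close> by \<open>K\<close> grid.\<close>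
locale grid_words =
  fixes K :: nat
begin

definition lcol :: "nat \<Rightarrow> nat" where "lcol s = s div K"
definition lrow :: "nat \<Rightarrow> nat" where "lrow s = s mod K"
definition S :: "nat set" where "S = {..<K * K}"

lemma finite_S: "finite S"
  unfolding S_def by simp

text \<open>Inside a common column or row the coordinate grows with the position, so every cell is
  increasing and the order of the letters extends \<open>grid_rel\<close>.\<close>

definition kx :: "nat list \<Rightarrow> nat \<Rightarrow> nat" where "kx w i = lcol (w ! i) * length w + i"
definition ky :: "nat list \<Rightarrow> nat \<Rightarrow> nat" where "ky w i = lrow (w ! i) * length w + i"

lemma kx_less: "i < length w \<Longrightarrow> j < length w \<Longrightarrow>
    kx w i < kx w j \<longleftrightarrow> lcol (w ! i) < lcol (w ! j) \<or> (lcol (w ! i) = lcol (w ! j) \<and> i < j)"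
  unfolding kx_def by (rule lex_key_less)

lemma ky_less: "i < length w \<Longrightarrow> j < length w \<Longrightarrow>
    ky w i < ky w j \<longleftrightarrow> lrow (w ! i) < lrow (w ! j) \<or> (lrow (w ! i) = lrow (w ! j) \<and> i < j)"
  unfolding ky_def by (rule lex_key_less)

lemma points_word: "points {..<length w} (kx w) (ky w)"
  unfolding points_def inj_on_def
proof (intro conjI ballI impI)
  fix i j assume ij: "i \<in> {..<length w}" "j \<in> {..<length w}"
  {
    assume "kx w i = kx w j"
    then have "\<not> kx w i < kx w j" "\<not> kx w j < kx w i" by simp_all
    then show "i = j" using kx_less[of i w j] kx_less[of j w i] ij by auto
  next
    assume "ky w i = ky w j"
    then have "\<not> ky w i < ky w j" "\<not> ky w j < ky w i" by simp_all
    then show "i = j" using ky_less[of i w j] ky_less[of j w i] ij by auto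
  }
qed simp

sublocale skeleton kx ky
proof
  show "inj_on (kx w) {..<length w}" "inj_on (ky w) {..<length w}" for w
    using points_word unfolding points_def by auto
  fix v w :: "nat list" and f
  assume f: "strict_mono_on {..<length v} f" "f ` {..<length v} \<subseteq> {..<length w}"
    "\<And>i. i < length v \<Longrightarrow> v ! i = w ! f i"
  have fl: "f i < length w" if "i < length v" for i using f(2) that by blast
  have fm: "f i < f j \<longleftrightarrow> i < j" if "i < length v" "j < length v" for i j
    using f(1) that unfolding strict_mono_on_def
    by (metis lessThan_iff linorder_neqE_nat order_less_asym order_less_irrefl)
  show "embeds f {..<length v} (kx v) (ky v) {..<length w} (kx w) (ky w)"
    unfolding embeds_def using f(2,3) fl fm by (auto simp: kx_less ky_less)
qed

lemma good_gridding_word: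
  "good_gridding {..<length w} (kx w) (ky w) (\<lambda>i. lcol (w ! i)) (\<lambda>i. lrow (w ! i))"
  unfolding good_gridding_def
proof (intro conjI ballI impI)
  have "grid_rel {..<length w} (kx w) (ky w) (\<lambda>i. lcol (w ! i)) (\<lambda>i. lrow (w ! i)) \<subseteq> {(i, j). i < j}"
    unfolding grid_rel_def by (auto simp: kx_less ky_less)
  moreover have "acyclic {(i, j :: nat). i < j}" by (rule wf_acyclic) (rule wf_less)
  ultimately show "acyclic (grid_rel {..<length w} (kx w) (ky w) (\<lambda>i. lcol (w ! i)) (\<lambda>i. lrow (w ! i)))"
    using acyclic_subset by blast
qed (auto simp: kx_less ky_less)

section \<open>Normal forms under the exchange of independent letters\<close>

definition indep :: "nat \<Rightarrow> nat \<Rightarrow> bool" where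
  "indep a c \<longleftrightarrow> lcol a \<noteq> lcol c \<and> lrow a \<noteq> lrow c"

lemma indep_sym: "indep a c \<longleftrightarrow> indep c a"
  unfolding indep_def by metis

text \<open>
  Independent letters commute. A word is the lexicographically least one among the words obtained
  from it by such exchanges iff it satisfies \<open>nf {}\<close>; the set \<open>F\<close> collects the letters that
  could have been moved to an earlier place.
\<close>
fun nf :: "nat set \<Rightarrow> nat list \<Rightarrow> bool" where
  "nf F [] \<longleftrightarrow> True"
| "nf F (c # w) \<longleftrightarrow> c \<notin> F \<and> nf {a. (a < c \<or> a \<in> F) \<and> indep a c} w"

lemma not_nf_blocked: "a \<in> F \<Longrightarrow> \<forall>c\<in>set v. indep a c \<Longrightarrow> \<not> nf F (v @ a # z)"
  by (induction v arbitrary: F) auto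

text \<open>The letter \<open>a\<close> could be moved in front of the larger letter
  \<open>b\<close>. By \<open>not_nfE\<close> this is the only way in which \<open>nf {}\<close>
  fails.\<close>

lemma not_nf_factor: "a < b \<Longrightarrow> \<forall>c\<in>set (b # v). indep a c \<Longrightarrow> \<not> nf F (u @ b # v @ a # z)"
  by (induction u arbitrary: F) (auto simp: not_nf_blocked)

lemma not_nfE:
  assumes "\<not> nf F w"
  shows "(\<exists>v a z. w = v @ a # z \<and> a \<in> F \<and> (\<forall>c\<in>set v. indep a c)) \<or>
    (\<exists>u b v a z. w = u @ b # v @ a # z \<and> a < b \<and> (\<forall>c\<in>set (b # v). indep a c))"
  using assms
proof (induction w arbitrary: F)
  case (Cons c w)
  show ?case
  proof (cases "c \<in> F")
    case True
    then show ?thesis by (intro disjI1 exI[of _ "[]"]) auto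
  next
    case False
    then have "\<not> nf {a. (a < c \<or> a \<in> F) \<and> indep a c} w" using Cons.prems by simp
    from Cons.IH[OF this] show ?thesis
    proof
      assume "\<exists>v a z. w = v @ a # z \<and> a \<in> {a. (a < c \<or> a \<in> F) \<and> indep a c} \<and> (\<forall>c\<in>set v. indep a c)"
      then obtain v a z where h: "w = v @ a # z" "a < c \<or> a \<in> F" "indep a c" "\<forall>c\<in>set v. indep a c" by blast
      from h(2) show ?thesis
      proof
        assume "a < c"
        then show ?thesis using h
          by (intro disjI2 exI[of _ "[]"] exI[of _ c] exI[of _ v] exI[of _ a] exI[of _ z]) auto
      next
        assume "a \<in> F"
        then show ?thesis using h by (intro disjI1 exI[of _ "c # v"] exI[of _ a] exI[of _ z]) auto
      qed
    next
      assume "\<exists>u b v a z. w = u @ b # v @ a # z \<and> a < b \<and> (\<forall>c\<in>set (b # v). indep a c)"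
      then obtain u b v a z where "w = u @ b # v @ a # z" "a < b" "\<forall>c\<in>set (b # v). indep a c" by blast
      then show ?thesis
        by (intro disjI2 exI[of _ "c # u"] exI[of _ b] exI[of _ v] exI[of _ a] exI[of _ z]) auto
    qed
  qed
qed simp

text \<open>All that a prefix leaves behind is the set of blocked letters, a subset of
  \<open>S\<close>, or failure.\<close>

lemma regular_nf: "regular S {w \<in> lists S. nf {} w}"
proof -
  define L where "L F = {v \<in> lists S. nf F v}" for F
  have step: "{v \<in> lists S. nf F (u @ v)} \<in> insert {} (L ` Pow S)" if "u \<in> lists S" "F \<subseteq> S" for u F
    using that
  proof (induction u arbitrary: F rule: list.induct)
    case Nil
    then show ?case unfolding L_def by auto
  next
    case (Cons c u)
    then have c: "c \<in> S" "u \<in> lists S" by auto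
    have "{a. (a < c \<or> a \<in> F) \<and> indep a c} \<subseteq> S" using c(1) Cons.prems(2) unfolding S_def by auto
    from Cons.IH[OF c(2) this] show ?case by (cases "c \<in> F") auto
  qed
  have "residual S {w \<in> lists S. nf {} w} u \<in> insert {} (L ` Pow S)" if "u \<in> lists S" for u
  proof -
    have "residual S {w \<in> lists S. nf {} w} u = {v \<in> lists S. nf {} (u @ v)}"
      using that unfolding residual_def by auto
    then show ?thesis using step[OF that, of "{}"] by simp
  qed
  then have "residual S {w \<in> lists S. nf {} w} ` lists S \<subseteq> insert {} (L ` Pow S)" by blast
  then show ?thesis unfolding regular_def using finite_S by (meson finite.insertI finite_Pow_iff finite_imageI finite_subset)
qed

text \<open>At the first difference, each of \<open>p\<close> and \<open>q\<close> can be moved to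
  that place in the list where it comes later: everything passed on the way occurs in opposite
  orders in the two lists, hence is independent. The smaller letter then violates a normal form, and
  equal letters are not independent.\<close>

lemma nf_unique:
  assumes dist: "distinct ps" "distinct qs" "set ps = set qs"
    and nf: "nf {} (map g ps)" "nf {} (map g qs)"
    and dep: "\<And>p q a b c a' b' c'. ps = a @ p # b @ q # c \<Longrightarrow> qs = a' @ q # b' @ p # c' \<Longrightarrow> indep (g p) (g q)"
  shows "ps = qs"
proof (rule ccontr)
  assume "ps \<noteq> qs"
  moreover have "length ps = length qs" using dist by (metis distinct_card)
  ultimately obtain u p ps' q qs' where d: "p \<noteq> q" "ps = u @ [p] @ ps'" "qs = u @ [q] @ qs'"
    using same_length_different by blast
  have "p \<in> set qs" "q \<in> set ps" using d(2,3) dist(3) by auto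
  then have "p \<in> set qs'" "q \<in> set ps'" using d dist(1,2) by auto
  then obtain v z v' z' where v: "qs' = v @ p # z" "ps' = v' @ q # z'" by (metis split_list)
  have P: "indep (g p) (g c)" if c: "c \<in> set (q # v)" for c
  proof -
    have "c \<in> set qs" "c \<notin> set u" "c \<noteq> p" using c d v dist(2) by auto
    then have "c \<in> set ps'" using d(2) dist(3) by auto
    then obtain r s where rs: "ps' = r @ c # s" by (metis split_list)
    obtain r' s' where rs': "q # v = r' @ c # s'" using c by (metis split_list)
    show ?thesis
    proof (rule dep)
      show "ps = u @ p # r @ c # s" using d(2) rs by simp
      have "qs = u @ (q # v) @ p # z" using d(3) v(1) by simp
      then show "qs = (u @ r') @ c # s' @ p # z" unfolding rs' by simp
    qed
  qed
  have Q: "indep (g q) (g c)" if c: "c \<in> set (p # v')" for c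
  proof -
    have "c \<in> set ps" "c \<notin> set u" "c \<noteq> q" using c d v dist(1) by auto
    then have "c \<in> set qs'" using d(3) dist(3) by auto
    then obtain r s where rs: "qs' = r @ c # s" by (metis split_list)
    obtain r' s' where rs': "p # v' = r' @ c # s'" using c by (metis split_list)
    have "indep (g c) (g q)"
    proof (rule dep)
      show "qs = u @ q # r @ c # s" using d(3) rs by simp
      have "ps = u @ (p # v') @ q # z'" using d(2) v(2) by simp
      then show "ps = (u @ r') @ c # s' @ q # z'" unfolding rs' by simp
    qed
    then show ?thesis by (simp add: indep_sym)
  qed
  consider "g p < g q" | "g q < g p" | "g p = g q" by linarith
  then show False
  proof cases
    case 1
    have "\<not> nf {} (map g u @ g q # map g v @ g p # map g z)"
      by (rule not_nf_factor[OF 1]) (use P in auto)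
    then show False using nf(2) d(3) v(1) by simp
  next
    case 2
    have "\<not> nf {} (map g u @ g p # map g v' @ g q # map g z')"
      by (rule not_nf_factor[OF 2]) (use Q in auto)
    then show False using nf(1) d(2) v(2) by simp
  next
    case 3
    then show False using P[of q] unfolding indep_def by simp
  qed
qed

text \<open>
  A word over triples describes a gridded point set by its first entries, a second gridding of
  the same points by its second entries, and marks points from which the second gridding is seen
  to be smaller than the first one in the lexicographic order from left to right.
\<close>
definition alternative :: "(nat \<times> nat \<times> bool) list \<Rightarrow> bool" where
  "alternative t \<longleftrightarrow>
     good_gridding {..<length t} (kx (map fst t)) (ky (map fst t))
       (\<lambda>i. lcol (fst (snd (t ! i)))) (\<lambda>i. lrow (fst (snd (t ! i)))) \<and>
     (\<forall>i<length t. snd (snd (t ! i)) \<longrightarrow> fst (snd (t ! i)) < fst (t ! i) \<and>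
        (\<forall>j<length t. kx (map fst t) j < kx (map fst t) i \<longrightarrow> fst (snd (t ! j)) = fst (t ! j)))"

definition improvable :: "nat list set" where
  "improvable = map fst ` {t \<in> lists (S \<times> S \<times> UNIV). alternative t \<and> (\<exists>i<length t. snd (snd (t ! i)))}"

definition nonsimple :: "nat list set" where
  "nonsimple = map fst ` {t \<in> lists (S \<times> UNIV).
     interval {..<length t} (kx (map fst t)) (ky (map fst t)) {i. i < length t \<and> snd (t ! i)} \<and>
     \<not> (\<forall>i<length t. \<forall>j<length t. snd (t ! i) \<and> snd (t ! j) \<longrightarrow> i = j) \<and> \<not> (\<forall>i<length t. snd (t ! i))}"

text \<open>Words with at most two letters satisfy \<open>simple\<close> as well, but inflations
  with two blocks are direct or skew sums, which are counted separately, and a single block gives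
  nothing new.\<close>

definition Can :: "nat list set" where
  "Can = {w \<in> lists S. nf {} w} - improvable - nonsimple - {w \<in> lists S. length w \<le> 2}"

lemma subseq_index:
  assumes "subseq v t"
  shows "\<exists>f. embeds f {..<length v} (kx (map fst v)) (ky (map fst v)) {..<length t} (kx (map fst t)) (ky (map fst t)) \<and>
    (\<forall>i<length v. v ! i = t ! f i \<and> f i < length t) \<and> inj_on f {..<length v}"
proof -
  obtain f where f: "strict_mono_on {..<length v} f" "f ` {..<length v} \<subseteq> {..<length t}"
    "\<forall>i<length v. v ! i = t ! f i" using assms unfolding list_emb_nth by blast
  have fl: "f i < length t" if "i < length v" for i using f(2) that by blast
  have "embeds f {..<length (map fst v)} (kx (map fst v)) (ky (map fst v))
      {..<length (map fst t)} (kx (map fst t)) (ky (map fst t))"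
    by (rule key_subword) (use f fl in auto)
  then show ?thesis using f(3) fl strict_mono_on_imp_inj_on[OF f(1)] by (intro exI[of _ f]) simp
qed

lemma subseq_lists: "subseq u v \<Longrightarrow> v \<in> lists A \<Longrightarrow> u \<in> lists A"
  by (auto dest: list_emb_set)

lemma good_gridding_cong:
  assumes "\<And>p. p \<in> P \<Longrightarrow> col p = col' p \<and> row p = row' p"
  shows "good_gridding P x y col row = good_gridding P x y col' row'"
proof -
  have "grid_rel P x y col row = grid_rel P x y col' row'" unfolding grid_rel_def using assms by auto
  then show ?thesis unfolding good_gridding_def using assms by auto
qed

lemma alternative_subseq:
  assumes "subseq v t" "alternative t"
  shows "alternative v"
proof -
  obtain f where f: "embeds f {..<length v} (kx (map fst v)) (ky (map fst v)) {..<length t} (kx (map fst t)) (ky (map fst t))"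
    "\<And>i. i < length v \<Longrightarrow> v ! i = t ! f i" "\<And>i. i < length v \<Longrightarrow> f i < length t"
    using subseq_index[OF assms(1)] by blast
  have g: "good_gridding {..<length v} (kx (map fst v)) (ky (map fst v))
      (\<lambda>i. lcol (fst (snd (t ! f i)))) (\<lambda>i. lrow (fst (snd (t ! f i))))"
    by (rule good_gridding_embeds[OF f(1)]) (use assms(2) in \<open>simp add: alternative_def\<close>)
  have "good_gridding {..<length v} (kx (map fst v)) (ky (map fst v))
      (\<lambda>i. lcol (fst (snd (v ! i)))) (\<lambda>i. lrow (fst (snd (v ! i))))"
    using g by (subst good_gridding_cong[of _ _ "\<lambda>i. lcol (fst (snd (t ! f i)))" _ "\<lambda>i. lrow (fst (snd (t ! f i)))"]) (simp_all add: f(2))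
  moreover have "fst (snd (v ! i)) < fst (v ! i) \<and>
        (\<forall>j<length v. kx (map fst v) j < kx (map fst v) i \<longrightarrow> fst (snd (v ! j)) = fst (v ! j))"
    if i: "i < length v" "snd (snd (v ! i))" for i
  proof -
    have ti: "snd (snd (t ! f i))" "f i < length t" using i f by auto
    have "kx (map fst v) j < kx (map fst v) i \<longleftrightarrow> kx (map fst t) (f j) < kx (map fst t) (f i)" if "j < length v" for j
      using f(1) i(1) that unfolding embeds_def by blast
    moreover have "fst (snd (t ! f i)) < fst (t ! f i) \<and>
        (\<forall>j<length t. kx (map fst t) j < kx (map fst t) (f i) \<longrightarrow> fst (snd (t ! j)) = fst (t ! j))"
      using assms(2) ti unfolding alternative_def by blast
    ultimately show ?thesis using f(2,3) i(1) by simp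
  qed
  ultimately show ?thesis unfolding alternative_def by blast
qed

text \<open>Alternative griddings and the absence of marks both pass to subwords. The language of
  marked words is thus a difference of two downsets, and forgetting the second gridding is a
  projection.\<close>

lemma regular_improvable: "regular S improvable"
  unfolding improvable_def
proof (rule regular_map)
  define A where "A = {t \<in> lists (S \<times> S \<times> (UNIV :: bool set)). alternative t}"
  define N where "N = {t \<in> lists (S \<times> S \<times> (UNIV :: bool set)). \<forall>i<length t. \<not> snd (snd (t ! i))}"
  have fin: "finite (S \<times> S \<times> (UNIV :: bool set))" using finite_S by simp
  have A: "regular (S \<times> S \<times> UNIV) A"
  proof (rule regular_downset[OF fin])
    fix u v assume "v \<in> A" "subseq u v"
    then show "u \<in> A"
      using alternative_subseq subseq_lists[of u v] unfolding A_def by (simp del: in_lists_conv_set)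
  qed (auto simp: A_def)
  have N: "regular (S \<times> S \<times> UNIV) N"
  proof (rule regular_downset[OF fin])
    fix u v assume v: "v \<in> N" "subseq u v"
    obtain f where f: "\<And>i. i < length u \<Longrightarrow> u ! i = v ! f i" "\<And>i. i < length u \<Longrightarrow> f i < length v"
      using subseq_index[OF v(2)] by blast
    then show "u \<in> N" using v subseq_lists[OF v(2)] unfolding N_def by (simp del: in_lists_conv_set)
  qed (auto simp: N_def)
  have "{t \<in> lists (S \<times> S \<times> UNIV). alternative t \<and> (\<exists>i<length t. snd (snd (t ! i)))} = A - N"
    unfolding A_def N_def by blast
  then show "regular (S \<times> S \<times> UNIV)
      {t \<in> lists (S \<times> S \<times> UNIV). alternative t \<and> (\<exists>i<length t. snd (snd (t ! i)))}"
    using regular_Diff[OF A N] by (simp only:)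
qed auto

text \<open>The same scheme: that the marks form an interval, that at most one point is marked and
  that all points are marked are hereditary conditions, and two differences combine them.\<close>

lemma regular_nonsimple: "regular S nonsimple"
  unfolding nonsimple_def
proof (rule regular_map)
  let ?B = "S \<times> (UNIV :: bool set)"
  define A where "A = {t \<in> lists ?B. interval {..<length t} (kx (map fst t)) (ky (map fst t)) {i. i < length t \<and> snd (t ! i)}}"
  define M where "M = {t \<in> lists ?B. \<forall>i<length t. \<forall>j<length t. snd (t ! i) \<and> snd (t ! j) \<longrightarrow> i = j}"
  define N where "N = {t \<in> lists ?B. \<forall>i<length t. snd (t ! i)}"
  have fin: "finite ?B" using finite_S by simp
  have A: "regular ?B A"
  proof (rule regular_downset[OF fin])
    fix u v assume v: "v \<in> A" "subseq u v"
    obtain f where f: "embeds f {..<length u} (kx (map fst u)) (ky (map fst u)) {..<length v} (kx (map fst v)) (ky (map fst v))"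
      "\<And>i. i < length u \<Longrightarrow> u ! i = v ! f i" "\<And>i. i < length u \<Longrightarrow> f i < length v"
      using subseq_index[OF v(2)] by blast
    have "interval {..<length u} (kx (map fst u)) (ky (map fst u))
        {i \<in> {..<length u}. f i \<in> {i. i < length v \<and> snd (v ! i)}}"
      by (rule interval_vimage[OF f(1)]) (use v(1) in \<open>simp add: A_def\<close>)
    moreover have "{i \<in> {..<length u}. f i \<in> {i. i < length v \<and> snd (v ! i)}} = {i. i < length u \<and> snd (u ! i)}"
      using f(2,3) by auto
    ultimately show "u \<in> A" using v subseq_lists[OF v(2)] unfolding A_def by (simp del: in_lists_conv_set)
  qed (auto simp: A_def)
  have M: "regular ?B M"
  proof (rule regular_downset[OF fin])
    fix u v assume v: "v \<in> M" "subseq u v"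
    obtain f where f: "\<And>i. i < length u \<Longrightarrow> u ! i = v ! f i" "\<And>i. i < length u \<Longrightarrow> f i < length v"
      "inj_on f {..<length u}"
      using subseq_index[OF v(2)] by blast
    have "i = j" if "i < length u" "j < length u" "snd (u ! i)" "snd (u ! j)" for i j
    proof -
      have "f i = f j" using v(1) f(1,2) that unfolding M_def by auto
      then show ?thesis using f(3) that unfolding inj_on_def by blast
    qed
    then show "u \<in> M" using v subseq_lists[OF v(2)] unfolding M_def by (simp del: in_lists_conv_set)
  qed (auto simp: M_def)
  have N: "regular ?B N"
  proof (rule regular_downset[OF fin])
    fix u v assume v: "v \<in> N" "subseq u v"
    obtain f where f: "\<And>i. i < length u \<Longrightarrow> u ! i = v ! f i" "\<And>i. i < length u \<Longrightarrow> f i < length v"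
      using subseq_index[OF v(2)] by blast
    then show "u \<in> N" using v subseq_lists[OF v(2)] unfolding N_def by (simp del: in_lists_conv_set)
  qed (auto simp: N_def)
  have "{t \<in> lists ?B. interval {..<length t} (kx (map fst t)) (ky (map fst t)) {i. i < length t \<and> snd (t ! i)} \<and>
     \<not> (\<forall>i<length t. \<forall>j<length t. snd (t ! i) \<and> snd (t ! j) \<longrightarrow> i = j) \<and> \<not> (\<forall>i<length t. snd (t ! i))} = A - M - N"
    unfolding A_def M_def N_def by blast
  then show "regular ?B {t \<in> lists ?B.
     interval {..<length t} (kx (map fst t)) (ky (map fst t)) {i. i < length t \<and> snd (t ! i)} \<and>
     \<not> (\<forall>i<length t. \<forall>j<length t. snd (t ! i) \<and> snd (t ! j) \<longrightarrow> i = j) \<and> \<not> (\<forall>i<length t. snd (t ! i))}"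
    using regular_Diff[OF regular_Diff[OF A M] N] by (simp only:)
qed auto

lemma regular_Can: "regular S Can"
  unfolding Can_def
proof (intro regular_Diff regular_nf regular_improvable regular_nonsimple regular_downset[OF finite_S])
  fix u v assume "v \<in> {w \<in> lists S. length w \<le> 2}" "subseq u v"
  then show "u \<in> {w \<in> lists S. length w \<le> 2}"
    using subseq_lists[of u v S] list_emb_length[of "(=)" u v] by (simp del: in_lists_conv_set)
qed auto

lemma nonsimple_iff:
  assumes "w \<in> lists S"
  shows "w \<in> nonsimple \<longleftrightarrow> \<not> simple {..<length w} (kx w) (ky w)"
proof
  assume "w \<in> nonsimple"
  then obtain t where t: "w = map fst t" "interval {..<length t} (kx w) (ky w) {i. i < length t \<and> snd (t ! i)}"
    "\<not> (\<forall>i<length t. \<forall>j<length t. snd (t ! i) \<and> snd (t ! j) \<longrightarrow> i = j)" "\<not> (\<forall>i<length t. snd (t ! i))"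
    unfolding nonsimple_def by blast
  define I where "I = {i. i < length t \<and> snd (t ! i)}"
  obtain i j where "i \<in> I" "j \<in> I" "i \<noteq> j" using t(3) unfolding I_def by blast
  then have "\<not> card I \<le> 1" using card_mono[of I "{i, j}"] unfolding I_def by auto
  moreover have "I \<noteq> {..<length w}" using t(1,4) unfolding I_def by auto
  ultimately show "\<not> simple {..<length w} (kx w) (ky w)"
    using t(1,2) unfolding simple_def I_def by auto
next
  assume "\<not> simple {..<length w} (kx w) (ky w)"
  then obtain I where I: "interval {..<length w} (kx w) (ky w) I" "\<not> card I \<le> 1" "I \<noteq> {..<length w}"
    unfolding simple_def by blast
  have sub: "I \<subseteq> {..<length w}" using I(1) unfolding interval_def by blast
  define t where "t = map (\<lambda>i. (w ! i, i \<in> I)) [0..<length w]"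
  have lt: "length t = length w" and ti: "\<And>i. i < length w \<Longrightarrow> t ! i = (w ! i, i \<in> I)"
    unfolding t_def by simp_all
  have w: "map fst t = w" by (rule nth_equalityI) (simp_all add: lt ti)
  have "w ! i \<in> S" if "i < length w" for i using assms that by (auto dest: nth_mem)
  then have "t \<in> lists (S \<times> UNIV)" unfolding t_def by auto
  moreover have "{i. i < length t \<and> snd (t ! i)} = I" using sub lt ti by auto
  moreover have "\<not> (\<forall>i<length t. \<forall>j<length t. snd (t ! i) \<and> snd (t ! j) \<longrightarrow> i = j)"
  proof
    assume a: "\<forall>i<length t. \<forall>j<length t. snd (t ! i) \<and> snd (t ! j) \<longrightarrow> i = j"
    have "i = j" if "i \<in> I" "j \<in> I" for i j
    proof -
      have "i < length w" "j < length w" using that sub by auto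
      then show ?thesis using a[rule_format, of i j] that lt ti by simp
    qed
    moreover have "finite I" using sub finite_subset by blast
    ultimately show False using I(2) by (metis One_nat_def card_le_Suc0_iff_eq)
  qed
  moreover have "\<not> (\<forall>i<length t. snd (t ! i))" using sub I(3) lt ti by auto
  ultimately show "w \<in> nonsimple" using I(1) w lt unfolding nonsimple_def by (metis (mono_tags, lifting) image_eqI mem_Collect_eq)
qed

lemma Can_iff: "w \<in> Can \<longleftrightarrow> w \<in> lists S \<and> nf {} w \<and> w \<notin> improvable \<and>
    simple {..<length w} (kx w) (ky w) \<and> 3 \<le> length w"
  using nonsimple_iff[of w] unfolding Can_def by (auto simp del: in_lists_conv_set)

lemma improvableI:
  assumes w: "w \<in> lists S" and g: "\<And>i. i < length w \<Longrightarrow> g i \<in> S"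
    and good: "good_gridding {..<length w} (kx w) (ky w) (\<lambda>i. lcol (g i)) (\<lambda>i. lrow (g i))"
    and p: "p < length w" "g p < w ! p" "\<And>q. q < length w \<Longrightarrow> kx w q < kx w p \<Longrightarrow> g q = w ! q"
  shows "w \<in> improvable"
proof -
  define t where "t = map (\<lambda>i. (w ! i, g i, i = p)) [0..<length w]"
  have lt: "length t = length w" and ti: "\<And>i. i < length w \<Longrightarrow> t ! i = (w ! i, g i, i = p)"
    unfolding t_def by simp_all
  have mw: "map fst t = w" by (rule nth_equalityI) (simp_all add: lt ti)
  have "w ! i \<in> S" if "i < length w" for i using w that by (auto dest: nth_mem)
  then have "t \<in> lists (S \<times> S \<times> UNIV)" using g unfolding t_def by auto
  moreover have "alternative t"
    unfolding alternative_def mw lt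
  proof
    show "good_gridding {..<length w} (kx w) (ky w) (\<lambda>i. lcol (fst (snd (t ! i)))) (\<lambda>i. lrow (fst (snd (t ! i))))"
      using good by (subst good_gridding_cong[of _ _ "\<lambda>i. lcol (g i)" _ "\<lambda>i. lrow (g i)"]) (simp_all add: ti)
    show "\<forall>i<length w. snd (snd (t ! i)) \<longrightarrow> fst (snd (t ! i)) < fst (t ! i) \<and>
        (\<forall>j<length w. kx w j < kx w i \<longrightarrow> fst (snd (t ! j)) = fst (t ! j))"
      using p by (simp add: ti)
  qed
  moreover have "\<exists>i<length t. snd (snd (t ! i))" using p(1) lt ti by auto
  ultimately show ?thesis unfolding improvable_def using mw by blast
qed

section \<open>Uniqueness and existence of canonical words\<close>

lemma not_improvable_iso:
  assumes w: "w \<in> lists S" "w \<notin> improvable" and w': "w' \<in> lists S"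
    and \<tau>: "embeds \<tau> {..<length w} (kx w) (ky w) {..<length w'} (kx w') (ky w')"
    and p: "p < length w" "\<And>q. q < length w \<Longrightarrow> kx w q < kx w p \<Longrightarrow> w' ! \<tau> q = w ! q"
  shows "w ! p \<le> w' ! \<tau> p"
proof (rule ccontr)
  assume n: "\<not> ?thesis"
  have "w \<in> improvable"
  proof (rule improvableI[where g = "\<lambda>i. w' ! \<tau> i"])
    show "w' ! \<tau> i \<in> S" if "i < length w" for i
    proof -
      have "\<tau> i < length w'" using \<tau> that unfolding embeds_def by auto
      then show ?thesis using w' by (auto dest: nth_mem)
    qed
    show "good_gridding {..<length w} (kx w) (ky w) (\<lambda>i. lcol (w' ! \<tau> i)) (\<lambda>i. lrow (w' ! \<tau> i))"
      by (rule good_gridding_embeds[OF \<tau> good_gridding_word])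
  qed (use n p w in auto)
  then show False using w(2) by blast
qed

text \<open>Each word supplies a gridding of the other's points and neither can be improved, so the
  letters agree point by point from left to right. Points with dependent letters then come in the
  same order in both words, because the coordinates determine it, and \<open>nf_unique\<close>
  applies.\<close>

lemma rigid_Can: "rigid Can"
  unfolding rigid_def
proof (intro ballI allI impI, elim conjE)
  fix w w' \<tau> assume wC: "w \<in> Can" "w' \<in> Can" and bij: "bij_betw \<tau> {..<length w} {..<length w'}"
    and emb: "embeds \<tau> {..<length w} (kx w) (ky w) {..<length w'} (kx w') (ky w')"
  have w: "w \<in> lists S" "nf {} w" "w \<notin> improvable" and w': "w' \<in> lists S" "nf {} w'" "w' \<notin> improvable"
    using wC unfolding Can_iff by auto
  define \<sigma> where "\<sigma> = inv_into {..<length w} \<tau>"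
  have len: "length w' = length w" using bij_betw_same_card[OF bij] by simp
  have bij': "bij_betw \<sigma> {..<length w'} {..<length w}" unfolding \<sigma>_def by (rule bij_betw_inv_into[OF bij])
  have emb': "embeds \<sigma> {..<length w'} (kx w') (ky w') {..<length w} (kx w) (ky w)"
    unfolding \<sigma>_def by (rule embeds_inv[OF emb bij])
  have \<tau>\<sigma>: "\<tau> (\<sigma> j) = j" "\<sigma> j < length w" if "j < length w" for j
    using bij_betw_inv_into_right[OF bij, of j] bij' that len unfolding \<sigma>_def[symmetric] bij_betw_def by auto
  have \<sigma>\<tau>: "\<sigma> (\<tau> i) = i" "\<tau> i < length w" if "i < length w" for i
    using bij_betw_inv_into_left[OF bij, of i] bij that len unfolding \<sigma>_def[symmetric] bij_betw_def by auto
  have letters: "w' ! \<tau> p = w ! p" if "p < length w" for p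
    using that
  proof (induction "kx w p" arbitrary: p rule: less_induct)
    case less
    have "w ! p \<le> w' ! \<tau> p" by (rule not_improvable_iso[OF w(1,3) w'(1) emb less(2)]) (use less in blast)
    moreover have "w' ! \<tau> p \<le> w ! \<sigma> (\<tau> p)"
    proof (rule not_improvable_iso[OF w'(1,3) w(1) emb'])
      show "\<tau> p < length w'" using \<sigma>\<tau>(2)[OF less(2)] len by simp
      fix q assume q: "q < length w'" "kx w' q < kx w' (\<tau> p)"
      have q': "\<sigma> q < length w" "\<tau> (\<sigma> q) = q" using \<tau>\<sigma> q len by simp_all
      have "kx w (\<sigma> q) < kx w p" using emb q' q less(2) unfolding embeds_def by auto
      then show "w ! \<sigma> q = w' ! q" using less(1)[of "\<sigma> q"] q' by simp
    qed
    ultimately show ?case using \<sigma>\<tau>(1)[OF less(2)] by simp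
  qed
  have ord: "i < j \<longleftrightarrow> \<tau> i < \<tau> j" if "i < length w" "j < length w" "\<not> indep (w ! i) (w ! j)" for i j
  proof -
    have e: "(kx w i < kx w j \<longleftrightarrow> kx w' (\<tau> i) < kx w' (\<tau> j)) \<and> (ky w i < ky w j \<longleftrightarrow> ky w' (\<tau> i) < ky w' (\<tau> j))"
      using emb that unfolding embeds_def by simp
    have l: "\<tau> i < length w'" "\<tau> j < length w'" using \<sigma>\<tau>(2) that len by simp_all
    show ?thesis
      using e that(3) letters[OF that(1)] letters[OF that(2)]
      unfolding kx_less[OF that(1,2)] kx_less[OF l] ky_less[OF that(1,2)] ky_less[OF l] indep_def by auto
  qed
  define qs where "qs = map \<sigma> [0..<length w]"
  have "[0..<length w] = qs"
  proof (rule nf_unique[where g = "nth w"])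
    show "distinct qs" using bij' len unfolding qs_def bij_betw_def by (simp add: distinct_map lessThan_atLeast0)
    show "set [0..<length w] = set qs" using bij' len unfolding qs_def bij_betw_def by (simp add: lessThan_atLeast0)
    show "nf {} (map (nth w) [0..<length w])" using w(2) by (simp add: map_nth)
    have "map (nth w) qs = w'"
    proof (rule nth_equalityI)
      show "length (map (nth w) qs) = length w'" unfolding qs_def using len by simp
      fix i assume "i < length (map (nth w) qs)"
      then have i: "i < length w" unfolding qs_def by simp
      then show "map (nth w) qs ! i = w' ! i" using letters[OF \<tau>\<sigma>(2)[OF i]] \<tau>\<sigma>(1)[OF i] unfolding qs_def by simp
    qed
    then show "nf {} (map (nth w) qs)" using w'(2) by simp
    fix p q a b c a' b' c'
    assume ps: "[0..<length w] = a @ p # b @ q # c" and qs: "qs = a' @ q # b' @ p # c'"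
    show "indep (w ! p) (w ! q)"
    proof (rule ccontr)
      assume ni: "\<not> indep (w ! p) (w ! q)"
      have pq: "p < length w" "q < length w" using ps by (metis atLeastLessThan_iff in_set_conv_decomp set_upt append_Cons append_assoc)+
      have "sorted_wrt (<) (a @ p # b @ q # c)" unfolding ps[symmetric] by simp
      then have "p < q" by (simp add: sorted_wrt_append)
      have "sorted_wrt (<) (map \<tau> qs)"
      proof -
        have "map \<tau> qs = [0..<length w]" unfolding qs_def using \<tau>\<sigma>(1) by (intro nth_equalityI) auto
        then show ?thesis by simp
      qed
      then have "\<tau> q < \<tau> p" unfolding qs by (simp add: sorted_wrt_append)
      then show False using ord[OF pq ni] \<open>p < q\<close> by simp
    qed
  qed simp
  then have "\<sigma> i = i" if "i < length w" for i
    using that unfolding qs_def by (metis add_0 diff_zero length_map length_upt nth_map nth_upt)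
  then have \<tau>id: "\<tau> i = i" if "i < length w" for i using \<tau>\<sigma>(1)[OF that] that by simp
  have "w = w'" using len letters \<tau>id by (intro nth_equalityI) auto
  then show "w = w' \<and> (\<forall>i<length w. \<tau> i = i)" using \<tau>id by blast
qed

text \<open>Two successive choices: the least gridding, comparing the cells of the points from left
  to right, so that the word is not improvable, and then the linear extension of its reading order
  with the least word, so that the word is in normal form.\<close>

lemma ex_Can:
  assumes P: "points P x y" and simple: "simple P x y" and card: "3 \<le> card P"
    and good: "good_gridding P x y col row" and bound: "\<And>p. p \<in> P \<Longrightarrow> col p < K \<and> row p < K"
  shows "\<exists>w\<in>Can. \<exists>f. bij_betw f {..<length w} P \<and> embeds f {..<length w} (kx w) (ky w) P x y"
proof -
  have fin: "finite P" using P unfolding points_def by blast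
  define ok where "ok g \<longleftrightarrow> (\<forall>p\<in>P. g p \<in> S) \<and> good_gridding P x y (\<lambda>p. lcol (g p)) (\<lambda>p. lrow (g p))" for g
  obtain L where L: "set L = P" "sorted_wrt (<) (map x L)"
    using ex_sorted_points[OF P] by blast
  have ex_ok: "ok (\<lambda>p. col p * K + row p)"
  proof -
    have l: "lcol (col p * K + row p) = col p" "lrow (col p * K + row p) = row p" if "p \<in> P" for p
      using bound[OF that] unfolding lcol_def lrow_def by auto
    have "col p * K + row p < K * K" if "p \<in> P" for p
    proof -
      have "col p * K + row p < Suc (col p) * K" using bound[OF that] by simp
      also have "\<dots> \<le> K * K" using bound[OF that] by (intro mult_right_mono) auto
      finally show ?thesis .
    qed
    then show ?thesis
      unfolding ok_def S_def using good by (subst good_gridding_cong[of _ _ col _ row]) (simp_all add: l)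
  qed
  obtain g where g: "ok g" "\<And>g'. ok g' \<Longrightarrow> (map g' L, map g L) \<notin> lex less_than"
    using ex_lex_minimal[of ok _ "\<lambda>g. map g L", OF ex_ok] by blast
  define R where "R = grid_rel P x y (\<lambda>p. lcol (g p)) (\<lambda>p. lrow (g p))"
  define lin where "lin ps \<longleftrightarrow> distinct ps \<and> set ps = P \<and> sorted_wrt (\<lambda>p q. (q, p) \<notin> R) ps" for ps
  have "\<exists>ps. lin ps"
    unfolding lin_def
  proof (rule ex_linear_extension[OF fin])
    show "acyclic R" using g(1) unfolding R_def ok_def good_gridding_def by blast
    show "R \<subseteq> P \<times> P" unfolding R_def grid_rel_def by blast
  qed
  then obtain ps0 where ps0: "lin ps0" by blast
  obtain ps where ps: "lin ps" "\<And>ps'. lin ps' \<Longrightarrow> (map g ps', map g ps) \<notin> lex less_than"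
    using ex_lex_minimal[of lin _ "map g", OF ps0] by blast
  define w where "w = map g ps"
  have dist: "distinct ps" and setps: "set ps = P" and sorted: "sorted_wrt (\<lambda>p q. (q, p) \<notin> R) ps"
    using ps(1) unfolding lin_def by auto
  have lw: "length w = length ps" unfolding w_def by simp
  have psP: "ps ! i \<in> P" if "i < length w" for i using nth_mem[of i ps] that setps lw by simp
  have bij: "bij_betw (nth ps) {..<length w} P"
    by (rule bij_betw_nth[OF dist]) (simp_all add: lw setps)
  have R_total: "(ps ! i, ps ! j) \<in> R \<longleftrightarrow> i < j"
    if ij: "i < length w" "j < length w" "lcol (w ! i) = lcol (w ! j) \<or> lrow (w ! i) = lrow (w ! j)" "i \<noteq> j" for i j
  proof -
    have ne: "ps ! i \<noteq> ps ! j" using dist ij lw by (simp add: nth_eq_iff_index_eq)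
    have tot: "(ps ! i, ps ! j) \<in> R \<or> (ps ! j, ps ! i) \<in> R"
      using ij(3) points_neq[OF P psP[OF ij(1)] psP[OF ij(2)] ne] psP[OF ij(1)] psP[OF ij(2)] ij(1,2) lw
      unfolding R_def grid_rel_def w_def by auto
    have no: "(ps ! j', ps ! i') \<notin> R" if "i' < j'" "j' < length ps" for i' j'
      using sorted_wrt_nth_less[OF sorted that] .
    show ?thesis using tot no[of i j] no[of j i] ij(1,2,4) lw by (metis linorder_neqE_nat order_less_asym)
  qed
  have mono: "good_gridding P x y (\<lambda>p. lcol (g p)) (\<lambda>p. lrow (g p))" using g(1) unfolding ok_def by blast
  have key: "(kx w i < kx w j \<longleftrightarrow> x (ps ! i) < x (ps ! j)) \<and> (ky w i < ky w j \<longleftrightarrow> y (ps ! i) < y (ps ! j))"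
    if ij: "i < length w" "j < length w" for i j
  proof (cases "i = j")
    case False
    have ne: "ps ! i \<noteq> ps ! j" using dist False ij lw by (simp add: nth_eq_iff_index_eq)
    have xy: "x (ps ! i) \<noteq> x (ps ! j)" "y (ps ! i) \<noteq> y (ps ! j)"
      using points_neq[OF P psP[OF ij(1)] psP[OF ij(2)] ne] by blast+
    have wi: "w ! i = g (ps ! i)" "w ! j = g (ps ! j)" using ij lw unfolding w_def by simp_all
    have m: "x (ps ! i) < x (ps ! j) \<longrightarrow> lcol (w ! i) \<le> lcol (w ! j)" "x (ps ! j) < x (ps ! i) \<longrightarrow> lcol (w ! j) \<le> lcol (w ! i)"
      "y (ps ! i) < y (ps ! j) \<longrightarrow> lrow (w ! i) \<le> lrow (w ! j)" "y (ps ! j) < y (ps ! i) \<longrightarrow> lrow (w ! j) \<le> lrow (w ! i)"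
      using mono psP[OF ij(1)] psP[OF ij(2)] unfolding good_gridding_def wi by blast+
    have nR: "(ps ! b, ps ! a) \<notin> R" if "a < b" "b < length w" for a b
      using sorted_wrt_nth_less[OF sorted that(1)] that(2) lw by simp
    have c: "x (ps ! i) < x (ps ! j) \<longleftrightarrow> i < j" if "lcol (w ! i) = lcol (w ! j)"
    proof -
      have "x (ps ! b) < x (ps ! a) \<Longrightarrow> (ps ! b, ps ! a) \<in> R" if "a = i \<and> b = j \<or> a = j \<and> b = i" for a b
        using that \<open>lcol (w ! i) = lcol (w ! j)\<close> psP ij wi unfolding R_def grid_rel_def by auto
      then show ?thesis using nR[of i j] nR[of j i] ij xy(1) False by (metis linorder_neqE_nat order_less_asym)
    qed
    have r: "y (ps ! i) < y (ps ! j) \<longleftrightarrow> i < j" if "lrow (w ! i) = lrow (w ! j)"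
    proof -
      have "y (ps ! b) < y (ps ! a) \<Longrightarrow> (ps ! b, ps ! a) \<in> R" if "a = i \<and> b = j \<or> a = j \<and> b = i" for a b
        using that \<open>lrow (w ! i) = lrow (w ! j)\<close> psP ij wi unfolding R_def grid_rel_def by auto
      then show ?thesis using nR[of i j] nR[of j i] ij xy(2) False by (metis linorder_neqE_nat order_less_asym)
    qed
    show ?thesis
      unfolding kx_less[OF ij] ky_less[OF ij] using m xy c r by (metis le_neq_implies_less linorder_neqE_nat not_less)
  qed simp
  have emb: "embeds (nth ps) {..<length w} (kx w) (ky w) P x y"
    unfolding embeds_def using key psP by auto
  define \<iota> where "\<iota> = inv_into {..<length w} (nth ps)"
  have emb': "embeds \<iota> P x y {..<length w} (kx w) (ky w)" unfolding \<iota>_def by (rule embeds_inv[OF emb bij])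
  have \<iota>: "\<iota> p < length w" "ps ! \<iota> p = p" if "p \<in> P" for p
    using bij_betw_inv_into_right[OF bij that] bij_betwE[OF bij_betw_inv_into[OF bij]] that unfolding \<iota>_def by auto
  have \<iota>': "\<iota> (ps ! i) = i" if "i < length w" for i
    using bij_betw_inv_into_left[OF bij, of i] that unfolding \<iota>_def by simp
  have "w \<in> lists S" using g(1) setps unfolding w_def ok_def by auto
  moreover have "nf {} w"
  proof (rule ccontr)
    assume "\<not> nf {} w"
    then obtain u b v a z where d: "map g ps = u @ b # v @ a # z" "a < b" "\<forall>c\<in>set (b # v). indep a c"
      using not_nfE[of "{}" w] unfolding w_def by blast
    obtain us r1 where r1: "ps = us @ r1" "u = map g us" "map g r1 = b # v @ a # z"
      using d(1) unfolding map_eq_append_conv by metis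
    obtain pb r2 where r2: "r1 = pb # r2" "b = g pb" "map g r2 = v @ a # z"
      using r1(3) unfolding map_eq_Cons_conv by metis
    obtain vs r3 where r3: "r2 = vs @ r3" "v = map g vs" "map g r3 = a # z"
      using r2(3) unfolding map_eq_append_conv by metis
    obtain pa zs where "r3 = pa # zs" "a = g pa" using r3(3) unfolding map_eq_Cons_conv by metis
    then have e: "ps = us @ pb # vs @ pa # zs" "u = map g us" "b = g pb" "v = map g vs" "a = g pa"
      using r1 r2 r3 by simp_all
    \<comment> \<open>Moving \<open>pa\<close> forward past points independent of it keeps a linear
      extension and makes the word smaller.\<close>
    define ps' where "ps' = us @ pa # pb # vs @ zs"
    have "(q, pa) \<notin> R \<and> (pa, q) \<notin> R" if "q \<in> set (pb # vs)" for q
    proof -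
      have "indep (g pa) (g q)" using d(3) e that by auto
      then show ?thesis unfolding R_def grid_rel_def indep_def by auto
    qed
    then have "lin ps'" using ps(1) unfolding lin_def ps'_def e(1) by (auto simp: sorted_wrt_append)
    moreover have "(map g ps', map g ps) \<in> lex less_than"
    proof -
      have "map g ps' = map g us @ g pa # map g (pb # vs @ zs) \<and>
          map g ps = map g us @ g pb # map g (vs @ pa # zs) \<and> (g pa, g pb) \<in> less_than"
        unfolding ps'_def e(1) using d(2) e(3,5) by simp
      moreover have "length (map g ps') = length (map g ps)" unfolding ps'_def e(1) by simp
      ultimately show ?thesis by (intro lex_lessI) blast+
    qed
    ultimately show False using ps(2) by blast
  qed
  moreover have "w \<notin> improvable"
  proof
    assume "w \<in> improvable"
    then obtain t i where t: "t \<in> lists (S \<times> S \<times> UNIV)" "alternative t" "w = map fst t" "i < length t" "snd (snd (t ! i))"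
      unfolding improvable_def by blast
    have lt: "length t = length w" using t(3) by simp
    \<comment> \<open>The second entries, pulled back to the points, are an admissible gridding that
      comes before \<open>g\<close>.\<close>
    define g' where "g' p = fst (snd (t ! \<iota> p))" for p
    have "ok g'"
      unfolding ok_def
    proof (intro conjI ballI)
      fix p assume "p \<in> P"
      then have "t ! \<iota> p \<in> set t" using \<iota>(1) lt by simp
      then have "t ! \<iota> p \<in> S \<times> S \<times> UNIV" using t(1) by (auto simp del: mem_Times_iff)
      then show "g' p \<in> S" unfolding g'_def by auto
    next
      show "good_gridding P x y (\<lambda>p. lcol (g' p)) (\<lambda>p. lrow (g' p))"
        unfolding g'_def by (rule good_gridding_embeds[OF emb'])
          (use t(2) in \<open>simp add: alternative_def lt t(3)[symmetric]\<close>)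
    qed
    moreover have "(map g' L, map g L) \<in> lex less_than"
    proof -
      have alt: "fst (snd (t ! i)) < fst (t ! i)"
        "\<And>j. j < length t \<Longrightarrow> kx w j < kx w i \<Longrightarrow> fst (snd (t ! j)) = fst (t ! j)"
        using t(2,4,5) unfolding alternative_def t(3)[symmetric] by blast+
      define p where "p = ps ! i"
      have pP: "p \<in> P" and ip: "\<iota> p = i" using psP \<iota>' t(4) lt unfolding p_def by auto
      have gt: "g q = fst (t ! \<iota> q)" if "q \<in> P" for q
      proof -
        have "g q = w ! \<iota> q" using \<iota>[OF that] lw unfolding w_def by simp
        moreover have "w ! \<iota> q = fst (t ! \<iota> q)" unfolding t(3) using \<iota>(1)[OF that] lt by (intro nth_map) simp
        ultimately show ?thesis by simp
      qed
      obtain L1 L2 where LL: "L = L1 @ p # L2" using pP L(1) by (metis split_list)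
      have "g' q = g q" if "q \<in> set L1" for q
      proof -
        have q: "q \<in> P" "x q < x p" using that L LL by (auto simp: sorted_wrt_append)
        then have "kx w (\<iota> q) < kx w (\<iota> p)" using emb' pP unfolding embeds_def by blast
        then show ?thesis using alt(2)[of "\<iota> q"] \<iota>(1)[OF q(1)] lt ip gt[OF q(1)] unfolding g'_def by simp
      qed
      then have "map g' L1 = map g L1" by simp
      moreover have "g' p < g p" using alt(1) gt[OF pP] ip unfolding g'_def by simp
      ultimately have "map g' L = map g L1 @ g' p # map g' L2 \<and> map g L = map g L1 @ g p # map g L2 \<and>
          (g' p, g p) \<in> less_than" unfolding LL by simp
      then show ?thesis by (intro lex_lessI) (blast, simp)
    qed
    ultimately show False using g(2) by blast
  qed
  moreover have "simple {..<length w} (kx w) (ky w)"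
    by (rule simple_iso[OF _ emb' simple]) (simp add: \<iota>_def bij_betw_inv_into[OF bij])
  moreover have "3 \<le> length w" using card bij_betw_same_card[OF bij] by simp
  ultimately have "w \<in> Can" unfolding Can_iff by blast
  then show ?thesis using bij emb by blast
qed

end

section \<open>Sums and skew sums\<close>

lemma before_embeds:
  assumes "embeds f P x y Q x' y'" "p \<in> P" "q \<in> P"
  shows "before r x y p q \<longleftrightarrow> before r x' y' (f p) (f q)"
  using assms unfolding before_def embeds_def by auto

lemma cut_vimage:
  assumes "embeds f P x y Q x' y'" "cut r Q x' y' D"
  shows "cut r P x y {p \<in> P. f p \<in> D}"
  unfolding cut_def
proof (intro conjI ballI)
  fix p q assume p: "p \<in> {p \<in> P. f p \<in> D}" and q: "q \<in> P - {p \<in> P. f p \<in> D}"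
  have "f q \<in> Q" using q assms(1) unfolding embeds_def by blast
  then have "before r x' y' (f p) (f q)" using p q assms(2) unfolding cut_def by blast
  then show "before r x y p q" using before_embeds[OF assms(1)] p q by blast
qed blast

lemma component_iso1:
  assumes "embeds f P x y Q x' y'" "p \<in> P" "q \<in> P" "q \<in> component r P x y p"
  shows "f q \<in> component r Q x' y' (f p)"
proof -
  have "f p \<in> D \<longleftrightarrow> f q \<in> D" if "cut r Q x' y' D" for D
    using cut_vimage[OF assms(1) that] assms(2-4) unfolding component_def by blast
  moreover have "f q \<in> Q" using assms(1,3) unfolding embeds_def by blast
  ultimately show ?thesis unfolding component_def by blast
qed

lemma component_iso:
  assumes "bij_betw f P Q" "embeds f P x y Q x' y'" "p \<in> P" "q \<in> P"
  shows "q \<in> component r P x y p \<longleftrightarrow> f q \<in> component r Q x' y' (f p)"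
proof
  assume "f q \<in> component r Q x' y' (f p)"
  moreover have "f p \<in> Q" "f q \<in> Q" using assms unfolding bij_betw_def by auto
  ultimately have "inv_into P f (f q) \<in> component r P x y (inv_into P f (f p))"
    using component_iso1[OF embeds_inv[OF assms(2,1)]] by blast
  then show "q \<in> component r P x y p" using bij_betw_inv_into_left[OF assms(1)] assms(3,4) by simp
qed (rule component_iso1[OF assms(2-4)])

definition has_cut :: "bool \<Rightarrow> 'a set \<Rightarrow> ('a \<Rightarrow> nat) \<Rightarrow> ('a \<Rightarrow> nat) \<Rightarrow> bool" where
  "has_cut r P x y \<longleftrightarrow> (\<exists>D. cut r P x y D \<and> D \<noteq> {} \<and> D \<noteq> P)"

lemma has_cut_iso1:
  assumes "bij_betw f P Q" "embeds f P x y Q x' y'" "has_cut r Q x' y'"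
  shows "has_cut r P x y"
proof -
  obtain D where D: "cut r Q x' y' D" "D \<noteq> {}" "D \<noteq> Q" using assms(3) unfolding has_cut_def by blast
  have DQ: "D \<subseteq> Q" using D(1) unfolding cut_def by blast
  have fP: "f ` P = Q" using assms(1) unfolding bij_betw_def by blast
  obtain d e where de: "d \<in> D" "e \<in> Q" "e \<notin> D" using D(2,3) DQ by blast
  obtain p q where pq: "p \<in> P" "f p = d" "q \<in> P" "f q = e" using de DQ fP by blast
  have "{p \<in> P. f p \<in> D} \<noteq> {}" "{p \<in> P. f p \<in> D} \<noteq> P" using pq de by auto
  then show ?thesis using cut_vimage[OF assms(2) D(1)] unfolding has_cut_def by blast
qed

lemma has_cut_iso:
  assumes "bij_betw f P Q" "embeds f P x y Q x' y'"
  shows "has_cut r P x y \<longleftrightarrow> has_cut r Q x' y'"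
  using has_cut_iso1[OF assms] has_cut_iso1[OF bij_betw_inv_into[OF assms(1)] embeds_inv[OF assms(2,1)]]
  by blast

text \<open>The first parts of the two cuts are nested. A point of the smaller part and one outside
  the larger part would then be related in both ways.\<close>

lemma not_both_cuts: "has_cut True P x y \<Longrightarrow> has_cut False P x y \<Longrightarrow> False"
proof -
  assume "has_cut True P x y" "has_cut False P x y"
  then obtain D E where D: "cut True P x y D" "D \<noteq> {}" "D \<noteq> P" and E: "cut False P x y E" "E \<noteq> {}" "E \<noteq> P"
    unfolding has_cut_def by blast
  have sub: "D \<subseteq> P" "E \<subseteq> P" using D(1) E(1) unfolding cut_def by blast+
  obtain p q where pq: "p \<in> D" "q \<in> P" "q \<notin> E" using D E sub by blast
  obtain p' q' where pq': "p' \<in> E" "q' \<in> P" "q' \<notin> D" using D E sub by blast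
  have A: "before True x y u v" if "u \<in> D" "v \<in> P" "v \<notin> D" for u v using D(1) that unfolding cut_def by blast
  have B: "before False x y u v" if "u \<in> E" "v \<in> P" "v \<notin> E" for u v using E(1) that unfolding cut_def by blast
  have "D \<subseteq> E \<or> E \<subseteq> D"
  proof (rule ccontr)
    assume "\<not> ?thesis"
    then obtain u v where "u \<in> D" "u \<notin> E" "v \<in> E" "v \<notin> D" "u \<in> P" "v \<in> P" using sub by blast
    then show False using A[of u v] B[of v u] sub unfolding before_def by auto
  qed
  then show False
  proof
    assume "D \<subseteq> E"
    then have "q \<notin> D" "p \<in> E" using pq by blast+
    then show False using A[OF pq(1,2)] B[OF _ pq(2,3)] unfolding before_def by fastforce
  next
    assume "E \<subseteq> D"
    then have "q' \<notin> E" "p' \<in> D" using pq' by blast+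
    then show False using A[OF _ pq'(2,3)] B[OF pq'(1,2)] unfolding before_def by fastforce
  qed
qed

abbreviation perm_has_cut :: "bool \<Rightarrow> nat list \<Rightarrow> bool" where
  "perm_has_cut r \<pi> \<equiv> has_cut r {..<length \<pi>} (\<lambda>i. i) (nth \<pi>)"

lemma shape_has_cut: "shape \<pi> P x y \<Longrightarrow> perm_has_cut r \<pi> \<longleftrightarrow> has_cut r P x y"
  unfolding shape_def using has_cut_iso by blast

lemma ex_rank:
  fixes c :: "'a \<Rightarrow> nat"
  assumes "finite P"
  obtains b :: "'a \<Rightarrow> nat" where "b ` P = {..<card (c ` P)}"
    "\<And>p q. p \<in> P \<Longrightarrow> q \<in> P \<Longrightarrow> b p < b q \<longleftrightarrow> c p < c q"
proof -
  define A where "A = c ` P"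
  have fin: "finite A" using assms unfolding A_def by simp
  define b where "b p = card {v \<in> A. v < c p}" for p
  have lt: "b p < b q" if "p \<in> P" "q \<in> P" "c p < c q" for p q
    unfolding b_def
  proof (rule psubset_card_mono)
    have "c p \<in> {v \<in> A. v < c q}" "c p \<notin> {v \<in> A. v < c p}" using that unfolding A_def by auto
    moreover have "{v \<in> A. v < c p} \<subseteq> {v \<in> A. v < c q}" using that(3) by auto
    ultimately show "{v \<in> A. v < c p} \<subset> {v \<in> A. v < c q}" by blast
  qed (use fin in simp)
  have ltiff: "b p < b q \<longleftrightarrow> c p < c q" if "p \<in> P" "q \<in> P" for p q
  proof (cases "c p" "c q" rule: linorder_cases)
    case equal
    then show ?thesis unfolding b_def by simp
  qed (use lt[OF that] lt[OF that(2,1)] in simp_all)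
  have eqiff: "b p = b q \<longleftrightarrow> c p = c q" if "p \<in> P" "q \<in> P" for p q
    using ltiff[OF that] ltiff[OF that(2,1)] by (metis linorder_neqE_nat order_less_irrefl)
  have "b p < card A" if "p \<in> P" for p
    unfolding b_def
  proof (rule psubset_card_mono[OF fin])
    show "{v \<in> A. v < c p} \<subset> A" using that unfolding A_def by auto
  qed
  then have sub: "b ` P \<subseteq> {..<card A}" by auto
  have "card (b ` P) = card A"
  proof -
    have "bij_betw (\<lambda>v. b (inv_into P c v)) A (b ` P)"
      unfolding bij_betw_def
    proof
      show "inj_on (\<lambda>v. b (inv_into P c v)) A"
        unfolding A_def by (rule inj_onI) (metis eqiff f_inv_into_f inv_into_into)
      show "(\<lambda>v. b (inv_into P c v)) ` A = b ` P"
      proof (intro equalityI subsetI)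
        fix z assume "z \<in> b ` P"
        then obtain p where p: "p \<in> P" "z = b p" by blast
        then have "b (inv_into P c (c p)) = b p"
          using eqiff[of "inv_into P c (c p)" p] by (simp add: inv_into_into f_inv_into_f)
        then show "z \<in> (\<lambda>v. b (inv_into P c v)) ` A" using p unfolding A_def by force
      qed (auto simp: A_def inv_into_into)
    qed
    then show ?thesis using bij_betw_same_card by metis
  qed
  then have "b ` P = {..<card A}" using sub by (intro card_subset_eq) auto
  then show thesis using that[of b] ltiff unfolding A_def by blast
qed

text \<open>Direct sums (\<open>r = True\<close>) and skew sums (\<open>r = False\<close>) as inflations of monotone words.\<close>
definition mono_kx :: "unit list \<Rightarrow> nat \<Rightarrow> nat" where "mono_kx w i = i"
definition mono_ky :: "bool \<Rightarrow> unit list \<Rightarrow> nat \<Rightarrow> nat" where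
  "mono_ky r w i = (if r then i else length w - i)"

lemma skeleton_mono: "skeleton mono_kx (mono_ky r)"
proof
  show "inj_on (mono_kx w) {..<length w}" "inj_on (mono_ky r w) {..<length w}" for w
    unfolding mono_kx_def mono_ky_def inj_on_def by auto
  fix v w :: "unit list" and f
  assume f: "strict_mono_on {..<length v} f" "f ` {..<length v} \<subseteq> {..<length w}"
  have fl: "f i < length w" if "i < length v" for i using f(2) that by blast
  have fm: "f i < f j \<longleftrightarrow> i < j" if "i < length v" "j < length v" for i j
    using f(1) that unfolding strict_mono_on_def
    by (metis lessThan_iff linorder_neqE_nat order_less_asym order_less_irrefl)
  show "embeds f {..<length v} (mono_kx v) (mono_ky r v) {..<length w} (mono_kx w) (mono_ky r w)"
    unfolding embeds_def
  proof (intro conjI ballI)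
    fix i j assume "i \<in> {..<length v}" "j \<in> {..<length v}"
    then have ij: "i < length v" "j < length v" by auto
    show "(mono_kx v i < mono_kx v j) = (mono_kx w (f i) < mono_kx w (f j))"
      unfolding mono_kx_def using fm[OF ij] by simp
    show "(mono_ky r v i < mono_ky r v j) = (mono_ky r w (f i) < mono_ky r w (f j))"
      unfolding mono_ky_def using fm[OF ij] fm[OF ij(2,1)] fl[OF ij(1)] fl[OF ij(2)] ij by auto
  qed (use f(2) in auto)
qed

lemma mono_bij_id:
  assumes "bij_betw \<tau> {..<n} {..<n}" "\<And>i j. i < n \<Longrightarrow> j < n \<Longrightarrow> i < j \<longleftrightarrow> \<tau> i < \<tau> j" "i < (n::nat)"
  shows "\<tau> i = i"
  using assms(3)
proof (induction i rule: less_induct)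
  case (less i)
  have "\<not> \<tau> i < i"
  proof
    assume l: "\<tau> i < i"
    then have "\<tau> (\<tau> i) = \<tau> i" using less by simp
    then show False using assms(2)[of "\<tau> i" i] l less.prems by simp
  qed
  moreover have "\<not> i < \<tau> i"
  proof
    assume l: "i < \<tau> i"
    have "i \<in> \<tau> ` {..<n}" using assms(1) less.prems unfolding bij_betw_def by simp
    then obtain j where j: "j < n" "\<tau> j = i" by blast
    then have "j < i" using assms(2)[of j i] l less.prems by simp
    then show False using less.IH[of j] j by simp
  qed
  ultimately show ?case by simp
qed

text \<open>A word of length one would encode an indecomposable permutation rather than a
  sum.\<close>

definition mono_words :: "unit list set" where
  "mono_words = lists {()} - {w \<in> lists {()}. length w \<le> 1}"

lemma mono_words_iff: "w \<in> mono_words \<longleftrightarrow> 2 \<le> length w"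
  unfolding mono_words_def by auto

lemma regular_mono_words: "regular {()} mono_words"
  unfolding mono_words_def
proof (intro regular_Diff regular_lists regular_downset)
  fix u v :: "unit list" assume "v \<in> {w \<in> lists {()}. length w \<le> 1}" "subseq u v"
  then show "u \<in> {w \<in> lists {()}. length w \<le> 1}" using list_emb_length[of "(=)" u v] by auto
qed auto

lemma rigid_mono_words: "skeleton.rigid mono_kx (mono_ky r) mono_words"
proof -
  interpret skeleton mono_kx "mono_ky r" by (rule skeleton_mono)
  show ?thesis
    unfolding rigid_def
  proof (intro ballI allI impI, elim conjE)
    fix w w' :: "unit list" and \<tau>
    assume bij: "bij_betw \<tau> {..<length w} {..<length w'}"
      and emb: "embeds \<tau> {..<length w} (mono_kx w) (mono_ky r w) {..<length w'} (mono_kx w') (mono_ky r w')"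
    have len: "length w = length w'" using bij_betw_same_card[OF bij] by simp
    have "i < j \<longleftrightarrow> \<tau> i < \<tau> j" if "i < length w" "j < length w" for i j
      using emb that unfolding embeds_def mono_kx_def by simp
    then have "\<tau> i = i" if "i < length w" for i using mono_bij_id[of \<tau> "length w" i] bij len that by simp
    moreover have "w = w'" using len by (intro nth_equalityI) auto
    ultimately show "w = w' \<and> (\<forall>i<length w. \<tau> i = i)" by blast
  qed
qed

lemma mono_before:
  assumes "i < length w" "j < length w"
  shows "before r (mono_kx w) (mono_ky r w) i j \<longleftrightarrow> i < j"
  using assms unfolding before_def mono_kx_def mono_ky_def by auto

lemma (in skeleton) shape_block:
  assumes "perm_word u" "i < length u"
  shows "shape (snd (u ! i)) {p \<in> ipts u. fst p = i} (ix u) (iy u)"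
proof -
  have "bij_betw (Pair i) {..<length (snd (u ! i))} {p \<in> ipts u. fst p = i}"
    unfolding bij_betw_def using assms(2) by (auto simp: ipts_iff inj_on_def image_iff)
  moreover have "embeds (Pair i) {..<length (snd (u ! i))} (\<lambda>i. i) (nth (snd (u ! i))) {p \<in> ipts u. fst p = i} (ix u) (iy u)"
    unfolding embeds_def using assms(2) by (auto simp: ipts_iff ix_less iy_less[OF assms(1)])
  ultimately show ?thesis unfolding shape_def using perm_word_nth(1)[OF assms] by blast
qed

lemma (in skeleton) before_ipts:
  assumes "perm_word u" "p \<in> ipts u" "q \<in> ipts u" "fst p \<noteq> fst q"
  shows "before r (ix u) (iy u) p q \<longleftrightarrow> before r (kx (map fst u)) (ky (map fst u)) (fst p) (fst q)"
  using assms unfolding before_def ix_less[OF assms(2,3)] iy_less[OF assms(1-3)] iy_less[OF assms(1,3,2)]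
  by auto

text \<open>Belonging to the same \<open>component\<close> serves as the relation \<open>E\<close>
  of \<open>infl_inj\<close>. Indecomposability of the members of \<open>U\<close> ensures that the
  blocks of a word are the components and not coarser sets.\<close>

theorem strongly_rational_series:
  assumes U: "strongly_rational_wqo pattern_le length U"
    and Uperm: "\<And>\<alpha>. \<alpha> \<in> U \<Longrightarrow> is_perm \<alpha> \<and> \<alpha> \<noteq> [] \<and> \<not> perm_has_cut r \<alpha>"
    and C: "\<And>\<pi> \<sigma>. \<pi> \<in> C \<Longrightarrow> is_perm \<sigma> \<Longrightarrow> contains_pattern \<pi> \<sigma> \<Longrightarrow> \<sigma> \<in> C"
    and Cperm: "\<And>\<pi>. \<pi> \<in> C \<Longrightarrow> is_perm \<pi>"
    and blocks: "\<And>\<pi> p \<alpha>. \<pi> \<in> C \<Longrightarrow> perm_has_cut r \<pi> \<Longrightarrow> p < length \<pi> \<Longrightarrow>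
      shape \<alpha> (component r {..<length \<pi>} (\<lambda>i. i) (nth \<pi>) p) (\<lambda>i. i) (nth \<pi>) \<Longrightarrow> \<alpha> \<in> U"
  shows "strongly_rational_wqo pattern_le length {\<pi> \<in> C. perm_has_cut r \<pi>}"
proof -
  interpret skeleton mono_kx "mono_ky r" by (rule skeleton_mono)
  define L where "L = {u \<in> lists ({()} \<times> U). map fst u \<in> mono_words}"
  have L: "perm_word u \<and> map fst u \<in> mono_words" if "u \<in> L" for u
    using that Uperm unfolding L_def perm_word_def by (fastforce simp: mem_Times_iff)
  have cutD: "cut r (ipts u) (ix u) (iy u) {p \<in> ipts u. fst p \<le> i}" if u: "perm_word u" for u i
    unfolding cut_def
  proof (intro conjI ballI)
    fix p q assume pq: "p \<in> {p \<in> ipts u. fst p \<le> i}" "q \<in> ipts u - {p \<in> ipts u. fst p \<le> i}"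
    then have "fst p < fst q" "p \<in> ipts u" "q \<in> ipts u" by auto
    then show "before r (ix u) (iy u) p q"
      using before_ipts[OF u] mono_before[of "fst p" "map fst u" "fst q" r] unfolding ipts_iff by auto
  qed blast
  have comp: "fst p = fst q \<longleftrightarrow> q \<in> component r (ipts u) (ix u) (iy u) p"
    if u: "u \<in> L" and p: "p \<in> ipts u" and q: "q \<in> ipts u" for u p q
  proof
    assume eq: "fst p = fst q"
    have pw: "perm_word u" using L[OF u] by blast
    define B where "B = {z \<in> ipts u. fst z = fst p}"
    have i: "fst p < length u" using p unfolding ipts_iff by blast
    have "snd (u ! fst p) \<in> U" using u i unfolding L_def by (auto dest!: nth_mem simp: mem_Times_iff)
    then have nc: "\<not> has_cut r B (ix u) (iy u)"
      using shape_has_cut[OF shape_block[OF pw i]] Uperm unfolding B_def by blast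
    have "p \<in> D \<longleftrightarrow> q \<in> D" if D: "cut r (ipts u) (ix u) (iy u) D" for D
    proof (rule ccontr)
      assume n: "\<not> ?thesis"
      have "cut r B (ix u) (iy u) (D \<inter> B)" using D unfolding cut_def B_def by blast
      moreover have "D \<inter> B \<noteq> {}" "D \<inter> B \<noteq> B" using n p q eq unfolding B_def by auto
      ultimately show False using nc unfolding has_cut_def by blast
    qed
    then show "q \<in> component r (ipts u) (ix u) (iy u) p" using q unfolding component_def by blast
  next
    assume c: "q \<in> component r (ipts u) (ix u) (iy u) p"
    have pw: "perm_word u" using L[OF u] by blast
    have "p \<in> D \<longleftrightarrow> q \<in> D" if D: "cut r (ipts u) (ix u) (iy u) D" for D
      using c D unfolding component_def by blast
    from this[OF cutD[OF pw, of "fst p"]] this[OF cutD[OF pw, of "fst q"]]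
    show "fst p = fst q" using p q by simp
  qed
  have inj: "inj_on infl L"
  proof (rule infl_inj[OF rigid_mono_words, where E = "\<lambda>P x y p q. q \<in> component r P x y p"])
    show "(q \<in> component r P x y p) = (f q \<in> component r Q x' y' (f p))"
      if "bij_betw f P Q" "embeds f P x y Q x' y'" "p \<in> P" "q \<in> P" for P x y Q x' y' f p q
      by (rule component_iso[OF that])
  qed (use comp L in blast)+
  have "C \<inter> infl ` L = {\<pi> \<in> C. perm_has_cut r \<pi>}"
  proof (intro equalityI subsetI)
    fix \<pi> assume "\<pi> \<in> C \<inter> infl ` L"
    then obtain u where u: "\<pi> \<in> C" "u \<in> L" "\<pi> = infl u" by blast
    have pw: "perm_word u" and len: "2 \<le> length u" using L[OF u(2)] mono_words_iff by auto
    have "0 < length u" "1 < length u" using len by linarith+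
    then have z: "(0, 0) \<in> ipts u" "(1, 0) \<in> ipts u"
      using perm_word_nth(2)[OF pw, of 0] perm_word_nth(2)[OF pw, of 1] unfolding ipts_iff by auto
    have "(0, 0) \<in> {p \<in> ipts u. fst p \<le> 0}" "(1, 0) \<notin> {p \<in> ipts u. fst p \<le> 0}" using z by auto
    then have "{p \<in> ipts u. fst p \<le> 0} \<noteq> {}" "{p \<in> ipts u. fst p \<le> 0} \<noteq> ipts u"
      using z by blast+
    then have "has_cut r (ipts u) (ix u) (iy u)" using cutD[OF pw, of 0] unfolding has_cut_def by blast
    then show "\<pi> \<in> {\<pi> \<in> C. perm_has_cut r \<pi>}" using shape_has_cut[OF shape_infl[OF pw]] u by blast
  next
    fix \<pi> assume "\<pi> \<in> {\<pi> \<in> C. perm_has_cut r \<pi>}"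
    then have \<pi>: "\<pi> \<in> C" "perm_has_cut r \<pi>" by auto
    define P where "P = {..<length \<pi>}"
    define comp where "comp p = component r P (\<lambda>i. i) (nth \<pi>) p" for p
    \<comment> \<open>The least position identifies a component and orders the components from left
      to right.\<close>
    define c where "c p = Min (comp p)" for p
    have pts: "points P (\<lambda>i. i) (nth \<pi>)" unfolding P_def by (rule points_perm[OF Cperm[OF \<pi>(1)]])
    have fin: "finite P" unfolding P_def by simp
    have compP: "comp p \<subseteq> P" for p unfolding comp_def by (rule component_subset)
    have finc: "finite (comp p)" for p by (rule finite_subset[OF compP fin])
    have self: "p \<in> comp p" if "p \<in> P" for p unfolding comp_def by (rule component_self[OF that])
    have cin: "c p \<in> comp p" if "p \<in> P" for p using Min_in[OF finc, of p] self[OF that] unfolding c_def by blast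
    have ceq: "comp q = comp p" if "q \<in> comp p" for p q
      using that unfolding comp_def by (rule component_eq)
    have cc: "c p = c q \<longleftrightarrow> comp p = comp q" if "p \<in> P" "q \<in> P" for p q
    proof
      assume "c p = c q"
      then show "comp p = comp q" using ceq[OF cin[OF that(1)]] ceq[OF cin[OF that(2)]] by simp
    qed (simp add: c_def)
    obtain b where b: "b ` P = {..<card (c ` P)}" "\<And>p q. p \<in> P \<Longrightarrow> q \<in> P \<Longrightarrow> b p < b q \<longleftrightarrow> c p < c q"
      using ex_rank[OF fin, of c] by blast
    have beq: "b p = b q \<longleftrightarrow> comp p = comp q" if "p \<in> P" "q \<in> P" for p q
      using b(2)[OF that] b(2)[OF that(2,1)] cc[OF that] by (metis linorder_neqE_nat order_less_irrefl)
    have bef: "before r (\<lambda>i. i) (nth \<pi>) p q \<longleftrightarrow> b p < b q" if pq: "p \<in> P" "q \<in> P" "b p \<noteq> b q" for p q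
    proof -
      have "q \<notin> comp p" using beq[OF pq(1,2)] pq(3) ceq by blast
      then consider "\<forall>p'\<in>comp p. \<forall>q'\<in>comp q. before r (\<lambda>i. i) (nth \<pi>) p' q'"
        | "\<forall>p'\<in>comp p. \<forall>q'\<in>comp q. before r (\<lambda>i. i) (nth \<pi>) q' p'"
        using component_before[OF pq(1,2), of r "\<lambda>i. i" "nth \<pi>"] unfolding comp_def by blast
      then show ?thesis
      proof cases
        case 1
        then have "c p < c q" using cin pq unfolding before_def by blast
        then show ?thesis using 1 self pq b(2) by blast
      next
        case 2
        then have "c q < c p" using cin pq unfolding before_def by blast
        moreover have "before r (\<lambda>i. i) (nth \<pi>) q p" using 2 self pq by blast
        ultimately show ?thesis using b(2)[OF pq(1,2)] unfolding before_def by (auto split: if_splits)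
      qed
    qed
    define w where "w = replicate (card (c ` P)) ()"
    have lw: "length w = card (c ` P)" unfolding w_def by simp
    have "\<exists>u\<in>lists ({()} \<times> U). map fst u = w \<and> \<pi> = infl u"
    proof (rule ex_inflation[OF pts])
      show "shape \<pi> P (\<lambda>i. i) (nth \<pi>)" unfolding P_def by (rule shape_self[OF Cperm[OF \<pi>(1)]])
      show "b ` P = {..<length w}" using b(1) lw by simp
      show "w \<in> lists {()}" by auto
      fix p q assume pq: "p \<in> P" "q \<in> P" "b p \<noteq> b q"
      have bl: "b p < length w" "b q < length w" using b(1) pq lw by auto
      have "before r (\<lambda>i. i) (nth \<pi>) p q \<or> before r (\<lambda>i. i) (nth \<pi>) q p"
        using bef[OF pq] bef[OF pq(2,1)] pq(3) by auto
      then show "(p < q) = (mono_kx w (b p) < mono_kx w (b q)) \<and>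
          (\<pi> ! p < \<pi> ! q) = (mono_ky r w (b p) < mono_ky r w (b q))"
        using pq(3) bef[OF pq] bef[OF pq(2,1)] mono_before[OF bl, of r] mono_before[OF bl(2,1), of r]
        unfolding before_def mono_kx_def by (auto split: if_splits)
    next
      fix i \<alpha> assume i: "i < length w" and sh: "shape \<alpha> {p \<in> P. b p = i} (\<lambda>i. i) (nth \<pi>)"
      obtain p where p: "p \<in> P" "b p = i" using i b(1) lw by (metis imageE lessThan_iff)
      have "{q \<in> P. b q = i} = comp p"
      proof (intro equalityI subsetI)
        fix q assume q: "q \<in> {q \<in> P. b q = i}"
        then have "comp q = comp p" using beq[of q p] p by simp
        then show "q \<in> comp p" using self[of q] q by blast
      next
        fix q assume q: "q \<in> comp p"
        then have "q \<in> P" using compP by blast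
        then show "q \<in> {q \<in> P. b q = i}" using beq[of q p] p ceq[OF q] by simp
      qed
      then show "\<alpha> \<in> U" using blocks[OF \<pi>, of p \<alpha>] p(1) sh unfolding comp_def P_def by simp
    qed
    then obtain u where u: "u \<in> lists ({()} \<times> U)" "map fst u = w" "\<pi> = infl u" by blast
    have "2 \<le> length w"
    proof -
      obtain D where D: "cut r P (\<lambda>i. i) (nth \<pi>) D" "D \<noteq> {}" "D \<noteq> P"
        using \<pi>(2) unfolding has_cut_def P_def by blast
      have "D \<subseteq> P" using D(1) unfolding cut_def by blast
      then obtain p q where pq: "p \<in> D" "q \<in> P" "q \<notin> D" "p \<in> P" using D(2,3) by blast
      have "q \<notin> comp p" using pq D(1) unfolding comp_def component_def by blast
      then have "c p \<noteq> c q" using cc[OF pq(4,2)] self[OF pq(2)] by blast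
      then have "card {c p, c q} = 2" by simp
      moreover have "card {c p, c q} \<le> card (c ` P)" using fin pq by (intro card_mono) auto
      ultimately show ?thesis using lw by simp
    qed
    then have "map fst u \<in> mono_words" unfolding u(2) mono_words_iff .
    then have "u \<in> L" using u(1) unfolding L_def by blast
    then show "\<pi> \<in> C \<inter> infl ` L" using \<pi>(1) u(3) by blast
  qed
  moreover have "strongly_rational_wqo pattern_le length (C \<inter> infl ` L)"
    using inj unfolding L_def
    by (intro strongly_rational_inflations[OF U _ _ regular_mono_words C]) (use Uperm in auto)
  ultimately show ?thesis by simp
qed

section \<open>Inflations of simple permutations\<close>

lemma interval_Un:
  assumes "interval P x y I" "interval P x y J" "c \<in> I" "c \<in> J"
  shows "interval P x y (I \<union> J)"
  unfolding interval_def
proof (intro conjI ballI)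
  show "I \<union> J \<subseteq> P" using assms unfolding interval_def by blast
  fix e assume e: "e \<in> P - (I \<union> J)"
  have I: "((\<forall>p\<in>I. x e < x p) \<or> (\<forall>p\<in>I. x p < x e)) \<and> ((\<forall>p\<in>I. y e < y p) \<or> (\<forall>p\<in>I. y p < y e))"
    using assms(1) e unfolding interval_def by blast
  have J: "((\<forall>p\<in>J. x e < x p) \<or> (\<forall>p\<in>J. x p < x e)) \<and> ((\<forall>p\<in>J. y e < y p) \<or> (\<forall>p\<in>J. y p < y e))"
    using assms(2) e unfolding interval_def by blast
  show "(\<forall>p\<in>I \<union> J. x e < x p) \<or> (\<forall>p\<in>I \<union> J. x p < x e)"
    using I J assms(3,4) by (meson UnE less_asym)
  show "(\<forall>p\<in>I \<union> J. y e < y p) \<or> (\<forall>p\<in>I \<union> J. y p < y e)"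
    using I J assms(3,4) by (meson UnE less_asym)
qed

text \<open>If the two intervals covered \<open>P\<close>, the points outside \<open>I\<close> would
  lie in \<open>J\<close>. A point outside \<open>J\<close> lies in \<open>I\<close> and has all of
  \<open>J\<close> on one side in each coordinate, so the same holds for \<open>I\<close> and its
  complement, and \<open>P\<close> would be a direct or skew sum.\<close>

lemma proper_interval_Un:
  assumes nc: "\<And>r. \<not> has_cut r P x y"
    and I: "interval P x y I" "I \<noteq> P" and J: "interval P x y J" "J \<noteq> P" and c: "c \<in> I" "c \<in> J"
  shows "I \<union> J \<noteq> P"
proof
  assume U: "I \<union> J = P"
  have IP: "I \<subseteq> P" using I(1) unfolding interval_def by blast
  obtain f where f: "f \<in> P - J" using J unfolding interval_def by blast
  obtain e0 where e0: "e0 \<in> P - I" using I(2) IP by blast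
  have cutI: False if "\<forall>p\<in>I. \<forall>e\<in>P - I. before r x y p e" for r
    using nc[of r] that I(2) IP c(1) unfolding has_cut_def cut_def by blast
  have cutI': False if "\<forall>p\<in>I. \<forall>e\<in>P - I. before r x y e p" for r
  proof -
    have "cut r P x y (P - I)" using that IP unfolding cut_def by blast
    moreover have "P - I \<noteq> {}" "P - I \<noteq> P" using e0 c(1) IP by blast+
    ultimately show False using nc[of r] unfolding has_cut_def by blast
  qed
  have fx: "(\<forall>j\<in>J. x f < x j) \<or> (\<forall>j\<in>J. x j < x f)" and fy: "(\<forall>j\<in>J. y f < y j) \<or> (\<forall>j\<in>J. y j < y f)"
    using J(1) f unfolding interval_def by blast+
  have fI: "f \<in> I" using f U by blast
  have ex: "(\<forall>p\<in>I. x e < x p) \<or> (\<forall>p\<in>I. x p < x e)" and ey: "(\<forall>p\<in>I. y e < y p) \<or> (\<forall>p\<in>I. y p < y e)"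
    and eJ: "e \<in> J" if "e \<in> P - I" for e
    using I(1) that U unfolding interval_def by blast+
  have X: "(\<forall>e\<in>P - I. \<forall>p\<in>I. x p < x e) \<or> (\<forall>e\<in>P - I. \<forall>p\<in>I. x e < x p)"
    using fx
  proof
    assume "\<forall>j\<in>J. x f < x j"
    then show ?thesis using ex eJ fI by (meson less_asym)
  next
    assume "\<forall>j\<in>J. x j < x f"
    then show ?thesis using ex eJ fI by (meson less_asym)
  qed
  have Y: "(\<forall>e\<in>P - I. \<forall>p\<in>I. y p < y e) \<or> (\<forall>e\<in>P - I. \<forall>p\<in>I. y e < y p)"
    using fy
  proof
    assume "\<forall>j\<in>J. y f < y j"
    then show ?thesis using ey eJ fI by (meson less_asym)
  next
    assume "\<forall>j\<in>J. y j < y f"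
    then show ?thesis using ey eJ fI by (meson less_asym)
  qed
  from X Y show False
    using cutI[of True] cutI[of False] cutI'[of True] cutI'[of False] unfolding before_def by auto
qed

section \<open>Maximal proper intervals\<close>

definition together :: "'a set \<Rightarrow> ('a \<Rightarrow> nat) \<Rightarrow> ('a \<Rightarrow> nat) \<Rightarrow> 'a \<Rightarrow> 'a \<Rightarrow> bool" where
  "together P x y p q \<longleftrightarrow> (\<exists>I. interval P x y I \<and> I \<noteq> P \<and> p \<in> I \<and> q \<in> I)"

lemma together_iso1:
  assumes "bij_betw f P Q" "embeds f P x y Q x' y'" "p \<in> P" "q \<in> P" "together Q x' y' (f p) (f q)"
  shows "together P x y p q"
proof -
  obtain I where I: "interval Q x' y' I" "I \<noteq> Q" "f p \<in> I" "f q \<in> I"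
    using assms(5) unfolding together_def by blast
  have "{p \<in> P. f p \<in> I} \<noteq> P"
  proof
    assume "{p \<in> P. f p \<in> I} = P"
    then have "f ` P \<subseteq> I" by blast
    then show False using I(1,2) assms(1) unfolding interval_def bij_betw_def by blast
  qed
  then show ?thesis
    using interval_vimage[OF assms(2) I(1)] I(3,4) assms(3,4) unfolding together_def by blast
qed

lemma together_iso:
  assumes "bij_betw f P Q" "embeds f P x y Q x' y'" "p \<in> P" "q \<in> P"
  shows "together P x y p q \<longleftrightarrow> together Q x' y' (f p) (f q)"
proof
  assume t: "together P x y p q"
  have i: "inv_into P f (f p) = p" "inv_into P f (f q) = q"
    using bij_betw_inv_into_left[OF assms(1)] assms(3,4) by auto
  have "f p \<in> Q" "f q \<in> Q" using assms unfolding bij_betw_def by auto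
  then show "together Q x' y' (f p) (f q)"
    using together_iso1[OF bij_betw_inv_into[OF assms(1)] embeds_inv[OF assms(2,1)]] t i by metis
qed (rule together_iso1[OF assms])

definition module :: "'a set \<Rightarrow> ('a \<Rightarrow> nat) \<Rightarrow> ('a \<Rightarrow> nat) \<Rightarrow> 'a \<Rightarrow> 'a set" where
  "module P x y p = {q. together P x y p q}"

text \<open>The finitely many proper intervals through \<open>p\<close> are merged one by one; in
  the absence of cuts the union stays proper.\<close>

lemma module_interval:
  assumes P: "points P x y" "2 \<le> card P" and nc: "\<And>r. \<not> has_cut r P x y" and p: "p \<in> P"
  shows "interval P x y (module P x y p) \<and> module P x y p \<noteq> P \<and> p \<in> module P x y p"
proof -
  define \<I> where "\<I> = {I. interval P x y I \<and> I \<noteq> P \<and> p \<in> I}"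
  have finP: "finite P" using P unfolding points_def by blast
  have fin: "finite \<I>"
    by (rule finite_subset[of _ "Pow P"]) (auto simp: \<I>_def interval_def finP)
  have single: "{p} \<in> \<I>"
  proof -
    have "interval P x y {p}" unfolding interval_def using p points_neq[OF P(1)]
      by (auto simp: neq_iff[symmetric])
    moreover have "{p} \<noteq> P" using P(2) by auto
    ultimately show ?thesis unfolding \<I>_def by blast
  qed
  have "F \<noteq> {} \<longrightarrow> \<Union> F \<in> \<I>" if "finite F" "F \<subseteq> \<I>" for F
    using that
  proof (induction F rule: finite_induct)
    case (insert I F)
    show ?case
    proof (cases "F = {}")
      case True
      then show ?thesis using insert.prems by simp
    next
      case False
      then have "\<Union> F \<in> \<I>" "I \<in> \<I>" using insert by auto
      then have "interval P x y (I \<union> \<Union> F)" "I \<union> \<Union> F \<noteq> P" "p \<in> I"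
        using interval_Un[of P x y I "\<Union> F" p] proper_interval_Un[OF nc, of I "\<Union> F" p] unfolding \<I>_def by auto
      then show ?thesis unfolding \<I>_def by simp
    qed
  qed simp
  then have "\<Union> \<I> \<in> \<I>" using fin single by blast
  moreover have "module P x y p = \<Union> \<I>" unfolding module_def together_def \<I>_def by blast
  ultimately show ?thesis unfolding \<I>_def by simp
qed

lemma module_eq:
  assumes P: "points P x y" "2 \<le> card P" and nc: "\<And>r. \<not> has_cut r P x y" and p: "p \<in> P" and q: "q \<in> module P x y p"
  shows "module P x y q = module P x y p"
proof -
  have mp: "interval P x y (module P x y p)" "module P x y p \<noteq> P" "p \<in> module P x y p"
    using module_interval[OF P nc p] by auto
  have qP: "q \<in> P" using q mp(1) unfolding interval_def by blast
  have mq: "interval P x y (module P x y q)" "module P x y q \<noteq> P" "q \<in> module P x y q"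
    using module_interval[OF P nc qP] by auto
  define W where "W = module P x y p \<union> module P x y q"
  have W: "interval P x y W" "W \<noteq> P"
    unfolding W_def by (rule interval_Un[OF mp(1) mq(1) q mq(3)])
      (rule proper_interval_Un[OF nc mp(1,2) mq(1,2) q mq(3)])
  have "z \<in> module P x y v" if "v \<in> W" "z \<in> W" for v z
    unfolding module_def together_def using W that by blast
  moreover have "p \<in> W" "q \<in> W" using mp(3) mq(3) unfolding W_def by auto
  ultimately have "W \<subseteq> module P x y p" "W \<subseteq> module P x y q" by blast+
  then show ?thesis unfolding W_def by blast
qed

lemma cliques_le_neighbour:
  assumes P: "finite P" "cliques_le (Suc k) P x y" and B: "B \<subseteq> P" "e \<in> P" "\<And>b. b \<in> B \<Longrightarrow> adj x y e b"
  shows "cliques_le k B x y"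
  unfolding cliques_le_def
proof (intro allI impI)
  fix A assume A: "A \<subseteq> B" "clique x y A"
  have "clique x y (insert e A)"
    unfolding clique_def using A B(3) adj_sym[of x y] unfolding clique_def by blast
  moreover have "insert e A \<subseteq> P" using A B by blast
  ultimately have "card (insert e A) \<le> Suc k" using P(2) unfolding cliques_le_def by blast
  moreover have "e \<notin> A" using A(1) B(3)[of e] unfolding adj_iff by auto
  moreover have "finite A" using A(1) B(1) P(1) by (meson finite_subset)
  ultimately show "card A \<le> k" by simp
qed

text \<open>Otherwise every outside point is before or after all of \<open>I\<close> in the
  increasing order, so the points before \<open>I\<close> form a cut, both with and without
  \<open>I\<close> added. Neither can be a proper cut, which leaves only
  \<open>I = P\<close>.\<close>

lemma interval_neighbour:
  assumes P: "points P x y" and nc: "\<not> has_cut True P x y" and I: "interval P x y I" "I \<noteq> P" "c \<in> I"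
  shows "\<exists>e\<in>P. \<forall>b\<in>I. adj x y e b"
proof (rule ccontr)
  assume n: "\<not> ?thesis"
  have IP: "I \<subseteq> P" using I(1) unfolding interval_def by blast
  have side: "(\<forall>b\<in>I. before True x y e b) \<or> (\<forall>b\<in>I. before True x y b e)" if "e \<in> P - I" for e
  proof -
    have "((\<forall>p\<in>I. x e < x p) \<or> (\<forall>p\<in>I. x p < x e)) \<and> ((\<forall>p\<in>I. y e < y p) \<or> (\<forall>p\<in>I. y p < y e))"
      using I(1) that unfolding interval_def by blast
    moreover have "\<not> (\<forall>b\<in>I. adj x y e b)" using n that by blast
    ultimately show ?thesis unfolding adj_iff before_def by auto
  qed
  define D where "D = {e \<in> P - I. \<forall>b\<in>I. before True x y e b}"
  have c1: "cut True P x y D"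
    unfolding cut_def
  proof (intro conjI ballI)
    fix d e assume d: "d \<in> D" and e: "e \<in> P - D"
    show "before True x y d e"
    proof (cases "e \<in> I")
      case False
      then have "before True x y c e" using side[of e] e I(3) unfolding D_def by blast
      moreover have "before True x y d c" using d I(3) unfolding D_def by blast
      ultimately show ?thesis using before_trans by metis
    qed (use d in \<open>auto simp: D_def\<close>)
  qed (auto simp: D_def)
  have c2: "cut True P x y (D \<union> I)"
    unfolding cut_def
  proof (intro conjI ballI)
    fix d e assume d: "d \<in> D \<union> I" and e: "e \<in> P - (D \<union> I)"
    have ae: "\<forall>b\<in>I. before True x y b e" using side[of e] e unfolding D_def by blast
    show "before True x y d e"
    proof (cases "d \<in> I")
      case False
      then have "before True x y d c" using d I(3) unfolding D_def by blast
      then show ?thesis using ae I(3) before_trans by metis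
    qed (use ae in blast)
  qed (use IP in \<open>auto simp: D_def\<close>)
  have "D \<union> I = P" using nc c2 I(3) unfolding has_cut_def by blast
  moreover have "D = {}"
  proof -
    have "D \<noteq> P" using I(3) IP unfolding D_def by blast
    then show ?thesis using nc c1 unfolding has_cut_def by blast
  qed
  ultimately show False using I(2) by simp
qed

section \<open>The classes indexed by the length of the forbidden decreasing permutation\<close>

definition Cl :: "nat \<Rightarrow> nat list set" where
  "Cl l = Av {[2, 4, 1, 5, 3], [3, 1, 5, 2, 4], decreasing_perm l}"

lemma Cl_perm: "\<pi> \<in> Cl l \<Longrightarrow> is_perm \<pi>"
  unfolding Cl_def Av_def by blast

lemma Cl_closed: "\<pi> \<in> Cl l \<Longrightarrow> is_perm \<sigma> \<Longrightarrow> contains_pattern \<pi> \<sigma> \<Longrightarrow> \<sigma> \<in> Cl l"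
  unfolding Cl_def Av_def using contains_pattern_trans by blast

lemma Cl_Suc_iff:
  assumes "shape \<pi> P x y" "points P x y"
  shows "\<pi> \<in> Cl (Suc k) \<longleftrightarrow> \<not> contains_pattern \<pi> [2, 4, 1, 5, 3] \<and> \<not> contains_pattern \<pi> [3, 1, 5, 2, 4] \<and>
    cliques_le k P x y"
  using assms cliques_le_iff[OF assms, of k] unfolding Cl_def Av_def shape_def by auto

lemma Cl_0: "Cl 0 = {}"
proof -
  have "contains_pattern \<pi> (decreasing_perm 0)" for \<pi>
    unfolding contains_pattern_nth by (simp add: strict_mono_on_def)
  then show ?thesis unfolding Cl_def Av_def by blast
qed

text \<open>Every clique in \<open>B\<close> extends by \<open>e\<close>, so the clique number
  drops; this is what drives the induction on \<open>l\<close>.\<close>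

lemma Cl_neighbour:
  assumes \<pi>: "\<pi> \<in> Cl (Suc l)" "shape \<pi> P x y" "points P x y"
    and B: "B \<subseteq> P" "e \<in> P" "\<And>b. b \<in> B \<Longrightarrow> adj x y e b" "B \<noteq> {}" and sh: "shape \<alpha> B x y"
  shows "\<alpha> \<in> Cl l \<and> \<alpha> \<noteq> []"
proof -
  have pB: "points B x y" by (rule points_subset[OF \<pi>(3) B(1)])
  have finB: "finite B" and finP: "finite P" using pB \<pi>(3) unfolding points_def by auto
  have cl: "cliques_le l P x y" using Cl_Suc_iff[OF \<pi>(2,3)] \<pi>(1) by blast
  have "embeds id B x y P x y" unfolding embeds_def using B(1) by auto
  then have "contains_pattern \<pi> \<alpha>" by (rule shape_embeds_contains[OF \<pi>(2) sh])
  then have "\<alpha> \<in> Cl (Suc l)" using Cl_closed[OF \<pi>(1)] sh unfolding shape_def by blast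
  then have av: "\<not> contains_pattern \<alpha> [2, 4, 1, 5, 3]" "\<not> contains_pattern \<alpha> [3, 1, 5, 2, 4]"
    using Cl_Suc_iff[OF sh pB] by blast+
  have "\<alpha> \<noteq> []" using shape_length[OF sh] B(4) finB by auto
  moreover have "\<alpha> \<in> Cl l"
  proof (cases l)
    case 0
    have "card {e} \<le> 0" using cl B(2) unfolding 0 cliques_le_def clique_def by blast
    then show ?thesis by simp
  next
    case (Suc k)
    have "cliques_le k B x y" by (rule cliques_le_neighbour[OF finP cl[unfolded Suc] B(1-3)])
    then show ?thesis using Cl_Suc_iff[OF sh pB] av unfolding Suc by blast
  qed
  ultimately show ?thesis by blast
qed

context grid_words
begin

text \<open>A proper interval that meets two blocks meets all of them, since its trace on the simple
  skeleton is an interval with two points. It misses some point, say of block \<open>i\<close>; then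
  in each coordinate the other letters all lie on one side of \<open>i\<close>, and they form a
  proper interval with at least two points because there are three letters.\<close>

lemma together_inflation:
  assumes pw: "perm_word u" and C: "map fst u \<in> Can" and p: "p \<in> ipts u" and q: "q \<in> ipts u"
  shows "fst p = fst q \<longleftrightarrow> together (ipts u) (ix u) (iy u) p q"
proof
  have len: "3 \<le> length u" and simple: "simple {..<length u} (kx (map fst u)) (ky (map fst u))"
    using C unfolding Can_iff by auto
  have base: "(i, 0) \<in> ipts u" if "i < length u" for i
    using perm_word_nth(2)[OF pw that] that unfolding ipts_iff by simp
  have X: "ix u z < ix u z' \<longleftrightarrow> kx (map fst u) (fst z) < kx (map fst u) (fst z')"
    and Y: "iy u z < iy u z' \<longleftrightarrow> ky (map fst u) (fst z) < ky (map fst u) (fst z')"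
    if "z \<in> ipts u" "z' \<in> ipts u" "fst z \<noteq> fst z'" for z z'
    using ix_less[OF that(1,2)] iy_less[OF pw that(1,2)] that(3) by auto
  {
    assume eq: "fst p = fst q"
    define I where "I = {z \<in> ipts u. fst z = fst p}"
    have "interval (ipts u) (ix u) (iy u) I"
      unfolding interval_def
    proof (intro conjI ballI)
      fix e assume e: "e \<in> ipts u - I"
      have ne: "fst e < length u" "fst p < length u" "fst e \<noteq> fst p"
        using e p unfolding I_def by (auto simp: ipts_iff)
      have "kx (map fst u) (fst e) \<noteq> kx (map fst u) (fst p)" "ky (map fst u) (fst e) \<noteq> ky (map fst u) (fst p)"
        using points_neq[OF points_word[of "map fst u"], of "fst e" "fst p"] ne by auto
      then show "(\<forall>p\<in>I. ix u e < ix u p) \<or> (\<forall>p\<in>I. ix u p < ix u e)"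
        "(\<forall>p\<in>I. iy u e < iy u p) \<or> (\<forall>p\<in>I. iy u p < iy u e)"
        using e ne(3) unfolding I_def by (auto simp: X Y)
    qed (auto simp: I_def)
    moreover have "I \<noteq> ipts u"
    proof -
      obtain j where j: "j < length u" "j \<noteq> fst p"
        using len by (metis One_nat_def less_numeral_extra(1) numeral_3_eq_3 less_le_trans zero_less_Suc Suc_less_eq zero_neq_one)
      then have "(j, 0) \<in> ipts u" "(j, 0) \<notin> I" using base unfolding I_def by auto
      then show ?thesis by blast
    qed
    ultimately show "together (ipts u) (ix u) (iy u) p q"
      using p q eq unfolding together_def I_def by auto
  next
    assume "together (ipts u) (ix u) (iy u) p q"
    then obtain I where I: "interval (ipts u) (ix u) (iy u) I" "I \<noteq> ipts u" "p \<in> I" "q \<in> I"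
      unfolding together_def by blast
    have Isub: "I \<subseteq> ipts u" using I(1) unfolding interval_def by blast
    have side: "((\<forall>p\<in>I. ix u e < ix u p) \<or> (\<forall>p\<in>I. ix u p < ix u e)) \<and>
        ((\<forall>p\<in>I. iy u e < iy u p) \<or> (\<forall>p\<in>I. iy u p < iy u e))" if "e \<in> ipts u" "e \<notin> I" for e
      using I(1) that unfolding interval_def by blast
    show "fst p = fst q"
    proof (rule ccontr)
      assume ne: "fst p \<noteq> fst q"
      define J where "J = fst ` I"
      have "fst z < length u" if "z \<in> I" for z using that Isub ipts_iff[of z u] by blast
      then have Jsub: "J \<subseteq> {..<length u}" unfolding J_def by auto
      have "interval {..<length u} (kx (map fst u)) (ky (map fst u)) J"
        unfolding interval_def
      proof (intro conjI ballI Jsub)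
        fix e assume e: "e \<in> {..<length u} - J"
        then have eb: "(e, 0) \<in> ipts u" "(e, 0) \<notin> I" using base unfolding J_def by force+
        have "(ix u (e, 0) < ix u z \<longleftrightarrow> kx (map fst u) e < kx (map fst u) (fst z)) \<and>
          (ix u z < ix u (e, 0) \<longleftrightarrow> kx (map fst u) (fst z) < kx (map fst u) e) \<and>
          (iy u (e, 0) < iy u z \<longleftrightarrow> ky (map fst u) e < ky (map fst u) (fst z)) \<and>
          (iy u z < iy u (e, 0) \<longleftrightarrow> ky (map fst u) (fst z) < ky (map fst u) e)" if z: "z \<in> I" for z
        proof -
          have zi: "z \<in> ipts u" using z Isub by blast
          have "fst z \<noteq> e" using e z unfolding J_def by blast
          then have n: "fst (e, 0 :: nat) \<noteq> fst z" "fst z \<noteq> fst (e, 0 :: nat)" by auto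
          show ?thesis using X[OF eb(1) zi n(1)] X[OF zi eb(1) n(2)] Y[OF eb(1) zi n(1)] Y[OF zi eb(1) n(2)]
            by simp
        qed
        then show "(\<forall>p\<in>J. kx (map fst u) e < kx (map fst u) p) \<or> (\<forall>p\<in>J. kx (map fst u) p < kx (map fst u) e)"
          "(\<forall>p\<in>J. ky (map fst u) e < ky (map fst u) p) \<or> (\<forall>p\<in>J. ky (map fst u) p < ky (map fst u) e)"
          using side[OF eb] unfolding J_def by auto
      qed
      moreover have "\<not> card J \<le> 1"
      proof -
        have "card {fst p, fst q} \<le> card J"
          using I(3,4) Jsub by (intro card_mono) (auto simp: J_def intro: finite_subset)
        then show ?thesis using ne by simp
      qed
      ultimately have J: "J = {..<length u}" using simple unfolding simple_def by blast
      obtain z0 where z0: "z0 \<in> ipts u" "z0 \<notin> I" using I(2) Isub by blast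
      define i where "i = fst z0"
      have i: "i < length u" using z0(1) unfolding i_def ipts_iff by blast
      have "interval {..<length u} (kx (map fst u)) (ky (map fst u)) ({..<length u} - {i})"
        unfolding interval_def
      proof (intro conjI ballI)
        fix e assume "e \<in> {..<length u} - ({..<length u} - {i})"
        then have e: "e = i" by blast
        have zj: "\<exists>z\<in>I. fst z = j" if "j < length u" for j
        proof -
          have "j \<in> J" using that J by simp
          then show ?thesis unfolding J_def by blast
        qed
        have *: "((\<forall>p\<in>I. ix u z0 < ix u p) \<or> (\<forall>p\<in>I. ix u p < ix u z0)) \<and>
            ((\<forall>p\<in>I. iy u z0 < iy u p) \<or> (\<forall>p\<in>I. iy u p < iy u z0))" by (rule side[OF z0])
        have **: "\<exists>z\<in>I. (ix u z0 < ix u z \<longleftrightarrow> kx (map fst u) i < kx (map fst u) j) \<and>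
            (ix u z < ix u z0 \<longleftrightarrow> kx (map fst u) j < kx (map fst u) i) \<and>
            (iy u z0 < iy u z \<longleftrightarrow> ky (map fst u) i < ky (map fst u) j) \<and>
            (iy u z < iy u z0 \<longleftrightarrow> ky (map fst u) j < ky (map fst u) i)" if j: "j < length u" "j \<noteq> i" for j
        proof -
          obtain z where z: "z \<in> I" "fst z = j" using zj[OF j(1)] by blast
          have zi: "z \<in> ipts u" using z(1) Isub by blast
          have n: "fst z0 \<noteq> fst z" "fst z \<noteq> fst z0" using j(2) z(2) unfolding i_def by auto
          show ?thesis
            using z X[OF z0(1) zi n(1)] X[OF zi z0(1) n(2)] Y[OF z0(1) zi n(1)] Y[OF zi z0(1) n(2)]
            unfolding i_def by (intro bexI[of _ z]) auto
        qed
        have "(\<forall>p\<in>{..<length u} - {i}. kx (map fst u) i < kx (map fst u) p) \<or>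
            (\<forall>p\<in>{..<length u} - {i}. kx (map fst u) p < kx (map fst u) i)"
          using *[THEN conjunct1]
        proof
          assume "\<forall>p\<in>I. ix u z0 < ix u p"
          then have "kx (map fst u) i < kx (map fst u) j" if "j \<in> {..<length u} - {i}" for j
            using **[of j] that by blast
          then show ?thesis by blast
        next
          assume "\<forall>p\<in>I. ix u p < ix u z0"
          then have "kx (map fst u) j < kx (map fst u) i" if "j \<in> {..<length u} - {i}" for j
            using **[of j] that by blast
          then show ?thesis by blast
        qed
        then show "(\<forall>p\<in>{..<length u} - {i}. kx (map fst u) e < kx (map fst u) p) \<or>
            (\<forall>p\<in>{..<length u} - {i}. kx (map fst u) p < kx (map fst u) e)" unfolding e .
        have "(\<forall>p\<in>{..<length u} - {i}. ky (map fst u) i < ky (map fst u) p) \<or>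
            (\<forall>p\<in>{..<length u} - {i}. ky (map fst u) p < ky (map fst u) i)"
          using *[THEN conjunct2]
        proof
          assume "\<forall>p\<in>I. iy u z0 < iy u p"
          then have "ky (map fst u) i < ky (map fst u) j" if "j \<in> {..<length u} - {i}" for j
            using **[of j] that by blast
          then show ?thesis by blast
        next
          assume "\<forall>p\<in>I. iy u p < iy u z0"
          then have "ky (map fst u) j < ky (map fst u) i" if "j \<in> {..<length u} - {i}" for j
            using **[of j] that by blast
          then show ?thesis by blast
        qed
        then show "(\<forall>p\<in>{..<length u} - {i}. ky (map fst u) e < ky (map fst u) p) \<or>
            (\<forall>p\<in>{..<length u} - {i}. ky (map fst u) p < ky (map fst u) e)" unfolding e .
      qed blast
      then have "card ({..<length u} - {i}) \<le> 1 \<or> {..<length u} - {i} = {..<length u}"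
        using simple unfolding simple_def by blast
      then show False using i len by auto
    qed
  }
qed

text \<open>A cut and its complement would be proper intervals, each inside a single block, which
  leaves at most two letters.\<close>

lemma inflation_no_cut:
  assumes pw: "perm_word u" and C: "map fst u \<in> Can"
  shows "\<not> has_cut r (ipts u) (ix u) (iy u)"
proof
  assume "has_cut r (ipts u) (ix u) (iy u)"
  then obtain D where D: "cut r (ipts u) (ix u) (iy u) D" "D \<noteq> {}" "D \<noteq> ipts u" unfolding has_cut_def by blast
  define E where "E = ipts u - D"
  have sub: "D \<subseteq> ipts u" using D(1) unfolding cut_def by blast
  have b: "before r (ix u) (iy u) d e" if "d \<in> D" "e \<in> E" for d e
    using D(1) that unfolding cut_def E_def by blast
  have iD: "interval (ipts u) (ix u) (iy u) D"
    unfolding interval_def using sub b unfolding E_def before_def by (cases r) auto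
  have iE: "interval (ipts u) (ix u) (iy u) E"
    unfolding interval_def using sub b unfolding E_def before_def by (cases r) auto
  have E: "E \<noteq> {}" "E \<noteq> ipts u" "E \<subseteq> ipts u" using D(2,3) sub unfolding E_def by blast+
  have len: "3 \<le> length u" using C unfolding Can_iff by auto
  have same: "fst p = fst q" if "p \<in> D \<and> q \<in> D \<or> p \<in> E \<and> q \<in> E" for p q
    using together_inflation[OF pw C, of p q] that iD iE D(3) E(2,3) sub unfolding together_def by blast
  obtain d e where de: "d \<in> D" "e \<in> E" using D(2) E(1) by blast
  have "i \<in> {fst d, fst e}" if "i < length u" for i
  proof -
    have "(i, 0) \<in> ipts u" using perm_word_nth(2)[OF pw that] that unfolding ipts_iff by simp
    then have "(i, 0) \<in> D \<or> (i, 0) \<in> E" unfolding E_def by blast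
    then show ?thesis using same[of "(i, 0)" d] same[of "(i, 0)" e] de by auto
  qed
  then have "{..<length u} \<subseteq> {fst d, fst e}" by blast
  then have "card {..<length u} \<le> card {fst d, fst e}" by (intro card_mono) auto
  also have "\<dots> \<le> 2" by (simp add: card_insert_if)
  finally show False using len by simp
qed

end

theorem strongly_rational_prime:
  assumes U: "strongly_rational_wqo pattern_le length (Cl l - {[]})"
  shows "strongly_rational_wqo pattern_le length
    {\<pi> \<in> Cl (Suc l). 2 \<le> length \<pi> \<and> (\<forall>r. \<not> perm_has_cut r \<pi>)}"
proof -
  interpret grid_words "grid_bound l" .
  define U where "U = Cl l - {[]}"
  have Uperm: "is_perm \<alpha> \<and> \<alpha> \<noteq> []" if "\<alpha> \<in> U" for \<alpha> using that Cl_perm unfolding U_def by blast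
  define L where "L = {u \<in> lists (S \<times> U). map fst u \<in> Can}"
  have L: "perm_word u \<and> map fst u \<in> Can" if "u \<in> L" for u
    using that Uperm unfolding L_def perm_word_def by (fastforce simp: mem_Times_iff)
  have inj: "inj_on infl L"
  proof (rule infl_inj[OF rigid_Can, where E = together])
    show "together P x y p q = together Q x' y' (f p) (f q)"
      if "bij_betw f P Q" "embeds f P x y Q x' y'" "p \<in> P" "q \<in> P" for P x y Q x' y' f p q
      by (rule together_iso[OF that])
    show "(fst p = fst q) = together (ipts u) (ix u) (iy u) p q"
      if "u \<in> L" "p \<in> ipts u" "q \<in> ipts u" for u p q
      using together_inflation[OF _ _ that(2,3)] L[OF that(1)] by blast
  qed (use L in blast)
  have "Cl (Suc l) \<inter> infl ` L = {\<pi> \<in> Cl (Suc l). 2 \<le> length \<pi> \<and> (\<forall>r. \<not> perm_has_cut r \<pi>)}"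
  proof (intro equalityI subsetI)
    fix \<pi> assume "\<pi> \<in> Cl (Suc l) \<inter> infl ` L"
    then obtain u where u: "\<pi> \<in> Cl (Suc l)" "u \<in> L" "\<pi> = infl u" by blast
    have pw: "perm_word u" and C: "map fst u \<in> Can" using L[OF u(2)] by auto
    have nc: "\<not> perm_has_cut r \<pi>" for r
      using shape_has_cut[OF shape_infl[OF pw]] inflation_no_cut[OF pw C] u(3) by blast
    have len: "3 \<le> length u" using C unfolding Can_iff by auto
    have "length u = (\<Sum>i<length u. 1)" by simp
    also have "\<dots> \<le> (\<Sum>i<length u. length (snd (u ! i)))"
      using perm_word_nth(2)[OF pw] by (intro sum_mono) (simp add: Suc_leI)
    also have "\<dots> = card (ipts u)" unfolding ipts_def by simp
    also have "\<dots> = length \<pi>" using u(3) length_infl[OF pw] by (simp add: card_ipts)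
    finally show "\<pi> \<in> {\<pi> \<in> Cl (Suc l). 2 \<le> length \<pi> \<and> (\<forall>r. \<not> perm_has_cut r \<pi>)}" using u(1) nc len by simp
  next
    fix \<pi> assume "\<pi> \<in> {\<pi> \<in> Cl (Suc l). 2 \<le> length \<pi> \<and> (\<forall>r. \<not> perm_has_cut r \<pi>)}"
    then have \<pi>: "\<pi> \<in> Cl (Suc l)" "2 \<le> length \<pi>" "\<And>r. \<not> perm_has_cut r \<pi>" by auto
    define P where "P = {..<length \<pi>}"
    let ?x = "\<lambda>i::nat. i" and ?y = "nth \<pi>"
    have pts: "points P ?x ?y" unfolding P_def by (rule points_perm[OF Cl_perm[OF \<pi>(1)]])
    have sh: "shape \<pi> P ?x ?y" unfolding P_def by (rule shape_self[OF Cl_perm[OF \<pi>(1)]])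
    have card: "2 \<le> card P" using \<pi>(2) unfolding P_def by simp
    have nc: "\<not> has_cut r P ?x ?y" for r using \<pi>(3) unfolding P_def by blast
    define M where "M p = module P ?x ?y p" for p
    have Mint: "interval P ?x ?y (M p)" "M p \<noteq> P" "p \<in> M p" if "p \<in> P" for p
      using module_interval[OF pts card nc that] unfolding M_def by auto
    have MP: "M p \<subseteq> P" if "p \<in> P" for p using Mint(1)[OF that] unfolding interval_def by blast
    have Meq: "M q = M p" if "p \<in> P" "q \<in> M p" for p q
      using module_eq[OF pts card nc that(1), of q] that(2) unfolding M_def by blast
    have Mproper: "M p = M q" if "interval P ?x ?y I" "I \<noteq> P" "p \<in> I" "q \<in> I" for I p q
    proof -
      have "q \<in> M p" using that unfolding M_def module_def together_def by blast
      moreover have "p \<in> P" using that unfolding interval_def by blast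
      ultimately show ?thesis using Meq by blast
    qed
    \<comment> \<open>The choice depends on the set \<open>M p\<close> alone, so all points of a
      module get the same representative.\<close>
    define rep where "rep p = (SOME q. q \<in> M p)" for p
    have rep: "rep p \<in> M p" if "p \<in> P" for p unfolding rep_def by (rule someI) (rule Mint(3)[OF that])
    have rep_eq: "rep p = rep q \<longleftrightarrow> M p = M q" if "p \<in> P" "q \<in> P" for p q
      using rep[OF that(1)] rep[OF that(2)] Meq[OF that(1)] Meq[OF that(2)] unfolding rep_def by metis
    have repP: "rep p \<in> P" if "p \<in> P" for p using rep[OF that] MP[OF that] by blast
    have repM: "M (rep p) = M p" if "p \<in> P" for p using Meq[OF that rep[OF that]] .
    define Q where "Q = rep ` P"
    have QP: "Q \<subseteq> P" using repP unfolding Q_def by blast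
    have Qneq: "M a \<noteq> M b" if "a \<in> Q" "b \<in> Q" "a \<noteq> b" for a b
      using that rep_eq repM repP unfolding Q_def by (metis imageE)
    have cmp: "(p < q \<longleftrightarrow> rep p < rep q) \<and> (\<pi> ! p < \<pi> ! q \<longleftrightarrow> \<pi> ! rep p < \<pi> ! rep q)"
      if p: "p \<in> P" and q: "q \<in> P" and ne: "M p \<noteq> M q" for p q
    proof -
      have disj: "z \<notin> M q" if "z \<in> M p" for z using Meq[OF p that] Meq[OF q, of z] ne by metis
      have s1: "((\<forall>z\<in>M q. a < z) \<or> (\<forall>z\<in>M q. z < a)) \<and> ((\<forall>z\<in>M q. \<pi> ! a < \<pi> ! z) \<or> (\<forall>z\<in>M q. \<pi> ! z < \<pi> ! a))"
        if "a \<in> M p" for a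
        using Mint(1)[OF q] disj[OF that] that MP[OF p] unfolding interval_def by blast
      have s2: "((\<forall>z\<in>M p. a < z) \<or> (\<forall>z\<in>M p. z < a)) \<and> ((\<forall>z\<in>M p. \<pi> ! a < \<pi> ! z) \<or> (\<forall>z\<in>M p. \<pi> ! z < \<pi> ! a))"
        if "a \<in> M q" for a
        using Mint(1)[OF p] disj that MP[OF q] unfolding interval_def by blast
      have m: "p \<in> M p" "q \<in> M q" "rep p \<in> M p" "rep q \<in> M q" using Mint(3) rep p q by auto
      have "p < q \<longleftrightarrow> p < rep q" "\<pi> ! p < \<pi> ! q \<longleftrightarrow> \<pi> ! p < \<pi> ! rep q"
        using s1[OF m(1)] m(2,4) by (meson less_asym)+
      moreover have "p < rep q \<longleftrightarrow> rep p < rep q" "\<pi> ! p < \<pi> ! rep q \<longleftrightarrow> \<pi> ! rep p < \<pi> ! rep q"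
        using s2[OF m(4)] m(1,3) by (meson less_asym)+
      ultimately show ?thesis by blast
    qed
    have finP: "finite P" unfolding P_def by simp
    have ptsQ: "points Q ?x ?y" by (rule points_subset[OF pts QP])
    \<comment> \<open>A proper interval of representatives with two elements lifts to a proper
      interval of \<open>P\<close> that joins two modules, against their maximality.\<close>
    have simpleQ: "simple Q ?x ?y"
      unfolding simple_def
    proof (intro allI impI, rule ccontr)
      fix I assume I: "interval Q ?x ?y I" "\<not> (card I \<le> 1 \<or> I = Q)"
      have IQ: "I \<subseteq> Q" using I(1) unfolding interval_def by blast
      have finI: "finite I" using IQ QP finP by (meson finite_subset)
      obtain a b where ab: "a \<in> I" "b \<in> I" "a \<noteq> b"
        using I(2) finI by (metis One_nat_def card_le_Suc0_iff_eq)
      define J where "J = {p \<in> P. rep p \<in> I}"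
      have "interval P ?x ?y J"
        unfolding interval_def
      proof (intro conjI ballI)
        fix e assume e: "e \<in> P - J"
        then have eQ: "rep e \<in> Q - I" unfolding J_def Q_def by blast
        have s: "((\<forall>p\<in>I. rep e < p) \<or> (\<forall>p\<in>I. p < rep e)) \<and> ((\<forall>p\<in>I. \<pi> ! rep e < \<pi> ! p) \<or> (\<forall>p\<in>I. \<pi> ! p < \<pi> ! rep e))"
          using I(1) eQ unfolding interval_def by blast
        have "M e \<noteq> M p" if "p \<in> J" for p using that e rep_eq[of e p] unfolding J_def by auto
        then have c: "(e < p \<longleftrightarrow> rep e < rep p) \<and> (\<pi> ! e < \<pi> ! p \<longleftrightarrow> \<pi> ! rep e < \<pi> ! rep p) \<and>
            (p < e \<longleftrightarrow> rep p < rep e) \<and> (\<pi> ! p < \<pi> ! e \<longleftrightarrow> \<pi> ! rep p < \<pi> ! rep e)" if "p \<in> J" for p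
          using cmp[of e p] cmp[of p e] that e unfolding J_def by (metis (mono_tags, lifting) DiffD1 mem_Collect_eq)
        then show "(\<forall>p\<in>J. e < p) \<or> (\<forall>p\<in>J. p < e)" "(\<forall>p\<in>J. \<pi> ! e < \<pi> ! p) \<or> (\<forall>p\<in>J. \<pi> ! p < \<pi> ! e)"
          using s unfolding J_def by auto
      qed (auto simp: J_def)
      moreover have "J \<noteq> P" using I(2) IQ unfolding J_def Q_def by blast
      moreover have rr: "rep z = z" if "z \<in> Q" for z
        using that rep_eq repM repP unfolding Q_def by (metis imageE)
      then have "a \<in> J" "b \<in> J" using ab IQ QP unfolding J_def by auto
      ultimately have "M a = M b" using Mproper by blast
      then show False using Qneq ab IQ by blast
    qed
    \<comment> \<open>With only two modules the permutation would be their direct or skew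
      sum.\<close>
    have "3 \<le> card Q"
    proof (rule ccontr)
      assume "\<not> 3 \<le> card Q"
      then have c2: "card Q \<le> 2" by simp
      have "P \<noteq> {}" using card by auto
      then obtain p where p: "p \<in> P" by blast
      obtain q where q: "q \<in> P" "q \<notin> M p" using Mint(2)[OF p] MP[OF p] by blast
      have ne: "M p \<noteq> M q" using Mint(3)[OF q(1)] q(2) by blast
      have "rep p \<noteq> rep q" using rep_eq[OF p q(1)] ne by blast
      then have "{rep p, rep q} = Q"
        using c2 p q(1) finP unfolding Q_def by (intro card_seteq) auto
      then have all: "M z = M p \<or> M z = M q" if "z \<in> P" for z
        using that rep_eq[OF that p] rep_eq[OF that q(1)] unfolding Q_def by blast
      have side: "before True ?x ?y a b \<or> before True ?x ?y b a \<or> before False ?x ?y a b \<or> before False ?x ?y b a"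
        if "a \<in> P" "b \<in> P" "a \<noteq> b" for a b
        using points_neq[OF pts that] unfolding before_def by auto
      have cmpb: "before r ?x ?y a b \<longleftrightarrow> before r ?x ?y (rep a) (rep b)" if "a \<in> P" "b \<in> P" "M a \<noteq> M b" for r a b
        using cmp[OF that] cmp[OF that(2,1)] that(3) unfolding before_def by auto
      have cutM: False if "a \<in> P" "b \<in> P" "M a \<noteq> M b" "\<And>z. z \<in> P \<Longrightarrow> M z = M a \<or> M z = M b"
          "before r ?x ?y (rep a) (rep b)" for r a b
      proof -
        have "cut r P ?x ?y (M a)"
          unfolding cut_def
        proof (intro conjI ballI MP that(1))
          fix z z' assume z: "z \<in> M a" "z' \<in> P - M a"
          have e: "M z = M a" "z \<in> P" using Meq[OF that(1) z(1)] MP[OF that(1)] z(1) by auto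
          have e': "M z' = M b" "z' \<in> P" using that(4)[of z'] Mint(3)[of z'] z(2) by auto
          have "rep z = rep a" "rep z' = rep b" using rep_eq e e' that by auto
          then show "before r ?x ?y z z'" using cmpb[OF e(2) e'(2)] e e' that(3,5) by simp
        qed
        moreover have "M a \<noteq> {}" "M a \<noteq> P" using Mint[OF that(1)] by auto
        ultimately show False using nc[of r] unfolding has_cut_def by blast
      qed
      show False
        using side[OF repP[OF p] repP[OF q(1)] \<open>rep p \<noteq> rep q\<close>] cutM[OF p q(1) ne all]
          cutM[OF q(1) p ne[symmetric]] all by blast
    qed
    have clP: "cliques_le l P ?x ?y" and free: "P5_free P ?x ?y"
      using Cl_Suc_iff[OF sh pts] \<pi>(1) P5_free_shape[OF sh pts] by blast+
    have clQ: "cliques_le l Q ?x ?y" using clP QP unfolding cliques_le_def by (meson order_trans)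
    have freeQ: "P5_free Q ?x ?y" using free QP unfolding P5_free_def by (meson subsetD)
    obtain col row where good: "good_gridding Q ?x ?y col row"
      "\<And>p. p \<in> Q \<Longrightarrow> col p < grid_bound l \<and> row p < grid_bound l"
      using ex_good_gridding[OF ptsQ freeQ clQ simpleQ] by blast
    obtain w f where w: "w \<in> Can" and f: "bij_betw f {..<length w} Q"
      and emb: "embeds f {..<length w} (kx w) (ky w) Q ?x ?y"
      using ex_Can[OF ptsQ simpleQ \<open>3 \<le> card Q\<close> good] by blast
    define b where "b p = inv_into {..<length w} f (rep p)" for p
    have bij': "bij_betw (inv_into {..<length w} f) Q {..<length w}" by (rule bij_betw_inv_into[OF f])
    have emb': "embeds (inv_into {..<length w} f) Q ?x ?y {..<length w} (kx w) (ky w)" by (rule embeds_inv[OF emb f])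
    have bimg: "b ` P = {..<length w}" using bij' unfolding b_def Q_def bij_betw_def by (simp add: image_image)
    have beq: "b p = b q \<longleftrightarrow> M p = M q" if "p \<in> P" "q \<in> P" for p q
    proof -
      have "b p = b q \<longleftrightarrow> rep p = rep q"
        using bij' that unfolding b_def Q_def bij_betw_def by (metis imageI inj_onD)
      then show ?thesis using rep_eq[OF that] by blast
    qed
    have "\<exists>u\<in>lists (S \<times> U). map fst u = w \<and> \<pi> = infl u"
    proof (rule ex_inflation[OF pts sh bimg])
      show "w \<in> lists S" using w unfolding Can_iff by blast
      fix p q assume pq: "p \<in> P" "q \<in> P" "b p \<noteq> b q"
      have "rep p \<in> Q" "rep q \<in> Q" using pq unfolding Q_def by auto
      then have "(rep p < rep q \<longleftrightarrow> kx w (b p) < kx w (b q)) \<and> (\<pi> ! rep p < \<pi> ! rep q \<longleftrightarrow> ky w (b p) < ky w (b q))"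
        using emb' unfolding embeds_def b_def by blast
      then show "(p < q) = (kx w (b p) < kx w (b q)) \<and> (\<pi> ! p < \<pi> ! q) = (ky w (b p) < ky w (b q))"
        using cmp[OF pq(1,2)] beq[OF pq(1,2)] pq(3) by blast
    next
      fix i \<alpha> assume i: "i < length w" and sh\<alpha>: "shape \<alpha> {p \<in> P. b p = i} ?x ?y"
      obtain p where p: "p \<in> P" "b p = i" using i bimg by (metis imageE lessThan_iff)
      have eq: "{q \<in> P. b q = i} = M p"
      proof (intro equalityI subsetI)
        fix q assume q: "q \<in> {q \<in> P. b q = i}"
        then have "M q = M p" using beq[of q p] p by simp
        then show "q \<in> M p" using Mint(3)[of q] q by blast
      next
        fix q assume q: "q \<in> M p"
        then have "q \<in> P" using MP[OF p(1)] by blast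
        then show "q \<in> {q \<in> P. b q = i}" using beq[of q p] p Meq[OF p(1) q] by simp
      qed
      obtain e where e: "e \<in> P" "\<forall>z\<in>M p. adj ?x ?y e z"
        using interval_neighbour[OF pts nc[of True] Mint[OF p(1)]] by blast
      have "\<alpha> \<in> Cl l \<and> \<alpha> \<noteq> []"
        by (rule Cl_neighbour[OF \<pi>(1) sh pts MP[OF p(1)] e(1)]) (use e(2) Mint(3)[OF p(1)] sh\<alpha> eq in auto)
      then show "\<alpha> \<in> U" unfolding U_def by simp
    qed
    then obtain u where "u \<in> lists (S \<times> U)" "map fst u = w" "\<pi> = infl u" by blast
    then have "u \<in> L" "\<pi> = infl u" using w unfolding L_def by simp_all
    then show "\<pi> \<in> Cl (Suc l) \<inter> infl ` L" using \<pi>(1) by blast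
  qed
  moreover have "strongly_rational_wqo pattern_le length (Cl (Suc l) \<inter> infl ` L)"
    unfolding L_def
    by (rule strongly_rational_inflations[OF U[folded U_def] Uperm finite_S regular_Can Cl_closed inj[unfolded L_def]])
  ultimately show ?thesis by simp
qed

section \<open>Assembling the class from its parts\<close>

lemma strongly_rational_wqo_Un:
  assumes A: "strongly_rational_wqo le sz A" and B: "strongly_rational_wqo le sz B" and disj: "A \<inter> B = {}"
  shows "strongly_rational_wqo le sz (A \<union> B)"
proof -
  have fl: "finite_levels sz A" "finite_levels sz B" and w: "wqo_on le A" "wqo_on le B"
    using A B unfolding strongly_rational_wqo_def by auto
  have "wqo_on le (A \<union> B)"
    unfolding wqo_on_def
  proof (intro conjI allI impI)
    show "transp le" using w(1) unfolding wqo_on_def by blast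
    fix f :: "nat \<Rightarrow> 'a" assume f: "\<forall>i. f i \<in> A \<union> B"
    have *: "\<exists>i j. i < j \<and> le (f i) (f j)" if inf_D: "infinite {i. f i \<in> D}" and w_D: "wqo_on le D" for D
    proof -
      define T where "T = {i. f i \<in> D}"
      have inf: "infinite T" using inf_D unfolding T_def .
      have "f (enumerate T i) \<in> D" for i using enumerate_in_set[OF inf] unfolding T_def by blast
      then obtain i j where "i < j" "le (f (enumerate T i)) (f (enumerate T j))"
        using wqo_onE[OF w_D, of "\<lambda>i. f (enumerate T i)"] by metis
      then show ?thesis using enumerate_mono[OF _ inf] by metis
    qed
    have "UNIV = {i. f i \<in> A} \<union> {i. f i \<in> B}" using f by auto
    then have "infinite {i. f i \<in> A} \<or> infinite {i. f i \<in> B}"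
      using infinite_UNIV_nat by (metis finite_UnI)
    then show "\<exists>i j. i < j \<and> le (f i) (f j)" using * w by blast
  qed
  moreover have "finite_levels sz (A \<union> B)"
  proof -
    have "{a \<in> A \<union> B. sz a = n} = {a \<in> A. sz a = n} \<union> {a \<in> B. sz a = n}" for n by blast
    then show ?thesis using fl unfolding finite_levels_def by simp
  qed
  moreover have "rational_fps (gf sz V)" if V: "upset_in le (A \<union> B) V" for V
  proof -
    have "upset_in le A (V \<inter> A)" "upset_in le B (V \<inter> B)" using V unfolding upset_in_def by blast+
    then have "rational_fps (gf sz (V \<inter> A))" "rational_fps (gf sz (V \<inter> B))"
      using A B unfolding strongly_rational_wqo_def by blast+
    moreover have "gf sz (V \<inter> A \<union> V \<inter> B) = gf sz (V \<inter> A) + gf sz (V \<inter> B)"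
      by (intro gf_Un finite_levels_subset[OF fl(1)] finite_levels_subset[OF fl(2)]) (use disj in auto)
    moreover have "V \<inter> A \<union> V \<inter> B = V" using V unfolding upset_in_def by blast
    ultimately show ?thesis using rational_fps_add by metis
  qed
  ultimately show ?thesis unfolding strongly_rational_wqo_def by blast
qed

lemma gf_singleton: "gf length {a} = fps_of_poly (monom 1 (length a))"
proof -
  have "{b. b = a \<and> length b = n} = (if n = length a then {a} else {})" for n by auto
  then show ?thesis by (auto simp: fps_eq_iff gf_nth)
qed

lemma strongly_rational_at_most_one:
  assumes "T \<subseteq> {[1]}"
  shows "strongly_rational_wqo pattern_le length T"
proof -
  have "wqo_on pattern_le T"
    unfolding wqo_on_def
  proof (intro conjI allI impI transp_pattern_le)
    fix f :: "nat \<Rightarrow> nat list" assume "\<forall>i. f i \<in> T"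
    then have "f 0 = f 1" using assms by (metis singletonD subsetD)
    then show "\<exists>i j. i < j \<and> pattern_le (f i) (f j)"
      unfolding pattern_le_def by (intro exI[of _ 0] exI[of _ 1]) simp
  qed
  moreover have "finite_levels length T"
    unfolding finite_levels_def using assms by (auto intro: finite_subset)
  moreover have "rational_fps (gf length V)" if "upset_in pattern_le T V" for V
  proof -
    have "V = {} \<or> V = {[1]}" using that assms unfolding upset_in_def by blast
    then show ?thesis using gf_singleton[of "[1]"] by (metis gf_empty rational_fps_0 rational_fps_of_poly)
  qed
  ultimately show ?thesis unfolding strongly_rational_wqo_def by blast
qed

lemma perm_length_1: "is_perm \<pi> \<Longrightarrow> length \<pi> = 1 \<Longrightarrow> \<pi> = [1]"
  unfolding is_perm_iff by (cases \<pi>) auto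

lemma perm_has_cut_length: "perm_has_cut r \<pi> \<Longrightarrow> 2 \<le> length \<pi>"
proof -
  assume "perm_has_cut r \<pi>"
  then obtain D where D: "D \<subseteq> {..<length \<pi>}" "D \<noteq> {}" "D \<noteq> {..<length \<pi>}"
    unfolding has_cut_def cut_def by blast
  then obtain p q where "p < length \<pi>" "q < length \<pi>" "p \<noteq> q" by blast
  then show ?thesis by linarith
qed

lemma component_neighbour:
  assumes "points P x y" "has_cut False P x y" "p \<in> P"
  shows "\<exists>e\<in>P. \<forall>b\<in>component False P x y p. adj x y e b"
proof -
  obtain D where D: "cut False P x y D" "D \<noteq> {}" "D \<noteq> P" using assms(2) unfolding has_cut_def by blast
  have "D \<subseteq> P" using D(1) unfolding cut_def by blast
  then obtain e where e: "e \<in> P" "e \<notin> component False P x y p"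
    using D assms(3) unfolding component_def by blast
  then show ?thesis
    using component_before[OF assms(3) e(1,2)] component_self[OF e(1), of False x y] unfolding adj_def by blast
qed

text \<open>The blocks of a skew sum are skew indecomposable members of the previous class, so these
  are carried along in the induction. They cannot be read off from the first conjunct, because skew
  indecomposability is preserved neither upwards nor downwards by containment.\<close>

theorem strongly_rational_Cl:
  "strongly_rational_wqo pattern_le length (Cl l - {[]}) \<and>
   strongly_rational_wqo pattern_le length {\<pi> \<in> Cl l - {[]}. \<not> perm_has_cut False \<pi>}"
proof (induction l)
  case 0
  have "strongly_rational_wqo pattern_le length {}" by (rule strongly_rational_at_most_one) simp
  moreover have "{\<pi> \<in> Cl 0 - {[]}. \<not> perm_has_cut False \<pi>} = {}" "Cl 0 - {[]} = {}" using Cl_0 by auto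
  ultimately show ?case by (simp only:)
next
  case (Suc l)
  let ?SR = "strongly_rational_wqo pattern_le length"
  define one where "one = {\<pi> \<in> Cl (Suc l). length \<pi> = 1}"
  define prime where "prime = {\<pi> \<in> Cl (Suc l). 2 \<le> length \<pi> \<and> (\<forall>r. \<not> perm_has_cut r \<pi>)}"
  define ser where "ser r = {\<pi> \<in> Cl (Suc l). perm_has_cut r \<pi>}" for r
  have one: "?SR one"
    by (rule strongly_rational_at_most_one) (use perm_length_1 Cl_perm in \<open>auto simp: one_def\<close>)
  have prime: "?SR prime" unfolding prime_def by (rule strongly_rational_prime) (use Suc in blast)
  have skew: "?SR (ser False)"
    unfolding ser_def
  proof (rule strongly_rational_series[where U = "{\<pi> \<in> Cl l - {[]}. \<not> perm_has_cut False \<pi>}"])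
    fix \<pi> p \<alpha> assume \<pi>: "\<pi> \<in> Cl (Suc l)" "perm_has_cut False \<pi>" and p: "p < length \<pi>"
      and sh: "shape \<alpha> (component False {..<length \<pi>} (\<lambda>i. i) (nth \<pi>) p) (\<lambda>i. i) (nth \<pi>)"
    define P where "P = {..<length \<pi>}"
    define B where "B = component False P (\<lambda>i. i) (nth \<pi>) p"
    have pP: "p \<in> P" using p unfolding P_def by simp
    have pts: "points P (\<lambda>i. i) (nth \<pi>)" unfolding P_def by (rule points_perm[OF Cl_perm[OF \<pi>(1)]])
    have sh': "shape \<pi> P (\<lambda>i. i) (nth \<pi>)" unfolding P_def by (rule shape_self[OF Cl_perm[OF \<pi>(1)]])
    obtain e where e: "e \<in> P" "\<forall>b\<in>B. adj (\<lambda>i. i) (nth \<pi>) e b"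
      using component_neighbour[OF pts _ pP] \<pi>(2) unfolding P_def B_def by blast
    have "\<alpha> \<in> Cl l \<and> \<alpha> \<noteq> []"
    proof (rule Cl_neighbour[OF \<pi>(1) sh' pts _ e(1)])
      show "B \<subseteq> P" unfolding B_def by (rule component_subset)
      show "B \<noteq> {}" using component_self[OF pP] unfolding B_def by blast
      show "shape \<alpha> B (\<lambda>i. i) (nth \<pi>)" using sh unfolding B_def P_def .
    qed (use e(2) in blast)
    moreover have "\<not> perm_has_cut False \<alpha>"
      using shape_has_cut[OF sh] component_no_cut[OF _ pP] unfolding has_cut_def P_def by blast
    ultimately show "\<alpha> \<in> {\<pi> \<in> Cl l - {[]}. \<not> perm_has_cut False \<pi>}" by blast
  qed (use Suc Cl_perm Cl_closed in blast)+
  have d1: "one \<inter> prime = {}" unfolding one_def prime_def by auto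
  have d2: "(one \<union> prime) \<inter> ser r = {}" for r
    unfolding one_def prime_def ser_def using perm_has_cut_length by fastforce
  have d3: "(one \<union> prime \<union> ser False) \<inter> ser True = {}"
    using d2[of True] not_both_cuts unfolding ser_def by blast
  have op: "?SR (one \<union> prime)" by (rule strongly_rational_wqo_Un[OF one prime d1])
  have ops: "?SR (one \<union> prime \<union> ser False)" by (rule strongly_rational_wqo_Un[OF op skew d2])
  have len: "length \<pi> = 1 \<or> 2 \<le> length \<pi>" if "\<pi> \<noteq> []" for \<pi> :: "nat list"
    using that by (cases \<pi>; cases "tl \<pi>") auto
  have ne: "\<pi> \<noteq> []" if "perm_has_cut r \<pi>" for r \<pi> using perm_has_cut_length[OF that] by auto
  have both: "(\<forall>r. \<not> perm_has_cut r \<pi>) \<longleftrightarrow> \<not> perm_has_cut True \<pi> \<and> \<not> perm_has_cut False \<pi>" for \<pi>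
    by (metis (full_types))
  \<comment> \<open>Sum components need not have smaller clique number; they come from the three
    families already treated at this level.\<close>
  have sum: "?SR (ser True)"
    unfolding ser_def
  proof (rule strongly_rational_series[OF ops])
    fix \<alpha> assume \<alpha>: "\<alpha> \<in> one \<union> prime \<union> ser False"
    then have "\<alpha> \<notin> ser True" "\<alpha> \<in> Cl (Suc l)" using d3 unfolding one_def prime_def ser_def by blast+
    moreover have "\<alpha> \<noteq> []" using \<alpha> ne unfolding one_def prime_def ser_def by auto
    ultimately show "is_perm \<alpha> \<and> \<alpha> \<noteq> [] \<and> \<not> perm_has_cut True \<alpha>" using Cl_perm unfolding ser_def by blast
  next
    fix \<pi> p \<alpha> assume \<pi>: "\<pi> \<in> Cl (Suc l)" "perm_has_cut True \<pi>" and p: "p < length \<pi>"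
      and sh: "shape \<alpha> (component True {..<length \<pi>} (\<lambda>i. i) (nth \<pi>) p) (\<lambda>i. i) (nth \<pi>)"
    define P where "P = {..<length \<pi>}"
    have pP: "p \<in> P" using p unfolding P_def by simp
    have sh': "shape \<pi> P (\<lambda>i. i) (nth \<pi>)" unfolding P_def by (rule shape_self[OF Cl_perm[OF \<pi>(1)]])
    define B where "B = component True P (\<lambda>i. i) (nth \<pi>) p"
    have shB: "shape \<alpha> B (\<lambda>i. i) (nth \<pi>)" using sh unfolding B_def P_def .
    have BP: "B \<subseteq> P" unfolding B_def by (rule component_subset)
    have "embeds id B (\<lambda>i. i) (nth \<pi>) P (\<lambda>i. i) (nth \<pi>)" unfolding embeds_def using BP by auto
    then have "contains_pattern \<pi> \<alpha>" by (rule shape_embeds_contains[OF sh' shB])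
    then have \<alpha>: "\<alpha> \<in> Cl (Suc l)" using Cl_closed[OF \<pi>(1)] shB unfolding shape_def by blast
    have "p \<in> B" unfolding B_def by (rule component_self[OF pP])
    moreover have "finite B" using BP unfolding P_def by (meson finite_lessThan finite_subset)
    ultimately have "\<alpha> \<noteq> []" using shape_length[OF shB] by auto
    moreover have "\<not> perm_has_cut True \<alpha>"
      using shape_has_cut[OF sh] component_no_cut[OF _ pP] unfolding has_cut_def P_def by blast
    ultimately show "\<alpha> \<in> one \<union> prime \<union> ser False"
      using \<alpha> len[of \<alpha>] both[of \<alpha>] unfolding one_def prime_def ser_def by blast
  qed (use Cl_perm Cl_closed in blast)+
  have "?SR (one \<union> prime \<union> ser False \<union> ser True)" by (rule strongly_rational_wqo_Un[OF ops sum d3])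
  moreover have "one \<union> prime \<union> ser False \<union> ser True = Cl (Suc l) - {[]}"
  proof (intro equalityI subsetI)
    fix \<pi> assume "\<pi> \<in> one \<union> prime \<union> ser False \<union> ser True"
    then show "\<pi> \<in> Cl (Suc l) - {[]}" using ne[of _ \<pi>] unfolding one_def prime_def ser_def by auto
  next
    fix \<pi> assume "\<pi> \<in> Cl (Suc l) - {[]}"
    then show "\<pi> \<in> one \<union> prime \<union> ser False \<union> ser True"
      using len[of \<pi>] both[of \<pi>] unfolding one_def prime_def ser_def by blast
  qed
  moreover have "?SR (one \<union> prime \<union> ser True)" by (rule strongly_rational_wqo_Un[OF op sum d2])
  moreover have "one \<union> prime \<union> ser True = {\<pi> \<in> Cl (Suc l) - {[]}. \<not> perm_has_cut False \<pi>}"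
  proof (intro equalityI subsetI)
    fix \<pi> assume \<pi>: "\<pi> \<in> one \<union> prime \<union> ser True"
    then have "\<pi> \<notin> ser False" using d2[of False] not_both_cuts unfolding ser_def by blast
    then show "\<pi> \<in> {\<pi> \<in> Cl (Suc l) - {[]}. \<not> perm_has_cut False \<pi>}"
      using \<pi> ne unfolding one_def prime_def ser_def by auto
  next
    fix \<pi> assume "\<pi> \<in> {\<pi> \<in> Cl (Suc l) - {[]}. \<not> perm_has_cut False \<pi>}"
    then show "\<pi> \<in> one \<union> prime \<union> ser True"
      using len[of \<pi>] both[of \<pi>] unfolding one_def prime_def ser_def by blast
  qed
  ultimately show ?case by simp
qed

theorem theorem6p3:
  fixes l :: nat
  shows "strongly_rational (Av {[2, 4, 1, 5, 3], [3, 1, 5, 2, 4], decreasing_perm l})"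
proof -
  define N where "N = Cl l - {[]}"
  have SR: "strongly_rational_wqo pattern_le length N" using strongly_rational_Cl unfolding N_def by blast
  have fl: "finite_levels length N" using SR unfolding strongly_rational_wqo_def by blast
  have rat: "rational_fps (gf length V)" if "upset_in pattern_le N V" for V
    using SR that unfolding strongly_rational_wqo_def by blast
  have "perm_class (Cl l)"
    unfolding perm_class_def using Cl_perm Cl_closed by blast
  moreover have "rational_fps (class_gf D)" if D: "perm_class D" "D \<subseteq> Cl l" for D
  proof -
    have up: "upset_in pattern_le N (N - D)"
      unfolding upset_in_def pattern_le_def
    proof (intro conjI ballI impI)
      fix a b assume a: "a \<in> N - D" and b: "b \<in> N" "contains_pattern b a"
      have "is_perm a" using a Cl_perm unfolding N_def by blast
      then show "b \<in> N - D" using a b D(1) unfolding perm_class_def by blast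
    qed blast
    have "upset_in pattern_le N N" unfolding upset_in_def by blast
    then have "rational_fps (gf length N - gf length (N - D))" by (intro rational_fps_diff rat up)
    moreover have "gf length (N - (N - D)) = gf length N - gf length (N - D)"
      by (rule gf_Diff[OF fl]) blast
    moreover have "N - (N - D) = D - {[]}" using D(2) unfolding N_def by blast
    ultimately have r: "rational_fps (gf length (D - {[]}))" by simp
    \<comment> \<open>The empty permutation had been left out because letters need positive size; it
      is added back here.\<close>
    have r0: "rational_fps (gf length (D \<inter> {[]}))"
      using gf_singleton[of "[] :: nat list"] by (cases "[] \<in> D") (simp_all add: Int_insert_right)
    have "finite_levels length (D - {[]})" "finite_levels length (D \<inter> {[]})"
      using finite_levels_subset[OF fl, of "D - {[]}"] D(2) unfolding N_def finite_levels_def by auto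
    then have "gf length ((D - {[]}) \<union> (D \<inter> {[]})) = gf length (D - {[]}) + gf length (D \<inter> {[]})"
      by (rule gf_Un) blast
    moreover have "(D - {[]}) \<union> (D \<inter> {[]}) = D" by blast
    moreover have "class_gf D = gf length D" unfolding class_gf_def gf_def ..
    ultimately show ?thesis using rational_fps_add[OF r r0] by simp
  qed
  ultimately show ?thesis unfolding strongly_rational_def Cl_def by blast
qed

end
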